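(* Let $\lambda=(p,0,r;a,1/2;x)\in\mathcal{I}$ with $p,r$ positive integers, and let $\lambda'=(p,0,r;a',1/2;x)$ with $a'=1-2p/r-a$ be its dual. Then $\lambda$ and $\lambda'$ are both non-elementary solutions to Problem I if and only if all of the following hold: (1) $s:=r/p$ is an integer with $s\ge2$ and $p(s-1)\equiv0\pmod2$; (2) $(s-1)^{s-1}x^s-s^s(1-x)^{s-1}=0$; (3) there exist $j,j'\in\mathbb{Z}_{\ge0}$ with $j+j'=s-2$, $a=j/s$, $a'=j'/s$, and $$\mathcal{F}_k\big(\chi(j,k;s);\,1/2-k;\,x\big)\cdot\mathcal{F}_{k'}\big(\chi(j',k';s);\,1/2-k';\,x\big)=0$$ for all $k,k'\in\mathbb{Z}_{\ge0}$ with $k+k'=r-1$.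
   Context: For $\lambda=(p,q,r;a,b;x)\in\mathbb{R}^6$ with $0<x<1$ put $f(w;\lambda):={}_2F_1(pw+a,\,qw+b;\,rw;\,x)$ (Gauss hypergeometric function, meromorphic in $w\in\mathbb{C}$). $\lambda$ is a solution to Problem I if there are $C,d\in\mathbb{C}^\times$, $u_i,v_j\in\mathbb{C}$ with $f(w;\lambda)=C\,d^w\prod_{i=1}^m\Gamma(w+u_i)/\prod_{j=1}^n\Gamma(w+v_j)$ identically in $w$. $\lambda$ is elementary if $f(w;\lambda)$ has finitely many poles in $w$. $\mathcal{I}:=\{(p,0,r;a,b;x)\in\mathbb{R}^6:0<p<r,\ 0<x<1\}$. $(\alpha)_0=1$, $(\alpha)_k=\alpha(\alpha+1)\cdots(\alpha+k-1)$. For $k\in\mathbb{Z}_{\ge0}$: $\mathcal{F}_k(\beta;\gamma;z):=\sum_{j=0}^k(-1)^j\binom kj(\beta)_j(\gamma+j)_{k-j}z^j$. For $j,k\in\mathbb{Z}_{\ge0}$, $s\in\mathbb{Z}_{\ge2}$: $\chi(j,k;s):=-\frac1s\{j+(s-1)(k-\frac12)\}$. *)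

theory Defs
  imports "HOL-Complex_Analysis.Complex_Analysis"
begin

definition hyp2F1 :: "complex \<Rightarrow> complex \<Rightarrow> complex \<Rightarrow> complex \<Rightarrow> complex" where
  "hyp2F1 \<alpha> \<beta> \<gamma> z =
     (\<Sum>k. pochhammer \<alpha> k * pochhammer \<beta> k / (pochhammer \<gamma> k * fact k) * z ^ k)"

definition hgf :: "real \<Rightarrow> real \<Rightarrow> real \<Rightarrow> real \<Rightarrow> real \<Rightarrow> real \<Rightarrow> complex \<Rightarrow> complex" where
  "hgf p q r a b x w =
     hyp2F1 (of_real p * w + of_real a) (of_real q * w + of_real b) (of_real r * w) (of_real x)"

(* lambda solves Problem I: f(w) = C d^w prod Gamma(w+u_i) / prod Gamma(w+v_j)
   identically in w (i.e. as meromorphic functions: equality off a discrete set).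
   d^w = exp (w * L) for a logarithm L of d. *)
definition solves_problem_I :: "real \<Rightarrow> real \<Rightarrow> real \<Rightarrow> real \<Rightarrow> real \<Rightarrow> real \<Rightarrow> bool" where
  "solves_problem_I p q r a b x \<longleftrightarrow>
     (\<exists>(C::complex) (d::complex) (L::complex) (us::complex list) (vs::complex list).
        C \<noteq> 0 \<and> d \<noteq> 0 \<and> exp L = d \<and>
        (\<forall>\<^sub>F w in cosparse UNIV.
           hgf p q r a b x w =
             C * exp (w * L) * (\<Prod>u\<leftarrow>us. Gamma (w + u)) / (\<Prod>v\<leftarrow>vs. Gamma (w + v))))"

definition elementary :: "real \<Rightarrow> real \<Rightarrow> real \<Rightarrow> real \<Rightarrow> real \<Rightarrow> real \<Rightarrow> bool" where
  "elementary p q r a b x \<longleftrightarrow> finite {w. is_pole (hgf p q r a b x) w}"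

definition Fk :: "nat \<Rightarrow> real \<Rightarrow> real \<Rightarrow> real \<Rightarrow> real" where
  "Fk k \<beta> \<gamma> z = (\<Sum>j = 0..k. (-1) ^ j * real (k choose j) * pochhammer \<beta> j
                              * pochhammer (\<gamma> + real j) (k - j) * z ^ j)"

definition chi :: "nat \<Rightarrow> nat \<Rightarrow> nat \<Rightarrow> real" where
  "chi j k s = - (1 / real s) * (real j + (real s - 1) * (real k - 1 / 2))"

end

(*
  Put alpha = p w + a, gamma = r w.  The functions f(w) = F(alpha, 1/2; gamma; x) and
  fd(w) = F(1 - alpha, 1/2; 2 - gamma; x) satisfy, up to explicit factors, the same contiguity
  relations, and fd(w) is the function of the dual parameters at 2/r - w.  Their Casoratian for the
  shift w -> w + 1, cleared of denominators, is (gamma - 1) P(w), where P = 0 or deg P < r.  At the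
  r nodes gamma = 1/2 - k, 0 <= k < r, it reduces to f(w) fd(w + 1), which by Euler's
  transformation is a nonzero multiple of F_k F_k'.  Hence the conditions on F_k F_k' say P = 0.

  If P = 0, then f(w + 1) / f(w) is bounded outside a disc, because f has a positive limit in right
  half planes and fd has one in left half planes.  So this ratio is rational, and comparing w with
  w + n for large n yields the gamma product.

  Conversely, gamma products for f and fd make both ratios rational.  If P were not zero, f fd would be
  rational, contradicting the infinitely many poles of f, at which fd does not vanish.  So P = 0.
  Zeros of (alpha)_p along chains w + n force s and s a to be integers.  Comparing the two
  ratios at infinity to leading order gives (2) and the parity condition; the order w^(-2) gives
  j j' >= s^2/6 - 17 (s - 1)/12 > -(s - 1), which excludes negative j and j'.
*)
theory Submission
  imports
    Defs
    "HOL-Computational_Algebra.Fundamental_Theorem_Algebra"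
    "HOL-Real_Asymp.Real_Asymp"
begin

section \<open>Contiguity relations and Euler's transformation\<close>

text \<open>The value b = 1/2 is special because the second local solution at 0 of the
  hypergeometric equation is z^(1-gamma) (1-z)^(gamma-alpha-b) F(1-alpha, 1-b; 2-gamma; z), and here
  1 - b = b. The companion of the family is thus a family of the same shape, which is why lambda and
  its dual are treated together. The shift w -> w + 1 moves (alpha, gamma) by (p, r): p steps (1, 1)
  and r - p steps (0, 1). Each step costs one degree, so the bound deg P < r equals the number of
  nodes. The nodes are zeros of (gamma - 1/2)_r, the factor that clears the denominators of the
  second sequence; there one of the two products in the Casoratian disappears. The obstacle in the
  converse direction is that the series controls f only where Re w is bounded below, and fd only
  where it is bounded above; neither half alone makes f(w + 1) / f(w) rational. At a nonpositive
  integer gamma the value of \<open>hyp2F1\<close> is an artefact of division by zero, so functional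
  equations are stated away from these points, and analytic arguments use the entire function f /
  Gamma(gamma).\<close>

definition hyp_fps :: "complex \<Rightarrow> complex \<Rightarrow> complex \<Rightarrow> complex fps" where
  "hyp_fps a b c = Abs_fps (\<lambda>n. pochhammer a n * pochhammer b n / (pochhammer c n * fact n))"

lemma hyp_fps_nth [simp]:
  "fps_nth (hyp_fps a b c) n = pochhammer a n * pochhammer b n / (pochhammer c n * fact n)"
  by (simp add: hyp_fps_def)

lemma pochhammer_neq_0_nonpos:
  fixes c :: complex
  assumes "c \<notin> \<int>\<^sub>\<le>\<^sub>0"
  shows "pochhammer c n \<noteq> 0"
  using assms by (auto simp: pochhammer_eq_0_iff)

lemma plus_of_nat_neq_0_nonpos:
  fixes c :: complex
  assumes "c \<notin> \<int>\<^sub>\<le>\<^sub>0"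
  shows "c + of_nat n \<noteq> 0"
  using pochhammer_neq_0_nonpos[OF assms, of "Suc n"] by (simp add: pochhammer_Suc)

lemma pochhammer_shift: "(a::complex) * pochhammer (a + 1) n = pochhammer a n * (a + of_nat n)"
  by (metis pochhammer_rec pochhammer_Suc)

text \<open>Valid for every c: if c + n = 0, both sides are 0 by the convention on division, and the
  series breaks off there. The ratio test for the radius of convergence relies on this.\<close>

lemma hyp_fps_Suc:
  "fps_nth (hyp_fps a b c) (Suc n) =
     fps_nth (hyp_fps a b c) n * ((a + of_nat n) * (b + of_nat n) / ((c + of_nat n) * of_nat (Suc n)))"
  by (simp add: pochhammer_Suc mult_ac)

lemma hyp_fps_up:
  assumes "c \<notin> \<int>\<^sub>\<le>\<^sub>0"
  shows "a * fps_nth (hyp_fps (a + 1) b (c + 1)) n * (c + of_nat n) =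
         c * fps_nth (hyp_fps a b c) n * (a + of_nat n)"
proof -
  have "c \<noteq> 0" "c + of_nat n \<noteq> 0" "pochhammer c n \<noteq> 0"
    using assms plus_of_nat_neq_0_nonpos[OF assms] pochhammer_neq_0_nonpos[OF assms] by auto
  note nz = this
  have e: "pochhammer (c + 1) n = pochhammer c n * (c + of_nat n) / c"
    using pochhammer_shift[of c n] \<open>c \<noteq> 0\<close> by (simp add: field_simps)
  have "a * fps_nth (hyp_fps (a + 1) b (c + 1)) n * (c + of_nat n) =
      (a * pochhammer (a + 1) n) * (c * (pochhammer b n / (pochhammer c n * fact n)))"
    using nz unfolding hyp_fps_nth e by (simp add: divide_simps)
  thus ?thesis
    unfolding pochhammer_shift by simp
qed

lemma hyp_fps_c_up:
  assumes "c \<notin> \<int>\<^sub>\<le>\<^sub>0"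
  shows "fps_nth (hyp_fps a b (c + 1)) n * (c + of_nat n) = c * fps_nth (hyp_fps a b c) n"
proof -
  have "c \<noteq> 0" "c + of_nat n \<noteq> 0" "pochhammer c n \<noteq> 0"
    using assms plus_of_nat_neq_0_nonpos[OF assms] pochhammer_neq_0_nonpos[OF assms] by auto
  note nz = this
  have e: "pochhammer (c + 1) n = pochhammer c n * (c + of_nat n) / c"
    using pochhammer_shift[of c n] \<open>c \<noteq> 0\<close> by (simp add: field_simps)
  show ?thesis
    using nz unfolding hyp_fps_nth e by (simp add: divide_simps)
qed

text \<open>Raising operator for the step (a, c) -> (a + 1, c + 1). Together with the lowering
  operator \<open>hyp_fps_ladder2\<close> it replaces derivatives by neighbouring series, so that
  later identities become pure algebra.\<close>

lemma hyp_fps_ladder1: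
  assumes "c \<notin> \<int>\<^sub>\<le>\<^sub>0"
  shows "(1 - fps_X) * fps_deriv (hyp_fps a b c) =
         fps_const a * hyp_fps a b c - fps_const (a * (c - b) / c) * hyp_fps (a + 1) b (c + 1)"
proof (rule fps_ext)
  fix n
  let ?A = "fps_nth (hyp_fps a b c)" and ?B = "fps_nth (hyp_fps (a+1) b (c+1))"
  have cn: "c + of_nat n \<noteq> 0" "c \<noteq> 0"
    using plus_of_nat_neq_0_nonpos[OF assms] assms by auto
  have B: "a * ?B n / c = ?A n * (a + of_nat n) / (c + of_nat n)"
    using hyp_fps_up[OF assms, of a b n] cn by (simp add: field_simps del: hyp_fps_nth)
  have S: "of_nat (Suc n) * ?A (Suc n) = ?A n * ((a + of_nat n) * (b + of_nat n) / (c + of_nat n))"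
    unfolding hyp_fps_Suc using of_nat_neq_0[where ?'a = complex, of n]
    by (simp add: divide_simps del: of_nat_Suc hyp_fps_nth)
  have "fps_nth ((1 - fps_X) * fps_deriv (hyp_fps a b c)) n = of_nat (Suc n) * ?A (Suc n) - of_nat n * ?A n"
    by (cases n) (simp_all add: left_diff_distrib del: hyp_fps_nth of_nat_Suc)
  also have "\<dots> = a * ?A n - (c - b) * (a * ?B n / c)"
    unfolding B S using cn by (simp add: divide_simps del: hyp_fps_nth) (simp add: algebra_simps del: hyp_fps_nth)
  also have "\<dots> = fps_nth (fps_const a * hyp_fps a b c - fps_const (a * (c - b) / c) * hyp_fps (a + 1) b (c + 1)) n"
    by (simp del: hyp_fps_nth)
  finally show "fps_nth ((1 - fps_X) * fps_deriv (hyp_fps a b c)) n = \<dots>" .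
qed

lemma hyp_fps_ladder2:
  assumes "c \<notin> \<int>\<^sub>\<le>\<^sub>0"
  shows "fps_X * ((1 - fps_X) * fps_deriv (hyp_fps (a + 1) b (c + 1))) =
         fps_const c * hyp_fps a b c + (fps_const b * fps_X - fps_const c) * hyp_fps (a + 1) b (c + 1)"
proof (rule fps_ext)
  fix n
  let ?A = "fps_nth (hyp_fps a b c)" and ?B = "fps_nth (hyp_fps (a+1) b (c+1))"
  show "fps_nth (fps_X * ((1 - fps_X) * fps_deriv (hyp_fps (a + 1) b (c + 1)))) n =
    fps_nth (fps_const c * hyp_fps a b c + (fps_const b * fps_X - fps_const c) * hyp_fps (a + 1) b (c + 1)) n"
  proof (cases n)
    case 0
    then show ?thesis by simp
  next
    case (Suc m)
    have cn: "c + of_nat m \<noteq> 0" "c + of_nat (Suc m) \<noteq> 0" "c + 1 + of_nat m \<noteq> 0" "c \<noteq> 0"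
      using plus_of_nat_neq_0_nonpos[OF assms, of m] plus_of_nat_neq_0_nonpos[OF assms, of "Suc m"] assms
      by (auto simp: add_ac)
    have "c * ?A (Suc m) * of_nat (Suc m) = c * ?A m * (a + of_nat m) * (b + of_nat m) / (c + of_nat m)"
      unfolding hyp_fps_Suc using of_nat_neq_0[where ?'a = complex, of m]
      by (simp add: divide_simps del: of_nat_Suc hyp_fps_nth)
    also have "c * ?A m * (a + of_nat m) = a * ?B m * (c + of_nat m)"
      using hyp_fps_up[OF assms, of a b m] by simp
    also have "a * ?B m * (c + of_nat m) * (b + of_nat m) / (c + of_nat m) = a * ?B m * (b + of_nat m)"
      using cn by (simp del: hyp_fps_nth)
    finally have A: "c * ?A (Suc m) = a * ?B m * (b + of_nat m) / of_nat (Suc m)"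
      using of_nat_neq_0[where ?'a = complex, of m] by (simp add: field_simps del: of_nat_Suc hyp_fps_nth)
    have B: "(c + 1 + of_nat m) * ?B (Suc m) = ?B m * ((a + 1 + of_nat m) * (b + of_nat m)) / of_nat (Suc m)"
      unfolding hyp_fps_Suc using cn
      by (simp add: divide_simps del: of_nat_Suc hyp_fps_nth)
    have "(c + 1 + of_nat m) * ?B (Suc m) = c * ?A (Suc m) + (b + of_nat m) * ?B m"
      unfolding A B using of_nat_neq_0[where ?'a = complex, of m]
      by (simp add: divide_simps del: of_nat_Suc hyp_fps_nth) (simp add: algebra_simps del: hyp_fps_nth)
    hence "of_nat (Suc m) * ?B (Suc m) - of_nat m * ?B m = c * ?A (Suc m) + b * ?B m - c * ?B (Suc m)"
      by (simp add: algebra_simps del: hyp_fps_nth)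
    moreover have "fps_nth (fps_X * ((1 - fps_X) * fps_deriv (hyp_fps (a + 1) b (c + 1)))) n =
        of_nat (Suc m) * ?B (Suc m) - of_nat m * ?B m"
      unfolding Suc by (cases m) (simp_all add: left_diff_distrib del: hyp_fps_nth of_nat_Suc)
    moreover have "fps_nth (fps_const c * hyp_fps a b c + (fps_const b * fps_X - fps_const c) * hyp_fps (a + 1) b (c + 1)) n =
        c * ?A (Suc m) + b * ?B m - c * ?B (Suc m)"
      unfolding Suc by (simp add: left_diff_distrib mult.assoc del: hyp_fps_nth)
    ultimately show ?thesis by simp
  qed
qed

text \<open>The raising operator at (a + 1, c + 1) and the lowering operator at (a, c) both compute
  the derivative of the middle series; eliminating it leaves three neighbours.\<close>

lemma hyp_fps_three_term:
  assumes "c \<notin> \<int>\<^sub>\<le>\<^sub>0"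
  shows "fps_const c * hyp_fps a b c =
         (fps_const c + fps_const (a + 1 - b) * fps_X) * hyp_fps (a + 1) b (c + 1)
         - fps_const ((c + 1 - b) * (a + 1) / (c + 1)) * fps_X * hyp_fps (a + 2) b (c + 2)"
proof -
  have c1: "c + 1 \<notin> \<int>\<^sub>\<le>\<^sub>0"
    using assms plus_one_in_nonpos_Ints_imp by blast
  define A A1 A2 where "A = hyp_fps a b c" and "A1 = hyp_fps (a + 1) b (c + 1)"
    and "A2 = hyp_fps (a + 2) b (c + 2)"
  define D where "D = (1 - fps_X) * fps_deriv A1"
  define k where "k = fps_const ((c + 1 - b) * (a + 1) / (c + 1))"
  have 1: "D = fps_const (a + 1) * A1 - k * A2"
    using hyp_fps_ladder1[OF c1, of "a+1" b]
    by (simp add: add.assoc D_def A1_def A2_def k_def mult.commute)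
  have 2: "fps_X * D = fps_const c * A + (fps_const b * fps_X - fps_const c) * A1"
    using hyp_fps_ladder2[OF assms, of a b] by (simp add: D_def A1_def A_def)
  have "fps_const c * A = fps_X * D - (fps_const b * fps_X - fps_const c) * A1"
    unfolding 2 by simp
  also have "\<dots> = (fps_const c + (fps_const (a + 1) - fps_const b) * fps_X) * A1 - k * fps_X * A2"
    unfolding 1 by (simp only: algebra_simps)
  finally show ?thesis
    unfolding A_def A1_def A2_def k_def by (simp only: fps_const_sub)
qed

lemma hyp_fps_raise_c:
  assumes "c \<notin> \<int>\<^sub>\<le>\<^sub>0"
  shows "fps_const ((c - a) / c) * hyp_fps a b (c + 1) =
         hyp_fps a b c - fps_const (a / c) * hyp_fps (a + 1) b (c + 1)"
proof (rule fps_ext)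
  fix n
  have cn: "c + of_nat n \<noteq> 0" "c \<noteq> 0"
    using plus_of_nat_neq_0_nonpos[OF assms] assms by auto
  have 1: "fps_nth (hyp_fps a b (c + 1)) n = c * fps_nth (hyp_fps a b c) n / (c + of_nat n)"
    using hyp_fps_c_up[OF assms, of a b n] cn by (simp add: field_simps del: hyp_fps_nth)
  have 2: "a * fps_nth (hyp_fps (a + 1) b (c + 1)) n = c * fps_nth (hyp_fps a b c) n * (a + of_nat n) / (c + of_nat n)"
    using hyp_fps_up[OF assms, of a b n] cn by (simp add: field_simps del: hyp_fps_nth)
  have "fps_nth (hyp_fps a b c - fps_const (a / c) * hyp_fps (a + 1) b (c + 1)) n =
      fps_nth (hyp_fps a b c) n - (a * fps_nth (hyp_fps (a + 1) b (c + 1)) n) / c"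
    by (simp del: hyp_fps_nth)
  also have "\<dots> = (c - a) / c * (fps_nth (hyp_fps a b (c + 1)) n)"
    unfolding 1 2 using cn by (simp add: divide_simps del: hyp_fps_nth) (simp add: algebra_simps del: hyp_fps_nth)
  finally show "fps_nth (fps_const ((c - a) / c) * hyp_fps a b (c + 1)) n =
     fps_nth (hyp_fps a b c - fps_const (a / c) * hyp_fps (a + 1) b (c + 1)) n"
    by (simp del: hyp_fps_nth)
qed

lemma hyp_fps_lower_a:
  assumes "c \<notin> \<int>\<^sub>\<le>\<^sub>0"
  shows "(1 - fps_X) * hyp_fps a b c =
         hyp_fps (a - 1) b c - fps_const ((c - b) / c) * fps_X * hyp_fps a b (c + 1)"
proof (rule fps_ext)
  fix n
  show "fps_nth ((1 - fps_X) * hyp_fps a b c) n =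
    fps_nth (hyp_fps (a - 1) b c - fps_const ((c - b) / c) * fps_X * hyp_fps a b (c + 1)) n"
  proof (cases n)
    case 0
    then show ?thesis by simp
  next
    case (Suc m)
    have cn: "c + of_nat m \<noteq> 0" "c \<noteq> 0" "pochhammer c m \<noteq> 0"
      using plus_of_nat_neq_0_nonpos[OF assms] assms pochhammer_neq_0_nonpos[OF assms] by auto
    let ?A = "fps_nth (hyp_fps a b c) m"
    have 1: "fps_nth (hyp_fps a b (c + 1)) m = c * ?A / (c + of_nat m)"
      using hyp_fps_c_up[OF assms, of a b m] cn by (simp add: field_simps del: hyp_fps_nth)
    have 2: "fps_nth (hyp_fps (a - 1) b c) (Suc m) = ?A * ((a - 1) * (b + of_nat m) / ((c + of_nat m) * of_nat (Suc m)))"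
      using pochhammer_rec[of "a - 1" m] by (simp add: pochhammer_Suc[of c] pochhammer_Suc[of b] mult_ac)
    have "fps_nth ((1 - fps_X) * hyp_fps a b c) n = fps_nth (hyp_fps a b c) (Suc m) - ?A"
      by (simp add: Suc left_diff_distrib del: hyp_fps_nth)
    also have "\<dots> = fps_nth (hyp_fps (a - 1) b c) (Suc m) - (c - b) / c * fps_nth (hyp_fps a b (c + 1)) m"
      unfolding 1 2 hyp_fps_Suc[of a b c m] using cn of_nat_neq_0[where ?'a = complex, of m]
      by (simp add: divide_simps del: hyp_fps_nth of_nat_Suc) (simp add: algebra_simps del: hyp_fps_nth)
    finally show ?thesis
      by (simp add: Suc mult.assoc del: hyp_fps_nth)
  qed
qed

text \<open>The Casoratian of the two local solutions for the single step (1, 1). The ladders show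
  that 1 - X times its derivative cancels, and its constant term is 1. For b = 1/2 the factors with
  parameter 1 - b belong to the dual family.\<close>

lemma hyp_fps_legendre:
  assumes "c \<notin> \<int>"
  shows "hyp_fps a b c * hyp_fps (-a) (1 - b) (1 - c)
         - fps_const (a * (c - b) / (c * (c - 1))) * fps_X * hyp_fps (a + 1) b (c + 1) * hyp_fps (1 - a) (1 - b) (2 - c) = 1"
    (is "?W = 1")
proof -
  have c: "c \<notin> \<int>\<^sub>\<le>\<^sub>0" "1 - c \<notin> \<int>\<^sub>\<le>\<^sub>0" "c \<noteq> 0" "c \<noteq> 1"
    using assms nonpos_Ints_Int by (auto dest!: nonpos_Ints_Int)
  define A B A1 B1 where "A = hyp_fps a b c" and "B = hyp_fps (-a) (1 - b) (1 - c)"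
    and "A1 = hyp_fps (a + 1) b (c + 1)" and "B1 = hyp_fps (1 - a) (1 - b) (2 - c)"
  define k where "k = a * (c - b) / (c * (c - 1))"
  define K where "K = fps_const k"
  have eqs: "a * (c - b) / c = k * (c - 1)" "(-a) * (1 - c - (1 - b)) / (1 - c) = - (k * c)"
    using c unfolding k_def by (simp_all add: divide_simps) (simp_all add: algebra_simps)
  have d1: "(1 - fps_X) * fps_deriv A = fps_const a * A - K * (fps_const c - 1) * A1"
    using hyp_fps_ladder1[OF c(1), of a b] unfolding eqs A_def A1_def K_def
    by (metis fps_const_1_eq_1 fps_const_mult fps_const_sub)
  have d2: "(1 - fps_X) * fps_deriv B = - fps_const a * B + K * fps_const c * B1"
    using hyp_fps_ladder1[OF c(2), of "-a" "1-b"] unfolding eqs B_def B1_def K_def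
    by (simp add: algebra_simps flip: fps_const_neg)
  have d3: "fps_X * ((1 - fps_X) * fps_deriv A1) = fps_const c * A + (fps_const b * fps_X - fps_const c) * A1"
    using hyp_fps_ladder2[OF c(1), of a b] unfolding A_def A1_def .
  have d4: "fps_X * ((1 - fps_X) * fps_deriv B1) =
        (1 - fps_const c) * B + ((1 - fps_const b) * fps_X - (1 - fps_const c)) * B1"
    using hyp_fps_ladder2[OF c(2), of "-a" "1-b"] unfolding B_def B1_def
    by (simp add: algebra_simps flip: fps_const_sub)
  have W: "?W = A * B - K * fps_X * A1 * B1"
    unfolding A_def B_def A1_def B1_def K_def k_def ..
  have "(1 - fps_X) * fps_deriv ?W =
       ((1 - fps_X) * fps_deriv A) * B + A * ((1 - fps_X) * fps_deriv B)
       - K * ((1 - fps_X) * A1 * B1 + (fps_X * ((1 - fps_X) * fps_deriv A1)) * B1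
              + A1 * (fps_X * ((1 - fps_X) * fps_deriv B1)))"
    unfolding W by (simp add: K_def algebra_simps)
  also have "\<dots> = 0"
    unfolding d1 d2 d3 d4 by (simp add: algebra_simps del: fps_const_neg)
  finally have "fps_deriv ?W = 0"
    by (metis (no_types, lifting) fps_X_neq_one mult_eq_0_iff right_minus_eq)
  hence "?W = fps_const (fps_nth ?W 0)"
    by (simp only: fps_deriv_eq_0_iff)
  also have "fps_nth ?W 0 = 1"
    by (simp add: mult.assoc)
  finally show ?thesis by simp
qed

section \<open>Euler's transformation through the hypergeometric differential equation\<close>

text \<open>The binomial series of (1 - X)^(-d). It is handled through the equation (1 - X) G' = d
  G, which avoids complex powers.\<close>

definition binom_fps :: "complex \<Rightarrow> complex fps" where
  "binom_fps d = Abs_fps (\<lambda>n. pochhammer d n / fact n)"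

lemma binom_fps_deriv: "(1 - fps_X) * fps_deriv (binom_fps d) = fps_const d * binom_fps d"
proof (rule fps_ext)
  fix n
  have "fps_nth ((1 - fps_X) * fps_deriv (binom_fps d)) n =
      of_nat (Suc n) * fps_nth (binom_fps d) (Suc n) - of_nat n * fps_nth (binom_fps d) n"
    by (cases n) (simp_all add: left_diff_distrib del: of_nat_Suc)
  also have "of_nat (Suc n) * fps_nth (binom_fps d) (Suc n) = (d + of_nat n) * fps_nth (binom_fps d) n"
    using of_nat_neq_0[where ?'a = complex, of n]
    by (simp add: binom_fps_def pochhammer_Suc divide_simps del: of_nat_Suc)
  finally show "fps_nth ((1 - fps_X) * fps_deriv (binom_fps d)) n = fps_nth (fps_const d * binom_fps d) n"
    by (simp add: algebra_simps)
qed

lemma binom_fps_inverse: "binom_fps d * binom_fps (-d) = 1"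
proof -
  have "(1 - fps_X) * fps_deriv (binom_fps d * binom_fps (-d)) =
      ((1 - fps_X) * fps_deriv (binom_fps d)) * binom_fps (-d) +
      binom_fps d * ((1 - fps_X) * fps_deriv (binom_fps (-d)))"
    by (simp add: algebra_simps)
  also have "\<dots> = 0"
    unfolding binom_fps_deriv by (simp add: algebra_simps flip: fps_const_neg)
  finally have "fps_deriv (binom_fps d * binom_fps (-d)) = 0"
    by (metis (no_types, lifting) fps_X_neq_one mult_eq_0_iff right_minus_eq)
  hence "binom_fps d * binom_fps (-d) = fps_const (fps_nth (binom_fps d * binom_fps (-d)) 0)"
    by (simp only: fps_deriv_eq_0_iff)
  thus ?thesis by (simp add: binom_fps_def)
qed

definition hyp_ode :: "complex \<Rightarrow> complex \<Rightarrow> complex \<Rightarrow> complex fps \<Rightarrow> complex fps" where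
  "hyp_ode a b c F = fps_X * ((1 - fps_X) * fps_deriv (fps_deriv F))
     + (fps_const c - (fps_const a + fps_const b + 1) * fps_X) * fps_deriv F - fps_const a * fps_const b * F"

lemma hyp_ode_nth:
  "fps_nth (hyp_ode a b c F) n =
     of_nat (Suc n) * (c + of_nat n) * fps_nth F (Suc n) - (a + of_nat n) * (b + of_nat n) * fps_nth F n"
proof -
  have "fps_nth (hyp_ode a b c F) n = fps_nth (fps_X * fps_deriv (fps_deriv F)) n
      - fps_nth (fps_X * (fps_X * fps_deriv (fps_deriv F))) n
      + c * fps_nth (fps_deriv F) n - (a + b + 1) * fps_nth (fps_X * fps_deriv F) n - a * b * fps_nth F n"
    unfolding hyp_ode_def
    by (simp add: algebra_simps)
  thus ?thesis
    by (cases n; cases "n - 1") (simp_all add: algebra_simps)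
qed

lemma hyp_ode_hyp_fps:
  assumes "c \<notin> \<int>\<^sub>\<le>\<^sub>0"
  shows "hyp_ode a b c (hyp_fps a b c) = 0"
proof (rule fps_ext)
  fix n
  have "c + of_nat n \<noteq> 0" "of_nat (Suc n) \<noteq> (0::complex)"
    using plus_of_nat_neq_0_nonpos[OF assms] by (simp_all del: of_nat_Suc)
  thus "fps_nth (hyp_ode a b c (hyp_fps a b c)) n = fps_nth 0 n"
    unfolding hyp_ode_nth hyp_fps_Suc by (simp add: divide_simps del: of_nat_Suc hyp_fps_nth)
qed

text \<open>The equation is a recursion for the coefficients whose leading factor (n + 1)(c + n)
  never vanishes, so the constant term fixes the solution.\<close>

lemma hyp_ode_unique:
  assumes c: "c \<notin> \<int>\<^sub>\<le>\<^sub>0" and F: "hyp_ode a b c F = 0" "fps_nth F 0 = 1"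
  shows "F = hyp_fps a b c"
proof (rule fps_ext)
  fix n show "fps_nth F n = fps_nth (hyp_fps a b c) n"
  proof (induction n)
    case 0
    then show ?case using F by simp
  next
    case (Suc n)
    have nz: "c + of_nat n \<noteq> 0" "of_nat (Suc n) \<noteq> (0::complex)"
      using plus_of_nat_neq_0_nonpos[OF c] by (simp_all del: of_nat_Suc)
    have "of_nat (Suc n) * (c + of_nat n) * fps_nth F (Suc n) = (a + of_nat n) * (b + of_nat n) * fps_nth F n"
      using hyp_ode_nth[of a b c F n] F(1) by simp
    hence "fps_nth F (Suc n) = (a + of_nat n) * (b + of_nat n) * fps_nth F n / ((c + of_nat n) * of_nat (Suc n))"
      using nz by (simp add: nonzero_eq_divide_eq mult_ac del: of_nat_Suc)
    thus ?case unfolding hyp_fps_Suc Suc.IH[symmetric] by simp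
  qed
qed

lemma hyp_fps_euler:
  assumes c: "c \<notin> \<int>\<^sub>\<le>\<^sub>0"
  shows "binom_fps (c - a - b) * hyp_fps a b c = hyp_fps (c - a) (c - b) c"
proof (rule hyp_ode_unique[OF c])
  define d where "d = c - a - b"
  define G F where "G = binom_fps d" and "F = hyp_fps a b c"
  define C A B where "C = fps_const c" and "A = fps_const a" and "B = fps_const b"
  let ?D = "C - A - B"
  have CAB: "fps_const (c - a) = C - A" "fps_const (c - b) = C - B" "fps_const d = ?D"
    unfolding C_def A_def B_def d_def by (simp_all flip: fps_const_sub)
  have G1: "(1 - fps_X) * fps_deriv G = ?D * G"
    using binom_fps_deriv[of d] unfolding G_def CAB .
  have "fps_deriv ((1 - fps_X) * fps_deriv G) = ?D * fps_deriv G"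
    unfolding G1 by (simp add: C_def A_def B_def)
  hence "(1 - fps_X) * fps_deriv (fps_deriv G) = (?D + 1) * fps_deriv G"
    by (simp add: algebra_simps)
  hence G2: "(1 - fps_X) * ((1 - fps_X) * fps_deriv (fps_deriv G)) = (?D + 1) * (?D * G)"
    by (metis G1 mult.left_commute)
  have F: "fps_X * ((1 - fps_X) * fps_deriv (fps_deriv F)) = A * B * F - (C - (A + B + 1) * fps_X) * fps_deriv F"
    using hyp_ode_hyp_fps[OF c, of a b] unfolding hyp_ode_def F_def A_def B_def C_def by (simp add: algebra_simps)
  \<comment> \<open>After multiplication by 1 - X, the derivatives of G occur only in the
    combinations of \<open>G1\<close> and \<open>G2\<close>, and the second derivative of F only as
    in \<open>F\<close>. What remains is a polynomial identity.\<close>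
  have "(1 - fps_X) * hyp_ode (c - a) (c - b) c (G * F) =
      fps_X * (((1 - fps_X) * ((1 - fps_X) * fps_deriv (fps_deriv G))) * F
        + 2 * (1 - fps_X) * ((1 - fps_X) * fps_deriv G) * fps_deriv F)
      + (1 - fps_X) * G * (fps_X * ((1 - fps_X) * fps_deriv (fps_deriv F)))
      + (C - ((C - A) + (C - B) + 1) * fps_X) * (((1 - fps_X) * fps_deriv G) * F + (1 - fps_X) * G * fps_deriv F)
      - (C - A) * (C - B) * (1 - fps_X) * G * F"
    unfolding hyp_ode_def CAB C_def[symmetric] by (simp add: algebra_simps)
  also have "\<dots> = 0"
    unfolding G1 G2 F by (simp add: algebra_simps)
  finally show "hyp_ode (c - a) (c - b) c (binom_fps (c - a - b) * hyp_fps a b c) = 0"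
    unfolding G_def F_def d_def
    by (metis (no_types, lifting) fps_X_neq_one mult_eq_0_iff right_minus_eq)
  show "fps_nth (binom_fps (c - a - b) * hyp_fps a b c) 0 = 1"
    by (simp add: binom_fps_def)
qed

section \<open>Convergence in the unit disc and evaluation\<close>

lemma tendsto_shift_quotient: "(\<lambda>n. (a + of_nat n) / (c + of_nat n) :: complex) \<longlonglongrightarrow> 1"
proof -
  have inf: "filterlim (\<lambda>n. c + of_nat n :: complex) at_infinity sequentially"
    by (rule tendsto_add_filterlim_at_infinity[OF tendsto_const tendsto_of_nat])
  hence "(\<lambda>n. 1 + (a - c) / (c + of_nat n)) \<longlonglongrightarrow> 1 + 0"
    by (intro tendsto_add tendsto_const tendsto_divide_0[OF tendsto_const])
  moreover have "eventually (\<lambda>n. c + of_nat n \<noteq> 0) sequentially"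
    using inf filterlim_at_infinity_imp_eventually_ne by blast
  hence "eventually (\<lambda>n. 1 + (a - c) / (c + of_nat n) = (a + of_nat n) / (c + of_nat n)) sequentially"
    by eventually_elim (simp add: field_simps)
  ultimately show ?thesis
    using Lim_transform_eventually by fastforce
qed

lemma hyp_fps_conv_radius: "fps_conv_radius (hyp_fps a b c) \<ge> 1"
  unfolding fps_conv_radius_def
proof (rule conv_radius_geI_ex')
  fix r :: real assume r: "0 < r" "ereal r < 1"
  hence r1: "r < 1" by simp
  obtain \<rho> where \<rho>: "r < \<rho>" "\<rho> < 1" using r1 dense by blast
  define q where "q = (\<lambda>n. (a + of_nat n) / (c + of_nat n) * ((b + of_nat n) / (1 + of_nat n)) :: complex)"
  have "q \<longlonglongrightarrow> 1 * 1"
    unfolding q_def by (intro tendsto_mult tendsto_shift_quotient)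
  hence "(\<lambda>n. norm (q n) * r) \<longlonglongrightarrow> norm (1 :: complex) * r"
    by (intro tendsto_mult tendsto_norm tendsto_const) simp
  hence "eventually (\<lambda>n. norm (q n) * r < \<rho>) sequentially"
    using \<rho> by (intro order_tendstoD) auto
  then obtain N where N: "\<And>n. n \<ge> N \<Longrightarrow> norm (q n) * r < \<rho>"
    by (auto simp: eventually_sequentially)
  have "norm (fps_nth (hyp_fps a b c) (Suc n) * of_real r ^ Suc n)
        \<le> \<rho> * norm (fps_nth (hyp_fps a b c) n * of_real r ^ n)" if "n \<ge> N" for n
  proof -
    have "fps_nth (hyp_fps a b c) (Suc n) * of_real r ^ Suc n =
          (q n * of_real r) * (fps_nth (hyp_fps a b c) n * of_real r ^ n)"
      unfolding hyp_fps_Suc q_def by (simp add: add_ac del: hyp_fps_nth)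
    hence "norm (fps_nth (hyp_fps a b c) (Suc n) * of_real r ^ Suc n) =
        (norm (q n) * r) * norm (fps_nth (hyp_fps a b c) n * of_real r ^ n)"
      using r by (simp add: norm_mult del: hyp_fps_nth)
    also have "\<dots> \<le> \<rho> * norm (fps_nth (hyp_fps a b c) n * of_real r ^ n)"
      using N[OF that] by (intro mult_right_mono) auto
    finally show ?thesis .
  qed
  thus "summable (\<lambda>n. fps_nth (hyp_fps a b c) n * of_real r ^ n)"
    by (intro summable_ratio_test[where c = \<rho> and N = N]) (use \<rho> in auto)
qed

lemma hyp2F1_eval: "hyp2F1 a b c z = eval_fps (hyp_fps a b c) z"
  by (simp add: hyp2F1_def eval_fps_def)

lemma hyp2F1_sums:
  assumes "norm z < 1"
  shows "(\<lambda>k. pochhammer a k * pochhammer b k / (pochhammer c k * fact k) * z ^ k) sums hyp2F1 a b c z"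
proof -
  have "ereal (norm z) < 1"
    using assms by simp
  also have "1 \<le> fps_conv_radius (hyp_fps a b c)"
    by (rule hyp_fps_conv_radius)
  finally show ?thesis
    using sums_eval_fps[of z "hyp_fps a b c"] by (simp add: hyp2F1_eval)
qed

lemma binom_fps_conv_radius: "fps_conv_radius (binom_fps d) \<ge> 1"
proof -
  have "binom_fps d = hyp_fps d 1 1"
    by (rule fps_ext) (simp add: binom_fps_def pochhammer_fact[symmetric])
  thus ?thesis using hyp_fps_conv_radius by simp
qed

text \<open>A condition stable under ring operations which ensures that evaluation at a point with
  |z| < 1 commutes with them; identities of formal series then transfer to \<open>hyp2F1\<close> by
  rewriting.\<close>

definition unit_conv :: "complex fps \<Rightarrow> bool" where
  "unit_conv f \<longleftrightarrow> fps_conv_radius f \<ge> 1"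

lemma unit_conv_intros:
  "unit_conv (hyp_fps a b c)" "unit_conv (binom_fps d)" "unit_conv (fps_const k)" "unit_conv fps_X"
  "unit_conv 1"
  "unit_conv f \<Longrightarrow> unit_conv g \<Longrightarrow> unit_conv (f + g)"
  "unit_conv f \<Longrightarrow> unit_conv g \<Longrightarrow> unit_conv (f - g)"
  "unit_conv f \<Longrightarrow> unit_conv g \<Longrightarrow> unit_conv (f * g)"
  using hyp_fps_conv_radius binom_fps_conv_radius
    fps_conv_radius_add[of f g] fps_conv_radius_diff[of f g] fps_conv_radius_mult[of f g]
  by (auto simp: unit_conv_def min_def split: if_splits intro: order_trans)

lemma unit_conv_eval:
  assumes "norm z < 1"
  shows "unit_conv f \<Longrightarrow> unit_conv g \<Longrightarrow> eval_fps (f + g) z = eval_fps f z + eval_fps g z"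
    "unit_conv f \<Longrightarrow> unit_conv g \<Longrightarrow> eval_fps (f - g) z = eval_fps f z - eval_fps g z"
    "unit_conv f \<Longrightarrow> unit_conv g \<Longrightarrow> eval_fps (f * g) z = eval_fps f z * eval_fps g z"
proof -
  have "ereal (norm z) < fps_conv_radius f" if "unit_conv f" for f
  proof -
    have "ereal (norm z) < 1" using assms by simp
    also have "1 \<le> fps_conv_radius f" using that by (simp add: unit_conv_def)
    finally show ?thesis .
  qed
  thus "unit_conv f \<Longrightarrow> unit_conv g \<Longrightarrow> eval_fps (f + g) z = eval_fps f z + eval_fps g z"
    "unit_conv f \<Longrightarrow> unit_conv g \<Longrightarrow> eval_fps (f - g) z = eval_fps f z - eval_fps g z"
    "unit_conv f \<Longrightarrow> unit_conv g \<Longrightarrow> eval_fps (f * g) z = eval_fps f z * eval_fps g z"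
    by (simp_all add: eval_fps_add eval_fps_diff eval_fps_mult)
qed

lemmas unit_conv_simps = unit_conv_eval unit_conv_intros hyp2F1_eval[symmetric]

lemma hyp2F1_three_term:
  assumes "norm z < 1" "c \<notin> \<int>\<^sub>\<le>\<^sub>0"
  shows "c * hyp2F1 a b c z =
         (c + (a + 1 - b) * z) * hyp2F1 (a + 1) b (c + 1) z
         - (c + 1 - b) * (a + 1) / (c + 1) * z * hyp2F1 (a + 2) b (c + 2) z"
  using arg_cong[OF hyp_fps_three_term[OF assms(2), of a b], of "\<lambda>f. eval_fps f z"] assms(1)
  by (simp add: unit_conv_simps)

lemma hyp2F1_raise_c:
  assumes "norm z < 1" "c \<notin> \<int>\<^sub>\<le>\<^sub>0"
  shows "(c - a) / c * hyp2F1 a b (c + 1) z = hyp2F1 a b c z - a / c * hyp2F1 (a + 1) b (c + 1) z"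
  using arg_cong[OF hyp_fps_raise_c[OF assms(2), of a b], of "\<lambda>f. eval_fps f z"] assms(1)
  by (simp add: unit_conv_simps)

lemma hyp2F1_lower_a:
  assumes "norm z < 1" "c \<notin> \<int>\<^sub>\<le>\<^sub>0"
  shows "(1 - z) * hyp2F1 a b c z = hyp2F1 (a - 1) b c z - (c - b) / c * z * hyp2F1 a b (c + 1) z"
  using arg_cong[OF hyp_fps_lower_a[OF assms(2), of a b], of "\<lambda>f. eval_fps f z"] assms(1)
  by (simp add: unit_conv_simps)

lemma hyp2F1_legendre:
  assumes "norm z < 1" "c \<notin> \<int>"
  shows "hyp2F1 a b c z * hyp2F1 (-a) (1 - b) (1 - c) z
         - a * (c - b) / (c * (c - 1)) * z * hyp2F1 (a + 1) b (c + 1) z * hyp2F1 (1 - a) (1 - b) (2 - c) z = 1"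
  using arg_cong[OF hyp_fps_legendre[OF assms(2), of a b], of "\<lambda>f. eval_fps f z"] assms(1)
  by (simp add: unit_conv_simps)

text \<open>The two values differ by the value of a binomial series, which is nonzero because the
  formal inverse evaluates to its reciprocal.\<close>

lemma hyp2F1_euler_eq_0_iff:
  assumes "norm z < 1" "c \<notin> \<int>\<^sub>\<le>\<^sub>0"
  shows "hyp2F1 (c - a) (c - b) c z = 0 \<longleftrightarrow> hyp2F1 a b c z = 0"
proof -
  have "eval_fps (binom_fps (c - a - b)) z * eval_fps (binom_fps (- (c - a - b))) z = 1"
    using arg_cong[OF binom_fps_inverse[of "c - a - b"], of "\<lambda>f. eval_fps f z"] assms(1)
    by (simp add: unit_conv_simps)
  hence "eval_fps (binom_fps (c - a - b)) z \<noteq> 0" by auto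
  moreover have "eval_fps (binom_fps (c - a - b)) z * hyp2F1 a b c z = hyp2F1 (c - a) (c - b) c z"
    using arg_cong[OF hyp_fps_euler[OF assms(2), of a b], of "\<lambda>f. eval_fps f z"] assms(1)
    by (simp add: unit_conv_simps)
  ultimately show ?thesis by (metis mult_eq_0_iff)
qed

section \<open>The Casoratian of the two solutions\<close>

text \<open>Euler's integral of t^(alpha+i-1) (1-t)^(gamma-alpha+k-1) (1-zt)^(-1/2) over [0, 1],
  divided by B(alpha, gamma-alpha). In this normalisation a step in i multiplies the integrand by t
  and a step in k by 1 - t, which is the origin of \<open>shiftI_step\<close>.\<close>

definition shiftI :: "complex \<Rightarrow> complex \<Rightarrow> complex \<Rightarrow> nat \<Rightarrow> nat \<Rightarrow> complex" where
  "shiftI \<alpha> \<gamma> z i k = pochhammer \<alpha> i * pochhammer (\<gamma> - \<alpha>) k / pochhammer \<gamma> (i + k)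
     * hyp2F1 (\<alpha> + of_nat i) (1/2) (\<gamma> + of_nat (i + k)) z"

text \<open>After division by (gamma - 1/2)_(i+k), and up to a factor free of i and k, this is the
  same integrand taken from 1/z to infinity: t = 1/(z u) gives a Beta integral again, and Euler's
  transformation brings it to the parameters shown.\<close>

definition shiftJ :: "complex \<Rightarrow> complex \<Rightarrow> complex \<Rightarrow> nat \<Rightarrow> nat \<Rightarrow> complex" where
  "shiftJ \<alpha> \<gamma> z i k = (-1) ^ k * (1 - z) ^ k / z ^ (i + k) * pochhammer (\<gamma> - 1) (i + k)
     * hyp2F1 (1 - \<alpha> - of_nat i) (1/2) (2 - \<gamma> - of_nat (i + k)) z"

(* Dividing shiftJ by pochhammer (gamma - 1/2) (i + k) gives it the recursions of shiftI; the
   definition below is the determinant of the two sequences with this denominator cleared. *)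
definition casoratian :: "complex \<Rightarrow> complex \<Rightarrow> complex \<Rightarrow> nat \<Rightarrow> nat \<Rightarrow> complex" where
  "casoratian \<alpha> \<gamma> z i k = shiftI \<alpha> \<gamma> z 0 0 * shiftJ \<alpha> \<gamma> z i k
     - pochhammer (\<gamma> - 1/2) (i + k) * shiftJ \<alpha> \<gamma> z 0 0 * shiftI \<alpha> \<gamma> z i k"

lemma notin_Ints_shift:
  fixes c :: complex
  assumes "c \<notin> \<int>"
  shows "c + of_nat n \<notin> \<int>" "c - of_nat n \<notin> \<int>" "of_nat n - c \<notin> \<int>" "c + of_nat n \<notin> \<int>\<^sub>\<le>\<^sub>0" "of_nat n - c \<notin> \<int>\<^sub>\<le>\<^sub>0"
    "c + of_nat n \<noteq> 0" "c \<notin> \<int>\<^sub>\<le>\<^sub>0" "pochhammer c n \<noteq> 0"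
proof -
  show 1: "c + of_nat n \<notin> \<int>"
    using assms Ints_diff[of "c + of_nat n" "of_nat n"] by auto
  show "c - of_nat n \<notin> \<int>"
    using assms Ints_add[of "c - of_nat n" "of_nat n"] by auto
  show 2: "of_nat n - c \<notin> \<int>"
    using assms Ints_diff[of "of_nat n" "of_nat n - c"] by auto
  show "c + of_nat n \<notin> \<int>\<^sub>\<le>\<^sub>0" "of_nat n - c \<notin> \<int>\<^sub>\<le>\<^sub>0"
    using 1 2 nonpos_Ints_Int by blast+
  show "c + of_nat n \<noteq> 0" using 1 by (metis Ints_0)
  show 3: "c \<notin> \<int>\<^sub>\<le>\<^sub>0" using assms nonpos_Ints_Int by blast
  show "pochhammer c n \<noteq> 0" by (rule pochhammer_neq_0_nonpos[OF 3])
qed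

context
  fixes \<alpha> \<gamma> z :: complex
  assumes z: "norm z < 1" "z \<noteq> 0" and \<gamma>: "\<gamma> \<notin> \<int>"
begin

lemma shiftI_step: "shiftI \<alpha> \<gamma> z i (Suc k) = shiftI \<alpha> \<gamma> z i k - shiftI \<alpha> \<gamma> z (Suc i) k"
proof -
  define c where "c = \<gamma> + of_nat (i + k)"
  define a where "a = \<alpha> + of_nat i"
  have c: "c \<notin> \<int>\<^sub>\<le>\<^sub>0" "c \<noteq> 0" unfolding c_def using notin_Ints_shift[OF \<gamma>] by blast+
  define u where "u = pochhammer \<alpha> i * pochhammer (\<gamma> - \<alpha>) k / pochhammer \<gamma> (i + k)"
  have e: "\<gamma> + of_nat (i + Suc k) = c + 1" "\<gamma> + of_nat (Suc i + k) = c + 1" "\<alpha> + of_nat (Suc i) = a + 1"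
    "pochhammer \<gamma> (i + Suc k) = pochhammer \<gamma> (i + k) * c"
    "pochhammer \<gamma> (Suc i + k) = pochhammer \<gamma> (i + k) * c"
    "pochhammer \<alpha> (Suc i) = pochhammer \<alpha> i * a"
    "pochhammer (\<gamma> - \<alpha>) (Suc k) = pochhammer (\<gamma> - \<alpha>) k * (c - a)"
    by (simp_all add: c_def a_def pochhammer_Suc add_ac)
  have "shiftI \<alpha> \<gamma> z i (Suc k) = u * ((c - a) / c * hyp2F1 a (1/2) (c + 1) z)"
    unfolding shiftI_def e u_def by (simp add: a_def)
  also have "\<dots> = u * hyp2F1 a (1/2) c z - u * (a / c) * hyp2F1 (a + 1) (1/2) (c + 1) z"
    unfolding hyp2F1_raise_c[OF z(1) c(1)] by (simp add: algebra_simps)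
  also have "\<dots> = shiftI \<alpha> \<gamma> z i k - shiftI \<alpha> \<gamma> z (Suc i) k"
    unfolding shiftI_def e u_def by (simp add: a_def c_def)
  finally show ?thesis .
qed

lemma shiftJ_step:
  "shiftJ \<alpha> \<gamma> z i (Suc k) = (\<gamma> - 1/2 + of_nat (i + k)) * shiftJ \<alpha> \<gamma> z i k - shiftJ \<alpha> \<gamma> z (Suc i) k"
proof -
  define c where "c = 1 - \<gamma> - of_nat (i + k)"
  define a where "a = 1 - \<alpha> - of_nat i"
  have "1 - (\<gamma> + of_nat (i + k)) \<notin> \<int>"
    using notin_Ints_shift(1)[OF \<gamma>, of "i+k"] notin_Ints_shift(3)[of "\<gamma> + of_nat (i + k)" 1] by simp
  hence "c \<notin> \<int>" by (simp add: c_def algebra_simps)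
  hence c: "c \<notin> \<int>\<^sub>\<le>\<^sub>0" "c \<noteq> 0" using notin_Ints_shift(7) by auto
  define u where "u = (-1) ^ k * (1 - z) ^ k / z ^ (i + k) * pochhammer (\<gamma> - 1) (i + k)"
  have e: "2 - \<gamma> - of_nat (i + k) = c + 1" "2 - \<gamma> - of_nat (Suc i + k) = c" "2 - \<gamma> - of_nat (i + Suc k) = c"
    "1 - \<alpha> - of_nat (Suc i) = a - 1" "1 - \<alpha> - of_nat i = a"
    "pochhammer (\<gamma> - 1) (Suc i + k) = pochhammer (\<gamma> - 1) (i + k) * (- c)"
    "pochhammer (\<gamma> - 1) (i + Suc k) = pochhammer (\<gamma> - 1) (i + k) * (- c)"
    "z ^ (Suc i + k) = z ^ (i + k) * z" "z ^ (i + Suc k) = z ^ (i + k) * z"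
    by (simp_all add: c_def a_def pochhammer_Suc)
  have J: "shiftJ \<alpha> \<gamma> z i k = u * hyp2F1 a (1/2) (c + 1) z"
    unfolding shiftJ_def u_def e by simp
  have J1: "shiftJ \<alpha> \<gamma> z (Suc i) k = u / z * (- c) * hyp2F1 (a - 1) (1/2) c z"
    unfolding shiftJ_def u_def e by simp
  have "shiftJ \<alpha> \<gamma> z i (Suc k) = u / z * c * ((1 - z) * hyp2F1 a (1/2) c z)"
    unfolding shiftJ_def u_def e by simp
  also have "\<dots> = - (c - 1/2) * (u * hyp2F1 a (1/2) (c + 1) z) - u / z * (- c) * hyp2F1 (a - 1) (1/2) c z"
    unfolding hyp2F1_lower_a[OF z(1) c(1)] using c(2) z(2) by (simp add: field_simps)
  also have "- (c - 1/2) = \<gamma> - 1/2 + of_nat (i + k)"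
    by (simp add: c_def)
  finally show ?thesis unfolding J J1 .
qed

text \<open>In terms of the integral: the derivative of t^(alpha+n) (1-t)^(gamma-alpha) (1-zt)^(1/2)
  integrates to 0.\<close>

lemma shiftI_three_term:
  "(\<alpha> + of_nat n) * shiftI \<alpha> \<gamma> z n 0 =
     (\<gamma> + of_nat n + (\<alpha> + of_nat n + 1/2) * z) * shiftI \<alpha> \<gamma> z (Suc n) 0
     - (\<gamma> + of_nat n + 1/2) * z * shiftI \<alpha> \<gamma> z (Suc (Suc n)) 0"
proof -
  define c where "c = \<gamma> + of_nat n"
  define a where "a = \<alpha> + of_nat n"
  have c: "c \<notin> \<int>\<^sub>\<le>\<^sub>0" "c \<noteq> 0" unfolding c_def using notin_Ints_shift[OF \<gamma>] by blast+
  have c1: "c + 1 \<noteq> 0" unfolding c_def using notin_Ints_shift(6)[OF \<gamma>, of "Suc n"] by (simp add: add_ac)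
  define u where "u = pochhammer \<alpha> n / pochhammer \<gamma> n"
  have I0: "shiftI \<alpha> \<gamma> z n 0 = u * hyp2F1 a (1/2) c z"
    unfolding shiftI_def u_def c_def a_def by simp
  have I1: "shiftI \<alpha> \<gamma> z (Suc n) 0 = u * (a / c) * hyp2F1 (a + 1) (1/2) (c + 1) z"
    unfolding shiftI_def u_def c_def a_def by (simp add: pochhammer_Suc add_ac)
  have I2: "shiftI \<alpha> \<gamma> z (Suc (Suc n)) 0 = u * (a / c) * ((a + 1) / (c + 1)) * hyp2F1 (a + 2) (1/2) (c + 2) z"
    unfolding shiftI_def u_def c_def a_def by (simp add: pochhammer_Suc add_ac)
  have "a * shiftI \<alpha> \<gamma> z n 0 = u * (a / c) * (c * hyp2F1 a (1/2) c z)"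
    unfolding I0 using c(2) by simp
  also have "\<dots> = (c + (a + 1/2) * z) * shiftI \<alpha> \<gamma> z (Suc n) 0 - (c + 1/2) * z * shiftI \<alpha> \<gamma> z (Suc (Suc n)) 0"
  proof -
    define X Y where "X = c + (a + 1/2) * z" and "Y = c + 1/2"
    have XY: "c + (a + 1 - 1/2) * z = X" "c + 1 - 1/2 = Y" by (simp_all add: X_def Y_def)
    show ?thesis
      unfolding hyp2F1_three_term[OF z(1) c(1), of a "1/2"] I1 I2 XY X_def[symmetric] Y_def[symmetric]
      by (simp add: right_diff_distrib mult_ac)
  qed
  finally show ?thesis unfolding a_def c_def .
qed

text \<open>The relation of \<open>shiftI_three_term\<close> after multiplying the sequence by
  (gamma - 1/2)_n; this moves the factor gamma + n + 1/2 away from the last term and puts gamma -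
  1/2 + n on the first.\<close>

lemma shiftJ_three_term:
  "(\<alpha> + of_nat n) * (\<gamma> - 1/2 + of_nat n) * shiftJ \<alpha> \<gamma> z n 0 =
     (\<gamma> + of_nat n + (\<alpha> + of_nat n + 1/2) * z) * shiftJ \<alpha> \<gamma> z (Suc n) 0
     - z * shiftJ \<alpha> \<gamma> z (Suc (Suc n)) 0"
proof -
  define c where "c = - (\<gamma> + of_nat n)"
  define a where "a = - 1 - \<alpha> - of_nat n"
  have "c \<notin> \<int>"
    using notin_Ints_shift(1)[OF \<gamma>, of n] by (simp add: c_def)
  hence c: "c \<notin> \<int>\<^sub>\<le>\<^sub>0" "c + 1 \<noteq> 0"
    using notin_Ints_shift(7) notin_Ints_shift(6)[of c 1] by auto
  define u where "u = pochhammer (\<gamma> - 1) n / z ^ n"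
  have e: "2 - \<gamma> - of_nat (n + 0) = c + 2" "2 - \<gamma> - of_nat (Suc n + 0) = c + 1" "2 - \<gamma> - of_nat (Suc (Suc n) + 0) = c"
    "1 - \<alpha> - of_nat n = a + 2" "1 - \<alpha> - of_nat (Suc n) = a + 1" "1 - \<alpha> - of_nat (Suc (Suc n)) = a"
    "pochhammer (\<gamma> - 1) (Suc (Suc n) + 0) = pochhammer (\<gamma> - 1) n * (- (c + 1)) * (- c)"
    "pochhammer (\<gamma> - 1) (Suc n + 0) = pochhammer (\<gamma> - 1) n * (- (c + 1))"
    by (simp_all add: c_def a_def pochhammer_Suc add_ac)
  have J0: "shiftJ \<alpha> \<gamma> z n 0 = u * hyp2F1 (a + 2) (1/2) (c + 2) z"
    unfolding shiftJ_def u_def e by simp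
  have J1: "shiftJ \<alpha> \<gamma> z (Suc n) 0 = u / z * (- (c + 1)) * hyp2F1 (a + 1) (1/2) (c + 1) z"
    unfolding shiftJ_def u_def e by simp
  have J2: "shiftJ \<alpha> \<gamma> z (Suc (Suc n)) 0 = u / z / z * (c + 1) * (c * hyp2F1 a (1/2) c z)"
    unfolding shiftJ_def u_def e using z(2) by (simp add: field_simps)
  have "z * shiftJ \<alpha> \<gamma> z (Suc (Suc n)) 0 =
      - (c + (a + 1/2) * z) * shiftJ \<alpha> \<gamma> z (Suc n) 0 - (c + 1/2) * (a + 1) * shiftJ \<alpha> \<gamma> z n 0"
  proof -
    define X Y d where "X = c + (a + 1/2) * z" and "Y = c + 1/2" and "d = c + 1"
    have XY: "c + (a + 1 - 1/2) * z = X" "c + 1 - 1/2 = Y" by (simp_all add: X_def Y_def)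
    have "d \<noteq> 0" using c by (simp add: d_def)
    thus ?thesis
      unfolding J0 J1 J2 hyp2F1_three_term[OF z(1) c(1), of a "1/2"] XY X_def[symmetric] Y_def[symmetric]
      unfolding d_def[symmetric] using z(2)
      by (simp add: field_simps)
  qed
  moreover have "- (c + (a + 1/2) * z) = \<gamma> + of_nat n + (\<alpha> + of_nat n + 1/2) * z"
  proof -
    have k: "a + 1/2 = - (\<alpha> + of_nat n + 1/2)" by (simp add: a_def field_simps)
    show ?thesis unfolding k by (subst mult_minus_left) (simp only: c_def minus_add_distrib minus_minus)
  qed
  moreover have "(c + 1/2) * (a + 1) = (\<alpha> + of_nat n) * (\<gamma> - 1/2 + of_nat n)"
  proof -
    have "c + 1/2 = - (\<gamma> - 1/2 + of_nat n)" "a + 1 = - (\<alpha> + of_nat n)"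
      by (simp_all add: a_def c_def)
    thus ?thesis by (simp only: minus_mult_minus mult.commute)
  qed
  ultimately have e2: "z * shiftJ \<alpha> \<gamma> z (Suc (Suc n)) 0 =
      (\<gamma> + of_nat n + (\<alpha> + of_nat n + 1/2) * z) * shiftJ \<alpha> \<gamma> z (Suc n) 0
      - (\<alpha> + of_nat n) * (\<gamma> - 1/2 + of_nat n) * shiftJ \<alpha> \<gamma> z n 0"
    by simp
  show ?thesis unfolding e2 by simp
qed

lemma casoratian_1: "casoratian \<alpha> \<gamma> z (Suc 0) 0 = (\<gamma> - 1) / z"
proof -
  have "\<gamma> \<noteq> 0" "\<gamma> - 1 \<noteq> 0"
    using \<gamma> by auto
  hence "casoratian \<alpha> \<gamma> z (Suc 0) 0 = (\<gamma> - 1) / z *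
     (hyp2F1 \<alpha> (1/2) \<gamma> z * hyp2F1 (-\<alpha>) (1 - 1/2) (1 - \<gamma>) z
         - \<alpha> * (\<gamma> - 1/2) / (\<gamma> * (\<gamma> - 1)) * z * hyp2F1 (\<alpha> + 1) (1/2) (\<gamma> + 1) z * hyp2F1 (1 - \<alpha>) (1 - 1/2) (2 - \<gamma>) z)"
    using z(2) by (simp add: casoratian_def shiftI_def shiftJ_def field_simps)
  thus ?thesis unfolding hyp2F1_legendre[OF z(1) \<gamma>] by simp
qed

text \<open>In (i, k) the Casoratian is a combination of the two sequences, cleared of the same
  denominator, with coefficients free of i and k. It therefore inherits their linear
  recursions.\<close>

lemma casoratian_step:
  "casoratian \<alpha> \<gamma> z i (Suc k) = (\<gamma> - 1/2 + of_nat (i + k)) * casoratian \<alpha> \<gamma> z i k - casoratian \<alpha> \<gamma> z (Suc i) k"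
proof -
  define h :: complex where "h = 1/2"
  show ?thesis
    unfolding casoratian_def shiftI_step shiftJ_step add_Suc add_Suc_right pochhammer_Suc h_def[symmetric]
    by (simp add: algebra_simps)
qed

lemma casoratian_three_term:
  "z * casoratian \<alpha> \<gamma> z (Suc (Suc n)) 0 =
     (\<gamma> + of_nat n + (\<alpha> + of_nat n + 1/2) * z) * casoratian \<alpha> \<gamma> z (Suc n) 0
     - (\<alpha> + of_nat n) * (\<gamma> - 1/2 + of_nat n) * casoratian \<alpha> \<gamma> z n 0"
proof -
  define h :: complex where "h = 1/2"
  define I J where "I = (\<lambda>n. shiftI \<alpha> \<gamma> z n 0)" and "J = (\<lambda>n. shiftJ \<alpha> \<gamma> z n 0)"
  let ?I = "\<lambda>n. shiftI \<alpha> \<gamma> z n 0" and ?J = "\<lambda>n. shiftJ \<alpha> \<gamma> z n 0" and ?q = "pochhammer (\<gamma> - 1/2) (Suc n)"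
  define q where "q = pochhammer (\<gamma> - 1/2) n"
  have q: "?q = q * (\<gamma> - h + of_nat n)" by (simp add: q_def h_def pochhammer_Suc)
  have "pochhammer (\<gamma> - 1/2) (Suc (Suc n)) = ?q * (\<gamma> + of_nat n + 1/2)"
    by (simp add: pochhammer_Suc algebra_simps)
  hence "z * casoratian \<alpha> \<gamma> z (Suc (Suc n)) 0 =
     ?I 0 * (z * ?J (Suc (Suc n))) - ?q * ?J 0 * ((\<gamma> + of_nat n + 1/2) * z * ?I (Suc (Suc n)))"
    by (simp add: casoratian_def algebra_simps)
  also have "z * ?J (Suc (Suc n)) = (\<gamma> + of_nat n + (\<alpha> + of_nat n + 1/2) * z) * ?J (Suc n)
      - (\<alpha> + of_nat n) * (\<gamma> - 1/2 + of_nat n) * ?J n"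
    using shiftJ_three_term[of n] by (simp add: algebra_simps)
  also have "(\<gamma> + of_nat n + 1/2) * z * ?I (Suc (Suc n)) =
      (\<gamma> + of_nat n + (\<alpha> + of_nat n + 1/2) * z) * ?I (Suc n) - (\<alpha> + of_nat n) * ?I n"
    using shiftI_three_term[of n] by (simp add: algebra_simps)
  finally have "z * casoratian \<alpha> \<gamma> z (Suc (Suc n)) 0 =
      I 0 * ((\<gamma> + of_nat n + (\<alpha> + of_nat n + h) * z) * J (Suc n) - (\<alpha> + of_nat n) * (\<gamma> - h + of_nat n) * J n)
      - q * (\<gamma> - h + of_nat n) * J 0 * ((\<gamma> + of_nat n + (\<alpha> + of_nat n + h) * z) * I (Suc n) - (\<alpha> + of_nat n) * I n)"
    unfolding q I_def[symmetric] J_def[symmetric] unfolding I_def J_def h_def .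
  also have "\<dots> = (\<gamma> + of_nat n + (\<alpha> + of_nat n + h) * z) * (I 0 * J (Suc n) - q * (\<gamma> - h + of_nat n) * J 0 * I (Suc n))
     - (\<alpha> + of_nat n) * (\<gamma> - h + of_nat n) * (I 0 * J n - q * J 0 * I n)"
    by (simp add: algebra_simps)
  finally show ?thesis
    unfolding casoratian_def add_0_right q unfolding I_def J_def h_def q_def .
qed

end

(* "degree P < n" that also admits P = 0 for n = 0, where degree 0 = 0 would get in the way. *)
definition low_degree :: "nat \<Rightarrow> complex poly \<Rightarrow> bool" where
  "low_degree n P \<longleftrightarrow> P = 0 \<or> degree P < n"

lemma low_degree_mult_linear:
  assumes "low_degree n P" "degree Q \<le> m"
  shows "low_degree (n + m) (Q * P)"
proof (cases "P = 0")
  case False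
  have "degree (Q * P) \<le> degree Q + degree P" by (rule degree_mult_le)
  thus ?thesis using assms False by (auto simp: low_degree_def)
qed (simp add: low_degree_def)

lemma low_degree_diff:
  assumes "low_degree n P" "low_degree n Q"
  shows "low_degree n (P - Q)"
proof (cases "P = Q")
  case False
  hence "n > 0" using assms by (auto simp: low_degree_def)
  thus ?thesis using assms degree_diff_le_max[of P Q] by (auto simp: low_degree_def)
qed (simp add: low_degree_def)

lemma low_degree_smult: "low_degree n P \<Longrightarrow> low_degree n (smult c P)"
  by (auto simp: low_degree_def)

text \<open>The recursion in i starts from the values 0 and (gamma - 1)/z, so the factor gamma - 1
  is carried through. Its coefficients have degree at most 1 on the preceding value and at most 2 on
  the one before; the step in k adds one degree. No hypergeometric function survives.\<close>

lemma casoratian_poly: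
  fixes z a :: complex and p r :: nat
  assumes z: "norm z < 1" "z \<noteq> 0"
  shows "\<exists>P. low_degree (i + k) P \<and> (\<forall>w. of_nat r * w \<notin> \<int> \<longrightarrow>
     casoratian (of_nat p * w + a) (of_nat r * w) z i k = (of_nat r * w - 1) * poly P w)"
proof (induction k arbitrary: i)
  case 0
  show ?case
  proof (induction i rule: less_induct)
    case (less i)
    consider "i = 0" | "i = Suc 0" | n where "i = Suc (Suc n)"
      by (metis not0_implies_Suc)
    thus ?case
    proof cases
      case 1
      thus ?thesis
        by (intro exI[of _ 0]) (auto simp: low_degree_def casoratian_def)
    next
      case 2
      thus ?thesis using casoratian_1[OF z]
        by (intro exI[of _ "[:1 / z:]"]) (auto simp: low_degree_def)
    next
      case 3
      obtain P where P: "low_degree (Suc n + 0) P" "\<And>w. of_nat r * w \<notin> \<int> \<Longrightarrow>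
          casoratian (of_nat p * w + a) (of_nat r * w) z (Suc n) 0 = (of_nat r * w - 1) * poly P w"
        using less[of "Suc n"] 3 by auto
      obtain Q where Q: "low_degree (n + 0) Q" "\<And>w. of_nat r * w \<notin> \<int> \<Longrightarrow>
          casoratian (of_nat p * w + a) (of_nat r * w) z n 0 = (of_nat r * w - 1) * poly Q w"
        using less[of n] 3 by auto
      define A :: "complex poly" where "A = [:of_nat n + (a + of_nat n + 1/2) * z, of_nat r + of_nat p * z:]"
      define B :: "complex poly" where "B = [:a + of_nat n, of_nat p:] * [:of_nat n - 1/2, of_nat r:]"
      have "degree A \<le> 1" by (simp add: A_def)
      hence "low_degree (i + 0) (A * P)"
        using low_degree_mult_linear[OF P(1), of A 1] 3 by simp
      moreover have "degree B \<le> 2"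
        unfolding B_def by (rule order.trans[OF degree_mult_le]) simp
      hence "low_degree (i + 0) (B * Q)"
        using low_degree_mult_linear[OF Q(1), of B 2] 3 by (simp add: numeral_2_eq_2)
      ultimately have "low_degree (i + 0) (smult (1 / z) (A * P - B * Q))"
        by (intro low_degree_smult low_degree_diff)
      moreover have "casoratian (of_nat p * w + a) (of_nat r * w) z i 0 =
          (of_nat r * w - 1) * poly (smult (1 / z) (A * P - B * Q)) w" if w: "of_nat r * w \<notin> \<int>" for w
      proof -
        have "z * casoratian (of_nat p * w + a) (of_nat r * w) z i 0 =
           poly A w * ((of_nat r * w - 1) * poly P w) - poly B w * ((of_nat r * w - 1) * poly Q w)"
        proof -
          have pA: "poly A w = of_nat r * w + of_nat n + (of_nat p * w + a + of_nat n + 1/2) * z"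
            by (simp add: A_def algebra_simps)
          have pB: "poly [:a + of_nat n, of_nat p:] w = of_nat p * w + a + of_nat n"
            "poly [:of_nat n - 1/2, of_nat r:] w = of_nat r * w - 1/2 + of_nat n"
            by (simp_all add: algebra_simps)
          show ?thesis
            unfolding 3 casoratian_three_term[OF z w] P(2)[OF w] Q(2)[OF w] B_def poly_mult pA pB ..
        qed
        thus ?thesis using z(2) by (simp add: field_simps)
      qed
      ultimately show ?thesis by blast
    qed
  qed
next
  case (Suc k)
  obtain P where P: "low_degree (i + k) P" "\<And>w. of_nat r * w \<notin> \<int> \<Longrightarrow>
      casoratian (of_nat p * w + a) (of_nat r * w) z i k = (of_nat r * w - 1) * poly P w"
    using Suc[of i] by auto
  obtain Q where Q: "low_degree (Suc i + k) Q" "\<And>w. of_nat r * w \<notin> \<int> \<Longrightarrow>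
      casoratian (of_nat p * w + a) (of_nat r * w) z (Suc i) k = (of_nat r * w - 1) * poly Q w"
    using Suc[of "Suc i"] by auto
  define A :: "complex poly" where "A = [:of_nat (i + k) - 1/2, of_nat r:]"
  have "low_degree (i + Suc k) (A * P)"
    using low_degree_mult_linear[OF P(1), of A 1] by (simp add: A_def)
  hence "low_degree (i + Suc k) (A * P - Q)"
    using Q(1) by (intro low_degree_diff) auto
  moreover have "casoratian (of_nat p * w + a) (of_nat r * w) z i (Suc k) =
          (of_nat r * w - 1) * poly (A * P - Q) w" if w: "of_nat r * w \<notin> \<int>" for w
  proof -
    have pA: "poly A w = of_nat r * w - 1/2 + of_nat (i + k)"
      by (simp add: A_def algebra_simps)
    show ?thesis
      unfolding casoratian_step[OF z w] P(2)[OF w] Q(2)[OF w] poly_diff poly_mult pA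
      by (simp only: right_diff_distrib mult.left_commute)
  qed
  ultimately show ?case by blast
qed

section \<open>Limits in half planes\<close>

text \<open>Terms of the binomial series of (1 - x)^(-1/2): the part of the hypergeometric series
  that is free of w.\<close>

definition half_coeff :: "real \<Rightarrow> nat \<Rightarrow> real" where
  "half_coeff x k = pochhammer (1/2) k / fact k * x ^ k"

lemma half_coeff_bounds:
  assumes "0 < x"
  shows "0 < half_coeff x k" "half_coeff x k \<le> x ^ k"
proof -
  have "0 < pochhammer (1/2 :: real) k" by (intro pochhammer_pos) auto
  thus "0 < half_coeff x k" using assms by (simp add: half_coeff_def)
  have "pochhammer (1/2 :: real) k \<le> fact k"
  proof (induction k)
    case (Suc k)
    have "0 \<le> pochhammer (1/2 :: real) k" by (intro less_imp_le pochhammer_pos) auto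
    hence "pochhammer (1/2 :: real) k * (1/2 + real k) \<le> fact k * (1 + real k)"
      using Suc by (intro mult_mono) auto
    thus ?case by (simp add: pochhammer_Suc algebra_simps)
  qed auto
  thus "half_coeff x k \<le> x ^ k"
    using assms by (simp add: half_coeff_def divide_simps mult_right_mono)
qed

locale gauss_family =
  fixes p r :: nat and a x :: real
  assumes p_pos: "0 < p" and p_less_r: "p < r" and x_pos: "0 < x" and x_less_1: "x < 1"
begin

definition al :: "complex \<Rightarrow> complex" where "al w = of_nat p * w + of_real a"
definition ga :: "complex \<Rightarrow> complex" where "ga w = of_nat r * w"
definition f :: "complex \<Rightarrow> complex" where "f w = hyp2F1 (al w) (1/2) (ga w) (of_real x)"
definition fd :: "complex \<Rightarrow> complex" where "fd w = hyp2F1 (1 - al w) (1/2) (2 - ga w) (of_real x)"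

abbreviation dual_a :: real where "dual_a \<equiv> 1 - 2 * real p / real r - a"
abbreviation dual_f :: "complex \<Rightarrow> complex" where "dual_f \<equiv> gauss_family.f p r dual_a x"

lemma norm_x: "norm (of_real x :: complex) < 1" "of_real x \<noteq> (0 :: complex)"
  using x_pos x_less_1 by auto

lemma r_pos: "0 < r" using p_less_r by simp

lemma ga_plus_1: "ga (w + 1) = ga w + of_nat r" and al_plus_1: "al (w + 1) = al w + of_nat p"
  by (simp_all add: ga_def al_def algebra_simps)

lemma f_sums: "(\<lambda>k. of_real (half_coeff x k) * (pochhammer (al w) k / pochhammer (ga w) k)) sums f w"
  using hyp2F1_sums[OF norm_x(1), of "al w" "1/2" "ga w"]
  by (simp add: f_def half_coeff_def pochhammer_of_real[symmetric] mult_ac)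

text \<open>With t = p/r one has al + i = t (ga + i) + a + (1 - t) i, and Re w >= -M bounds i by |ga
  + i| + r M. Since t < 1, the weights t and 1 - t leave |ga + i| plus a constant, which the excess
  of rho over 1 absorbs.\<close>

lemma norm_al_le:
  assumes K: "\<bar>a\<bar> + real r * M \<le> (\<rho> - 1) * norm (ga w + of_nat i)" "0 \<le> M" and "- M \<le> Re w"
  shows "norm (al w + of_nat i) \<le> \<rho> * norm (ga w + of_nat i)"
proof -
  define t where "t = real p / real r"
  have t: "0 < t" "t < 1" using p_pos p_less_r by (auto simp: t_def)
  have rt: "of_nat p = (of_real t :: complex) * of_nat r" using r_pos by (simp add: t_def)
  have "al w + of_nat i = of_real t * (ga w + of_nat i) + of_real (a + (1 - t) * real i)"
    unfolding al_def ga_def rt by (simp add: algebra_simps)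
  hence "norm (al w + of_nat i) \<le> norm (of_real t * (ga w + of_nat i)) + norm (of_real (a + (1 - t) * real i) :: complex)"
    using norm_triangle_ineq by metis
  also have "\<dots> = t * norm (ga w + of_nat i) + \<bar>a + (1 - t) * real i\<bar>"
    using t by (simp add: norm_mult del: of_real_add of_real_mult)
  also have "\<bar>a + (1 - t) * real i\<bar> \<le> \<bar>a\<bar> + (1 - t) * real i"
    using t by (intro order.trans[OF abs_triangle_ineq]) simp
  finally have 1: "norm (al w + of_nat i) \<le> t * norm (ga w + of_nat i) + (\<bar>a\<bar> + (1 - t) * real i)"
    by simp
  have "real i - real r * M \<le> Re (ga w + of_nat i)"
    using mult_left_mono[OF assms(3), of "real r"] by (simp add: ga_def)
  also have "\<dots> \<le> norm (ga w + of_nat i)" by (rule complex_Re_le_cmod)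
  finally have "(1 - t) * real i \<le> (1 - t) * (norm (ga w + of_nat i) + real r * M)"
    using t by (intro mult_left_mono) auto
  also have "\<dots> = norm (ga w + of_nat i) - t * norm (ga w + of_nat i) + (1 - t) * (real r * M)"
    by (simp add: algebra_simps)
  also have "(1 - t) * (real r * M) \<le> 1 * (real r * M)"
    using t K(2) by (intro mult_right_mono) auto
  finally show ?thesis using 1 K(1) by (simp add: left_diff_distrib)
qed

lemma norm_pochhammer_quotient_le:
  assumes "\<And>i. norm (al w + of_nat i) \<le> \<rho> * norm (ga w + of_nat i)" "0 \<le> \<rho>"
  shows "norm (pochhammer (al w) k / pochhammer (ga w) k) \<le> \<rho> ^ k"
proof (induction k)
  case (Suc k)
  have "norm ((al w + of_nat k) / (ga w + of_nat k)) \<le> \<rho>"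
    using assms(1)[of k] assms(2) by (cases "ga w + of_nat k = 0") (auto simp: norm_divide field_simps)
  hence "norm (pochhammer (al w) k / pochhammer (ga w) k * ((al w + of_nat k) / (ga w + of_nat k))) \<le> \<rho> ^ k * \<rho>"
    unfolding norm_mult using Suc assms(2) by (intro mult_mono) auto
  thus ?case by (simp add: pochhammer_Suc mult_ac)
qed auto

text \<open>The value (1 - p x / r)^(-1/2). What matters is that it is positive and does not involve
  a, so that a family and its dual share it.\<close>

definition limit_f :: real where "limit_f = (\<Sum>k. half_coeff x k * (real p / real r) ^ k)"

abbreviation right_infinity :: "real \<Rightarrow> complex filter" where
  "right_infinity M \<equiv> inf at_infinity (principal {w. - M \<le> Re w})"

lemma right_infinity_nontrivial: "right_infinity M \<noteq> bot"
proof
  assume "right_infinity M = bot"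
  hence "eventually (\<lambda>w. False) (right_infinity M)" by simp
  then obtain B where B: "\<And>w. norm w \<ge> B \<Longrightarrow> \<not> - M \<le> Re w"
    by (auto simp: eventually_inf_principal eventually_at_infinity)
  have "norm (of_real (\<bar>B\<bar> + \<bar>M\<bar>) :: complex) \<ge> B" by (simp del: of_real_add)
  from B[OF this] show False by simp
qed

text \<open>A point far out in the half plane has a large imaginary part or a large positive real
  part, and adding a nonnegative integer to ga spoils neither.\<close>

lemma shifted_norm_large:
  assumes "norm w \<ge> 2 * M + 2 * K" "- M \<le> Re w" "0 \<le> M" "0 < K"
  shows "K \<le> norm (ga w + of_nat i)"
proof -
  have "norm w \<le> \<bar>Re w\<bar> + \<bar>Im w\<bar>" by (rule cmod_le)
  hence "K \<le> \<bar>Im w\<bar> \<or> K \<le> Re w" using assms by linarith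
  thus ?thesis
  proof
    assume "K \<le> \<bar>Im w\<bar>"
    also have "\<dots> \<le> real r * \<bar>Im w\<bar>" using r_pos by (simp add: mult_le_cancel_right1)
    also have "\<dots> = \<bar>Im (ga w + of_nat i)\<bar>" by (simp add: ga_def abs_mult)
    also have "\<dots> \<le> norm (ga w + of_nat i)" by (rule abs_Im_le_cmod)
    finally show ?thesis .
  next
    assume K: "K \<le> Re w"
    also have "Re w \<le> real r * Re w" using r_pos K assms by (simp add: mult_le_cancel_right1)
    also have "\<dots> \<le> Re (ga w + of_nat i)" by (simp add: ga_def)
    also have "\<dots> \<le> norm (ga w + of_nat i)" by (rule complex_Re_le_cmod)
    finally show ?thesis .
  qed
qed

lemma tendsto_pochhammer_quotient:
  "((\<lambda>w. pochhammer (al w) k / pochhammer (ga w) k) \<longlongrightarrow> of_real ((real p / real r) ^ k)) at_infinity"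
proof (induction k)
  case (Suc k)
  have inf: "filterlim (\<lambda>w. of_nat r * w + of_nat k :: complex) at_infinity at_infinity"
    using r_pos by (intro tendsto_add_filterlim_at_infinity'[OF _ tendsto_const]
        tendsto_mult_filterlim_at_infinity[OF tendsto_const _ filterlim_ident]) auto
  define b where "b = (of_real a + of_nat k - of_nat p / of_nat r * of_nat k :: complex)"
  have "((\<lambda>w. of_nat p / of_nat r + b / (of_nat r * w + of_nat k)) \<longlongrightarrow> of_nat p / of_nat r + 0) at_infinity"
    by (intro tendsto_add tendsto_const tendsto_divide_0[OF tendsto_const inf])
  moreover have "eventually (\<lambda>w. of_nat p / of_nat r + b / (of_nat r * w + of_nat k) = (al w + of_nat k) / (ga w + of_nat k)) at_infinity"
    using filterlim_at_infinity_imp_eventually_ne[OF inf, of 0]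
  proof eventually_elim
    case (elim w)
    thus ?case using r_pos unfolding b_def al_def ga_def by (simp add: divide_simps) (simp add: algebra_simps)
  qed
  ultimately have "((\<lambda>w. (al w + of_nat k) / (ga w + of_nat k)) \<longlongrightarrow> of_nat p / of_nat r) at_infinity"
    using Lim_transform_eventually by fastforce
  from tendsto_mult[OF Suc this] show ?case
    by (simp add: pochhammer_Suc mult_ac)
qed auto

lemma limit_f_summable: "summable (\<lambda>k. half_coeff x k * (real p / real r) ^ k)"
proof (rule summable_comparison_test'[OF summable_geometric, where N = 0])
  show "norm x < 1" using x_pos x_less_1 by simp
  fix k
  have "0 \<le> (real p / real r) ^ k" "(real p / real r) ^ k \<le> 1"
    using p_less_r by (auto intro!: power_le_one)
  hence "half_coeff x k * (real p / real r) ^ k \<le> x ^ k * 1"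
    using half_coeff_bounds[OF x_pos, of k] x_pos by (intro mult_mono) auto
  thus "norm (half_coeff x k * (real p / real r) ^ k) \<le> x ^ k"
    using half_coeff_bounds[OF x_pos, of k] \<open>0 \<le> (real p / real r) ^ k\<close> by simp
qed

lemma limit_f_pos: "limit_f > 0"
  unfolding limit_f_def using limit_f_summable half_coeff_bounds[OF x_pos] p_pos r_pos
  by (intro suminf_pos) auto

lemma f_tendsto:
  assumes "0 \<le> M"
  shows "(f \<longlongrightarrow> of_real limit_f) (right_infinity M)"
proof -
  have "1 < 1 / x" using x_pos x_less_1 by simp
  \<comment> \<open>rho > 1 leaves room to absorb a and the shift by M, while x * rho < 1 keeps the
    majorant for Tannery's theorem summable.\<close>
  then obtain \<rho> where \<rho>: "1 < \<rho>" "\<rho> < 1 / x" using dense by blast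
  have \<rho>x: "0 \<le> x * \<rho>" "x * \<rho> < 1" using \<rho> x_pos by (auto simp: field_simps)
  define K where "K = (\<bar>a\<bar> + real r * M + 1) / (\<rho> - 1)"
  have K: "0 < K" using \<rho> assms by (auto simp: K_def intro!: divide_pos_pos add_nonneg_pos)
  let ?t = "\<lambda>k w. of_real (half_coeff x k) * (pochhammer (al w) k / pochhammer (ga w) k)"
  have bound: "norm (?t k w) \<le> (x * \<rho>) ^ k" if w: "norm w \<ge> 2 * M + 2 * K" "- M \<le> Re w" for k w
  proof -
    have "norm (pochhammer (al w) k / pochhammer (ga w) k) \<le> \<rho> ^ k"
    proof (rule norm_pochhammer_quotient_le)
      fix i
      have "K \<le> norm (ga w + of_nat i)" by (rule shifted_norm_large[OF w assms K])
      hence "\<bar>a\<bar> + real r * M \<le> (\<rho> - 1) * norm (ga w + of_nat i)"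
        using \<rho> by (simp add: K_def field_simps)
      thus "norm (al w + of_nat i) \<le> \<rho> * norm (ga w + of_nat i)"
        using assms w by (intro norm_al_le)
    qed (use \<rho> in auto)
    hence "half_coeff x k * norm (pochhammer (al w) k / pochhammer (ga w) k) \<le> x ^ k * \<rho> ^ k"
      using half_coeff_bounds[OF x_pos, of k] x_pos by (intro mult_mono) auto
    moreover have "norm (?t k w) = half_coeff x k * norm (pochhammer (al w) k / pochhammer (ga w) k)"
      using half_coeff_bounds[OF x_pos, of k] unfolding norm_mult norm_of_real by simp
    ultimately show ?thesis by (simp only: power_mult_distrib)
  qed
  have "eventually (\<lambda>w. norm w \<ge> 2 * M + 2 * K \<and> - M \<le> Re w) (right_infinity M)"
    by (auto simp: eventually_inf_principal eventually_at_infinity)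
  hence ev: "eventually (\<lambda>(k, w). norm (?t k w) \<le> (x * \<rho>) ^ k) (at_top \<times>\<^sub>F right_infinity M)"
    unfolding eventually_prod_filter prod.case
    by (intro exI[of _ "\<lambda>_. True"] exI[of _ "\<lambda>w. norm w \<ge> 2 * M + 2 * K \<and> - M \<le> Re w"] conjI allI impI bound)
       (assumption | simp | elim conjE)+
  have "((\<lambda>w. \<Sum>k. ?t k w) \<longlongrightarrow> (\<Sum>k. of_real (half_coeff x k) * of_real ((real p / real r) ^ k))) (right_infinity M)"
    using \<rho>x
    by (intro conjunct2[OF conjunct2[OF tannerys_theorem[OF _ ev]]] right_infinity_nontrivial
        tendsto_mult tendsto_const tendsto_mono[OF inf_le1 tendsto_pochhammer_quotient] summable_geometric) auto
  also have "(\<lambda>w. \<Sum>k. ?t k w) = f"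
    using f_sums by (auto simp: sums_iff)
  also have "(\<Sum>k. of_real (half_coeff x k) * of_real ((real p / real r) ^ k) :: complex) = of_real limit_f"
    unfolding limit_f_def by (subst suminf_of_real[OF limit_f_summable]) simp
  finally show ?thesis .
qed

section \<open>The regularised entire function\<close>

text \<open>f / Gamma(ga), with the quotient by the rising factorial of ga absorbed into
  \<open>rGamma\<close>: every term is entire, also where ga is a nonpositive integer.\<close>

definition freg :: "complex \<Rightarrow> complex" where
  "freg w = (\<Sum>k. of_real (half_coeff x k) * (pochhammer (al w) k * rGamma (ga w + of_nat k)))"

lemma freg_sums_holomorphic:
  "(\<forall>w. (\<lambda>k. of_real (half_coeff x k) * (pochhammer (al w) k * rGamma (ga w + of_nat k))) sums freg w)
    \<and> freg holomorphic_on UNIV"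
proof -
  let ?t = "\<lambda>k w. of_real (half_coeff x k) * (pochhammer (al w) k * rGamma (ga w + of_nat k))"
  have hol: "?t k holomorphic_on UNIV" for k
    unfolding al_def ga_def pochhammer_prod by (intro holomorphic_intros)
  have to_g: "\<exists>d (h :: nat \<Rightarrow> complex). 0 < d \<and> summable h \<and> range h \<subseteq> \<real>\<^sub>\<ge>\<^sub>0 \<and>
       (\<forall>\<^sub>F n in sequentially. \<forall>y\<in>ball w d \<inter> UNIV. norm (?t n y) \<le> norm (h n))" for w
  proof -
    define B where "B = norm w + 1"
    have "1 < 1 / x" using x_pos x_less_1 by simp
    then obtain \<rho> where \<rho>: "1 < \<rho>" "\<rho> < 1 / x" using dense by blast
    have \<rho>x: "0 \<le> x * \<rho>" "x * \<rho> < 1" using \<rho> x_pos by (auto simp: field_simps)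
    \<comment> \<open>From index N on, each factor of the quotient is bounded by rho uniformly on
      the unit ball around w; the earlier factors are absorbed in the constant C found by
      compactness.\<close>
    obtain N :: nat where N: "(\<bar>a\<bar> + real r * B) / (\<rho> - 1) + real r * B < real N"
      using reals_Archimedean2 by blast
    have B: "0 < B" by (simp add: B_def add_nonneg_pos)
    let ?u = "\<lambda>y. pochhammer (al y) N * rGamma (ga y + of_nat N)"
    have "continuous_on (cball w 1) ?u"
      unfolding al_def ga_def pochhammer_prod
      by (intro holomorphic_on_imp_continuous_on holomorphic_intros)
    hence "compact (?u ` cball w 1)" by (intro compact_continuous_image) auto
    hence "bounded (?u ` cball w 1)" by (rule compact_imp_bounded)
    then obtain C where "\<forall>z\<in>?u ` cball w 1. norm z \<le> C" unfolding bounded_iff by blast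
    hence C: "norm (?u y) \<le> C" if "y \<in> cball w 1" for y using that by blast
    have C0: "0 \<le> C" by (rule order.trans[OF norm_ge_zero C[of w]]) simp
    have bound: "norm (?t (N + m) y) \<le> C * x ^ N * (x * \<rho>) ^ m" if y: "y \<in> ball w 1" for m y
    proof -
      have yB: "norm y \<le> B"
        using y norm_triangle_ineq[of w "y - w"] by (simp add: B_def dist_norm norm_minus_commute)
      have i: "norm (al y + of_nat i) \<le> \<rho> * norm (ga y + of_nat i)" "ga y + of_nat i \<noteq> 0" if "i \<ge> N" for i
      proof -
        have 1: "- B \<le> Re y" using yB abs_Re_le_cmod[of y] by simp
        have "real i - real r * B \<le> Re (ga y + of_nat i)"
          using mult_left_mono[OF 1, of "real r"] by (simp add: ga_def)
        also have "\<dots> \<le> norm (ga y + of_nat i)" by (rule complex_Re_le_cmod)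
        finally have 2: "(\<bar>a\<bar> + real r * B) / (\<rho> - 1) < norm (ga y + of_nat i)"
          using N that by simp
        hence "\<bar>a\<bar> + real r * B \<le> (\<rho> - 1) * norm (ga y + of_nat i)"
          using \<rho> by (simp add: field_simps)
        thus "norm (al y + of_nat i) \<le> \<rho> * norm (ga y + of_nat i)"
          using 1 B by (intro norm_al_le) auto
        have "0 \<le> (\<bar>a\<bar> + real r * B) / (\<rho> - 1)" using \<rho> B by (intro divide_nonneg_pos) auto
        thus "ga y + of_nat i \<noteq> 0" using 2 by auto
      qed
      have "norm (pochhammer (al y) (N + m) * rGamma (ga y + of_nat (N + m))) \<le> C * \<rho> ^ m"
      proof (induction m)
        case 0
        show ?case using C[of y] y by simp
      next
        case (Suc m)
        have rG: "rGamma (ga y + of_nat (N + m)) = (ga y + of_nat (N + m)) * rGamma (ga y + of_nat (N + Suc m))"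
          using pochhammer_rGamma[of "ga y + of_nat (N + m)" 1] by (simp add: add_ac)
        have "norm (pochhammer (al y) (N + Suc m) * rGamma (ga y + of_nat (N + Suc m))) =
            norm (pochhammer (al y) (N + m) * rGamma (ga y + of_nat (N + Suc m))) * norm (al y + of_nat (N + m))"
          by (simp add: pochhammer_Suc norm_mult)
        also have "\<dots> \<le> norm (pochhammer (al y) (N + m) * rGamma (ga y + of_nat (N + Suc m))) * (\<rho> * norm (ga y + of_nat (N + m)))"
          by (intro mult_left_mono i) auto
        also have "\<dots> = norm (pochhammer (al y) (N + m) * rGamma (ga y + of_nat (N + m))) * \<rho>"
          unfolding rG by (simp add: norm_mult)
        also have "\<dots> \<le> C * \<rho> ^ m * \<rho>"
          using Suc \<rho> by (intro mult_right_mono) auto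
        finally show ?case by (simp add: mult_ac)
      qed
      hence "half_coeff x (N + m) * norm (pochhammer (al y) (N + m) * rGamma (ga y + of_nat (N + m)))
          \<le> x ^ (N + m) * (C * \<rho> ^ m)"
        using half_coeff_bounds[OF x_pos, of "N + m"] x_pos by (intro mult_mono) auto
      thus ?thesis using half_coeff_bounds[OF x_pos, of "N + m"]
        by (simp add: norm_mult power_mult_distrib power_add mult_ac)
    qed
    define h where "h = (\<lambda>n. complex_of_real (C * x ^ N * (x * \<rho>) ^ (n - N)))"
    have "summable (\<lambda>m. C * x ^ N * (x * \<rho>) ^ m)"
      using \<rho>x by (intro summable_mult summable_geometric) auto
    hence "summable (\<lambda>m. h (m + N))"
      unfolding h_def by (subst add_diff_cancel_right') (rule summable_of_real)
    hence "summable h" by (simp add: summable_iff_shift)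
    moreover have "range h \<subseteq> \<real>\<^sub>\<ge>\<^sub>0"
      unfolding h_def using C0 x_pos \<rho>x by (auto simp del: of_real_mult of_real_power intro!: mult_nonneg_nonneg)
    moreover have "eventually (\<lambda>n. \<forall>y\<in>ball w 1 \<inter> UNIV. norm (?t n y) \<le> norm (h n)) sequentially"
      using eventually_ge_at_top[of N]
    proof eventually_elim
      case (elim n)
      have h: "norm (h n) = C * x ^ N * (x * \<rho>) ^ (n - N)"
        unfolding h_def norm_of_real using C0 x_pos \<rho>x by (intro abs_of_nonneg mult_nonneg_nonneg) auto
      show ?case
        unfolding h using bound[of _ "n - N"] elim by auto
    qed
    ultimately show ?thesis by (intro exI[of _ 1] exI[of _ h]) auto
  qed
  have "\<And>k w. w \<in> UNIV \<Longrightarrow> ?t k field_differentiable (at w)"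
    using hol by (auto simp: holomorphic_on_def)
  then obtain g where g: "\<forall>w\<in>UNIV. (\<lambda>n. ?t n w) sums g w \<and> g field_differentiable (at w)"
    by (rule series_differentiable_comparison_complex[OF open_UNIV _ to_g]) blast
  have "g = freg"
    using g unfolding freg_def by (auto simp: sums_iff)
  thus ?thesis using g by (auto simp: holomorphic_on_def)
qed

lemmas freg_sums = freg_sums_holomorphic[THEN conjunct1, rule_format]
  and freg_holomorphic = freg_sums_holomorphic[THEN conjunct2]

lemma f_eq_freg:
  assumes "ga w \<notin> \<int>\<^sub>\<le>\<^sub>0"
  shows "f w = Gamma (ga w) * freg w"
proof -
  have "of_real (half_coeff x k) * (pochhammer (al w) k * rGamma (ga w + of_nat k)) =
      rGamma (ga w) * (of_real (half_coeff x k) * (pochhammer (al w) k / pochhammer (ga w) k))" for k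
    using pochhammer_rGamma[of "ga w" k] pochhammer_neq_0_nonpos[OF assms, of k] by simp
  hence "(\<lambda>k. rGamma (ga w) * (of_real (half_coeff x k) * (pochhammer (al w) k / pochhammer (ga w) k))) sums freg w"
    using freg_sums[of w] by simp
  moreover have "(\<lambda>k. rGamma (ga w) * (of_real (half_coeff x k) * (pochhammer (al w) k / pochhammer (ga w) k))) sums (rGamma (ga w) * f w)"
    by (intro sums_mult f_sums)
  ultimately have "freg w = rGamma (ga w) * f w"
    using sums_unique2 by blast
  thus ?thesis using assms by (simp add: Gamma_def rGamma_eq_zero_iff)
qed

end

section \<open>The nodes\<close>

lemma hyp2F1_eq_Fk:
  fixes \<beta> \<gamma> z :: real
  assumes "\<gamma> \<notin> \<int>\<^sub>\<le>\<^sub>0"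
  shows "hyp2F1 (of_real \<beta>) (- of_nat k) (of_real \<gamma>) (of_real z) = of_real (Fk k \<beta> \<gamma> z / pochhammer \<gamma> k)"
proof -
  have g: "pochhammer \<gamma> j \<noteq> 0" for j using assms by (auto simp: pochhammer_eq_0_iff)
  let ?c = "\<lambda>j. pochhammer (of_real \<beta>) j * pochhammer (- of_nat k :: complex) j / (pochhammer (of_real \<gamma>) j * fact j) * of_real z ^ j"
  let ?d = "\<lambda>j. (-1) ^ j * real (k choose j) * pochhammer \<beta> j * pochhammer (\<gamma> + real j) (k - j) * z ^ j"
  have "?c sums (\<Sum>j\<in>{0..k}. ?c j)"
    by (intro sums_finite) (auto simp: pochhammer_of_nat_eq_0_iff)
  hence "hyp2F1 (of_real \<beta>) (- of_nat k) (of_real \<gamma>) (of_real z) = (\<Sum>j\<in>{0..k}. ?c j)"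
    unfolding hyp2F1_def by (simp add: sums_iff)
  also have "\<dots> = (\<Sum>j\<in>{0..k}. of_real (?d j / pochhammer \<gamma> k))"
  proof (rule sum.cong)
    fix j assume j: "j \<in> {0..k}"
    have "pochhammer \<gamma> k = pochhammer \<gamma> j * pochhammer (\<gamma> + real j) (k - j)"
      using j by (intro pochhammer_product) auto
    hence 1: "?d j / pochhammer \<gamma> k = (-1) ^ j * real (k choose j) * pochhammer \<beta> j * z ^ j / pochhammer \<gamma> j"
      using g[of k] by auto
    have "real (k choose j) = (-1) ^ j * pochhammer (- real k) j / fact j"
      by (simp add: binomial_gbinomial gbinomial_pochhammer)
    hence "?d j / pochhammer \<gamma> k = ((-1) ^ j * (-1) ^ j) * (pochhammer \<beta> j * pochhammer (- real k) j / (pochhammer \<gamma> j * fact j) * z ^ j)"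
      unfolding 1 by (simp add: mult_ac)
    also have "(-1) ^ j * (-1) ^ j = (1::real)" by (simp flip: power_mult_distrib)
    finally show "?c j = of_real (?d j / pochhammer \<gamma> k)"
      by (simp add: pochhammer_of_real[symmetric])
  qed auto
  also have "\<dots> = of_real (Fk k \<beta> \<gamma> z / pochhammer \<gamma> k)"
    by (simp add: Fk_def sum_divide_distrib)
  finally show ?thesis .
qed

lemma half_minus_nat_notin_Ints: "1/2 - real k \<notin> \<int>" "(1/2 - of_nat k :: complex) \<notin> \<int>"
proof -
  show "1/2 - real k \<notin> \<int>"
  proof
    assume "1/2 - real k \<in> \<int>"
    then obtain n :: int where "1/2 - real k = of_int n" by (auto elim: Ints_cases)
    hence "real_of_int 1 = real_of_int (2 * (n + int k))" by simp
    hence "1 = 2 * (n + int k)" by (subst (asm) of_int_eq_iff)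
    thus False by presburger
  qed
  show "(1/2 - of_nat k :: complex) \<notin> \<int>"
  proof
    assume "(1/2 - of_nat k :: complex) \<in> \<int>"
    then obtain n :: int where "(1/2 - of_nat k :: complex) = of_int n" by (auto elim: Ints_cases)
    hence "complex_of_int 1 = complex_of_int (2 * (n + int k))" by (simp add: field_simps)
    hence "1 = 2 * (n + int k)" by (subst (asm) of_int_eq_iff)
    thus False by presburger
  qed
qed

context gauss_family
begin

lemma fd_eq: "fd w = dual_f (2 / of_nat r - w)"
proof -
  interpret D: gauss_family p r dual_a x by (rule gauss_family_axioms)
  have "D.al (2 / of_nat r - w) = 1 - al w" "D.ga (2 / of_nat r - w) = 2 - ga w"
    using r_pos unfolding D.al_def al_def D.ga_def ga_def by (simp_all add: right_diff_distrib)
  thus ?thesis unfolding D.f_def fd_def by simp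
qed

text \<open>The reflection w -> 2/r - w turns left half planes into right ones, and the limit of the
  dual family is the same because \<open>limit_f\<close> is free of a.\<close>

lemma fd_tendsto:
  assumes "0 \<le> M"
  shows "(fd \<longlongrightarrow> of_real limit_f) (inf at_infinity (principal {w. Re w \<le> M}))"
proof -
  interpret D: gauss_family p r dual_a x by (rule gauss_family_axioms)
  have "filterlim (\<lambda>w. 2 / of_nat r + (- w) :: complex) at_infinity at_infinity"
    by (intro tendsto_add_filterlim_at_infinity[OF tendsto_const])
       (simp add: filterlim_at_infinity_conv_norm_at_top filterlim_norm_at_top)
  hence "filterlim (\<lambda>w. 2 / of_nat r + (- w) :: complex) at_infinity (inf at_infinity (principal {w. Re w \<le> M}))"
    by (rule filterlim_mono) auto
  moreover have "eventually (\<lambda>w. 2 / of_nat r + (- w) \<in> {w. - M \<le> Re w}) (inf at_infinity (principal {w. Re w \<le> M}))"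
    unfolding eventually_inf_principal by (intro always_eventually) (auto simp: algebra_simps intro!: add_increasing2)
  ultimately have "filterlim (\<lambda>w. 2 / of_nat r + (- w) :: complex) (right_infinity M) (inf at_infinity (principal {w. Re w \<le> M}))"
    by (simp add: filterlim_inf filterlim_principal)
  from filterlim_compose[OF D.f_tendsto[OF assms] this] show ?thesis
    by (simp add: fd_eq[abs_def] D.limit_f_def limit_f_def)
qed

text \<open>The part of the prefactor of \<open>shiftJ\<close> at i = p, k = r - p that does not
  depend on w.\<close>

definition cross_factor :: complex where
  "cross_factor = of_real ((-1) ^ (r - p) * (1 - x) ^ (r - p) / x ^ r)"

text \<open>The first factor clears the denominators of the second sequence and vanishes at the
  nodes; the other two come from the normalisation of the first sequence.\<close>

definition shift_factor :: "complex \<Rightarrow> complex" where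
  "shift_factor w = pochhammer (ga w - 1/2) r * pochhammer (al w) p * pochhammer (ga w - al w) (r - p)"

lemma cross_factor_nonzero: "cross_factor \<noteq> 0"
  using x_pos x_less_1 by (simp add: cross_factor_def)

text \<open>The Casoratian at i = p, k = r - p, where the index shift is exactly w -> w + 1,
  multiplied by (gamma)_r to remove the last denominator.\<close>

lemma cross_difference_poly:
  "\<exists>P. low_degree r P \<and> (\<forall>w. ga w \<notin> \<int> \<longrightarrow>
     cross_factor * pochhammer (ga w - 1) r * pochhammer (ga w) r * f w * fd (w + 1)
       - shift_factor w * f (w + 1) * fd w = pochhammer (ga w) r * (ga w - 1) * poly P w)"
proof -
  obtain P where P: "low_degree (p + (r - p)) P" "\<And>w. of_nat r * w \<notin> \<int> \<Longrightarrow>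
     casoratian (of_nat p * w + of_real a) (of_nat r * w) (of_real x) p (r - p) = (of_nat r * w - 1) * poly P w"
    using casoratian_poly[OF norm_x] by blast
  have pr: "p + (r - p) = r" using p_less_r by simp
  have "cross_factor * pochhammer (ga w - 1) r * pochhammer (ga w) r * f w * fd (w + 1)
       - shift_factor w * f (w + 1) * fd w = pochhammer (ga w) r * (ga w - 1) * poly P w" if w: "ga w \<notin> \<int>" for w
  proof -
    have nz: "pochhammer (ga w) r \<noteq> 0" using notin_Ints_shift[OF w] by blast
    have 1: "f (w + 1) = hyp2F1 (al w + of_nat p) (1/2) (ga w + of_nat r) (of_real x)"
      "fd (w + 1) = hyp2F1 (1 - al w - of_nat p) (1/2) (2 - ga w - of_nat r) (of_real x)"
      unfolding f_def fd_def al_plus_1 ga_plus_1 by (simp_all only: diff_diff_eq)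
    have "casoratian (al w) (ga w) (of_real x) p (r - p) =
        f w * (cross_factor * pochhammer (ga w - 1) r * fd (w + 1))
        - pochhammer (ga w - 1/2) r * fd w * (pochhammer (al w) p * pochhammer (ga w - al w) (r - p) / pochhammer (ga w) r * f (w + 1))"
      unfolding casoratian_def shiftI_def shiftJ_def pr cross_factor_def 1
      by (simp add: f_def fd_def)
    hence "pochhammer (ga w) r * casoratian (al w) (ga w) (of_real x) p (r - p) =
       cross_factor * pochhammer (ga w - 1) r * pochhammer (ga w) r * f w * fd (w + 1)
       - shift_factor w * f (w + 1) * fd w"
      using nz by (simp add: shift_factor_def right_diff_distrib mult_ac)
    thus ?thesis using P(2)[of w] w unfolding al_def ga_def by (simp add: mult.assoc)
  qed
  thus ?thesis using P(1) pr by auto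
qed

definition cross_relation :: bool where
  "cross_relation \<longleftrightarrow> (\<forall>w. ga w \<notin> \<int> \<longrightarrow>
     cross_factor * pochhammer (ga w - 1) r * pochhammer (ga w) r * f w * fd (w + 1) = shift_factor w * f (w + 1) * fd w)"

text \<open>Legendre's relation writes 1 as a difference of two products, one containing f w and the
  other fd w.\<close>

lemma not_both_zero:
  assumes "ga w \<notin> \<int>"
  shows "f w \<noteq> 0 \<or> fd w \<noteq> 0"
  using hyp2F1_legendre[OF norm_x(1) assms, of "al w" "1/2"] by (auto simp: f_def fd_def)

definition node :: "nat \<Rightarrow> complex" where "node k = (1/2 - of_nat k) / of_nat r"

lemma ga_node: "ga (node k) = 1/2 - of_nat k" "ga (node k) \<notin> \<int>"
  using half_minus_nat_notin_Ints r_pos by (simp_all add: ga_def node_def)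

lemma pochhammer_node_nonzero:
  "pochhammer (ga (node k)) n \<noteq> 0" "pochhammer (ga (node k) - 1) n \<noteq> 0" "ga (node k) - 1 \<noteq> 0"
proof -
  have 1: "ga (node k) - 1 \<notin> \<int>" using notin_Ints_shift(2)[OF ga_node(2), of k 1] by simp
  thus "pochhammer (ga (node k) - 1) n \<noteq> 0" "ga (node k) - 1 \<noteq> 0"
    using notin_Ints_shift(8)[OF 1] by auto
  show "pochhammer (ga (node k)) n \<noteq> 0" by (rule notin_Ints_shift(8)[OF ga_node(2)])
qed

(* At gamma = 1/2 - k, Euler's transformation replaces the parameter 1/2 by -k: the series terminates. *)
lemma f_node_eq_0_iff:
  "f (node k) = 0 \<longleftrightarrow> Fk k ((1/2 - real k) * (1 - real p / real r) - a) (1/2 - real k) x = 0"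
proof -
  have 1: "ga (node k) - al (node k) = of_real ((1/2 - real k) * (1 - real p / real r) - a)"
    using r_pos by (simp add: ga_node al_def) (simp add: node_def field_simps)
  have 2: "ga (node k) = of_real (1/2 - real k)" by (simp add: ga_node)
  have 3: "1/2 - real k \<notin> \<int>\<^sub>\<le>\<^sub>0" using half_minus_nat_notin_Ints nonpos_Ints_Int by blast
  hence 4: "pochhammer (1/2 - real k) k \<noteq> 0" by (auto simp: pochhammer_eq_0_iff)
  have "f (node k) = 0 \<longleftrightarrow> hyp2F1 (ga (node k) - al (node k)) (ga (node k) - 1/2) (ga (node k)) (of_real x) = 0"
    unfolding f_def using ga_node(2) notin_Ints_shift(7)
    by (intro hyp2F1_euler_eq_0_iff[symmetric] norm_x) auto
  also have "ga (node k) - 1/2 = - of_nat k" by (simp add: ga_node)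
  also have "hyp2F1 (ga (node k) - al (node k)) (- of_nat k) (ga (node k)) (of_real x) =
      of_real (Fk k ((1/2 - real k) * (1 - real p / real r) - a) (1/2 - real k) x / pochhammer (1/2 - real k) k)"
    unfolding 1 unfolding 2 by (rule hyp2F1_eq_Fk[OF 3])
  also have "\<dots> = 0 \<longleftrightarrow> Fk k ((1/2 - real k) * (1 - real p / real r) - a) (1/2 - real k) x = 0"
    using 4 by (simp only: of_real_eq_0_iff divide_eq_0_iff simp_thms)
  finally show ?thesis .
qed

text \<open>The condition k + k' = r - 1 is what makes the reflected point a node again: 2 - (1/2 -
  k) - r = 1/2 - k'.\<close>

lemma node_dual:
  assumes "k + k' = r - 1"
  shows "2 / of_nat r - (node k + 1) = node k'"
proof -
  have "r = k + k' + 1" using assms r_pos by linarith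
  hence R: "(of_nat r :: complex) = of_nat k + of_nat k' + 1" by simp
  have "2 / of_nat r - (node k + 1) = (2 - (1/2 - of_nat k) - of_nat r) / of_nat r"
    using r_pos by (simp add: node_def add_divide_distrib diff_divide_distrib)
  also have "2 - (1/2 - of_nat k) - of_nat r = (1/2 - of_nat k' :: complex)"
    unfolding R by simp
  finally show ?thesis by (simp add: node_def)
qed

lemma shift_factor_node:
  assumes "k < r"
  shows "shift_factor (node k) = 0"
proof -
  have "pochhammer (ga (node k) - 1/2) r = 0"
    using assms by (auto simp: ga_node pochhammer_eq_0_iff)
  thus ?thesis by (simp add: shift_factor_def)
qed

lemma cross_difference_node:
  assumes "low_degree r P" and P: "\<And>w. ga w \<notin> \<int> \<Longrightarrow>
     cross_factor * pochhammer (ga w - 1) r * pochhammer (ga w) r * f w * fd (w + 1)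
       - shift_factor w * f (w + 1) * fd w = pochhammer (ga w) r * (ga w - 1) * poly P w"
    and "k < r"
  shows "poly P (node k) = 0 \<longleftrightarrow> f (node k) * fd (node k + 1) = 0"
proof -
  show ?thesis
    using P[OF ga_node(2), of k] pochhammer_node_nonzero[of k] cross_factor_nonzero unfolding shift_factor_node[OF assms(3)] by auto
qed

lemma cross_relation_if_nodes:
  assumes "\<And>k. k < r \<Longrightarrow> f (node k) * fd (node k + 1) = 0"
  shows "cross_relation"
proof -
  obtain P where P: "low_degree r P" "\<And>w. ga w \<notin> \<int> \<Longrightarrow>
     cross_factor * pochhammer (ga w - 1) r * pochhammer (ga w) r * f w * fd (w + 1)
       - shift_factor w * f (w + 1) * fd w = pochhammer (ga w) r * (ga w - 1) * poly P w"
    using cross_difference_poly by blast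
  have "P = 0"
  proof (rule ccontr)
    assume "P \<noteq> 0"
    have "inj_on node {..<r}" using r_pos by (auto simp: inj_on_def node_def)
    hence "r = card (node ` {..<r})" by (simp add: card_image)
    also have "\<dots> \<le> card {w. poly P w = 0}"
      using cross_difference_node[OF P] assms \<open>P \<noteq> 0\<close> poly_roots_finite by (intro card_mono) auto
    also have "\<dots> \<le> degree P" by (rule card_poly_roots_bound[OF \<open>P \<noteq> 0\<close>])
    also have "\<dots> < r" using P(1) \<open>P \<noteq> 0\<close> by (simp add: low_degree_def)
    finally show False by simp
  qed
  thus ?thesis using P(2) by (simp add: cross_relation_def)
qed

lemma nodes_if_cross_relation:
  assumes "cross_relation" "k < r"
  shows "f (node k) * fd (node k + 1) = 0"
proof -
  show ?thesis
    using assms(1)[unfolded cross_relation_def, rule_format, OF ga_node(2), of k] pochhammer_node_nonzero[of k] cross_factor_nonzero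
    unfolding shift_factor_node[OF assms(2)] by auto
qed

end

section \<open>Poles and rational recurrences\<close>

lemma hyp2F1_nonneg_terms_nonzero:
  fixes t :: "nat \<Rightarrow> real"
  assumes "norm z < 1" and t: "\<And>k. pochhammer a k * pochhammer b k / (pochhammer c k * fact k) * z ^ k = of_real (t k)"
    and nonneg: "\<And>k. 0 \<le> t k"
  shows "hyp2F1 a b c z \<noteq> 0"
proof -
  have s: "(\<lambda>k. complex_of_real (t k)) sums hyp2F1 a b c z"
    using hyp2F1_sums[OF assms(1), of a b c] unfolding t .
  hence "hyp2F1 a b c z = of_real (\<Sum>k. t k)" and summ: "summable t"
    using summable_complex_of_real[of t] by (auto simp: sums_iff suminf_of_real)
  moreover have "t 0 = 1"
    using t[of 0] by simp
  hence "1 \<le> (\<Sum>k. t k)"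
    using sum_le_suminf[OF summ, of "{0}"] nonneg by auto
  ultimately show ?thesis by auto
qed

lemma hyp2F1_nonneg_params_nonzero:
  fixes a b c z :: real
  assumes "0 \<le> z" "z < 1" "0 \<le> a" "0 \<le> b" "0 < c"
  shows "hyp2F1 (of_real a) (of_real b) (of_real c) (of_real z) \<noteq> 0"
proof (rule hyp2F1_nonneg_terms_nonzero)
  have "pochhammer u k \<ge> 0" if "0 \<le> u" for u :: real and k
    unfolding pochhammer_prod using that by (intro prod_nonneg) auto
  thus "0 \<le> pochhammer a k * pochhammer b k / (pochhammer c k * fact k) * z ^ k" for k
    using assms by (intro mult_nonneg_nonneg divide_nonneg_nonneg) auto
qed (use assms in \<open>auto simp: pochhammer_of_real[symmetric]\<close>)

text \<open>For negative a, Euler's transformation passes to the parameters c - a and c - 1/2, which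
  are positive.\<close>

lemma hyp2F1_half_nonzero:
  fixes a c z :: real
  assumes z: "0 \<le> z" "z < 1" and c: "1/2 < c"
  shows "hyp2F1 (of_real a) (1/2) (of_real c) (of_real z) \<noteq> 0"
proof (cases "0 \<le> a")
  case True
  thus ?thesis using hyp2F1_nonneg_params_nonzero[of z a "1/2" c] assms by simp
next
  case False
  have 1: "complex_of_real c \<notin> \<int>\<^sub>\<le>\<^sub>0"
    using c by (auto elim!: nonpos_Ints_cases dest!: arg_cong[of _ _ Re])
  have "hyp2F1 (of_real (c - a)) (of_real (c - 1/2)) (of_real c) (of_real z) \<noteq> 0"
    using assms False by (intro hyp2F1_nonneg_params_nonzero) auto
  thus ?thesis
    using hyp2F1_euler_eq_0_iff[OF _ 1, of "of_real z" "of_real a" "1/2"] z by simp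
qed

text \<open>Up to the index where the series breaks off, numerator i - m and denominator c + i are
  both nonpositive, since c + i <= c + m - 1 < 0; so no cancellation occurs.\<close>

lemma hyp2F1_terminating_nonzero:
  fixes c z :: real
  assumes z: "0 \<le> z" "z < 1" and c: "c + real m < 1"
  shows "hyp2F1 (- of_nat m) (1/2) (of_real c) (of_real z) \<noteq> 0"
proof (rule hyp2F1_nonneg_terms_nonzero)
  have 1: "0 \<le> pochhammer (- real m) k / pochhammer c k" for k
  proof (cases "k \<le> m")
    case True
    have "pochhammer (- real m) k / pochhammer c k = (\<Prod>i = 0..<k. (real i - real m) / (c + real i))"
      by (simp add: pochhammer_prod prod_dividef)
    also have "\<dots> \<ge> 0"
    proof (intro prod_nonneg)
      fix i assume "i \<in> {0..<k}"
      hence "real i - real m \<le> 0" "c + real i \<le> 0" using True c by auto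
      thus "0 \<le> (real i - real m) / (c + real i)" by (rule divide_nonpos_nonpos)
    qed
    finally show ?thesis .
  next
    case False
    hence "pochhammer (- real m) k = 0" by (simp add: pochhammer_of_nat_eq_0_iff)
    thus ?thesis by simp
  qed
  have 2: "0 \<le> pochhammer (1/2 :: real) k" for k
    by (intro less_imp_le pochhammer_pos) auto
  show "0 \<le> pochhammer (- real m) k / pochhammer c k * (pochhammer (1/2) k / fact k * z ^ k)" for k
    using z by (intro mult_nonneg_nonneg 1 divide_nonneg_nonneg 2) auto
  show "pochhammer (- of_nat m) k * pochhammer (1/2) k / (pochhammer (complex_of_real c) k * fact k) * complex_of_real z ^ k =
      complex_of_real (pochhammer (- real m) k / pochhammer c k * (pochhammer (1/2) k / fact k * z ^ k))" for k
    by (simp add: pochhammer_of_real[symmetric])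
qed (use z in auto)

(* Gamma is 0 at its poles, so the functional equation survives there. *)
lemma Gamma_plus1_nonzero:
  fixes z :: complex
  assumes "z \<noteq> 0"
  shows "Gamma (z + 1) = z * Gamma z"
proof (cases "z \<in> \<int>\<^sub>\<le>\<^sub>0")
  case True
  then obtain n where n: "z = - of_nat n" by (elim nonpos_Ints_cases')
  with assms obtain m where "n = Suc m" by (cases n) auto
  hence "z + 1 = - of_nat m" using n by simp
  hence "z + 1 \<in> \<int>\<^sub>\<le>\<^sub>0" by simp
  hence "Gamma (z + 1) = 0" "Gamma z = 0" using True by (simp_all only: Gamma_eq_zero_iff)
  thus ?thesis by simp
qed (rule Gamma_plus1)

lemma poly_pochhammer: "poly (pochhammer q n) w = pochhammer (poly q w) n"
  by (induction n) (simp_all add: pochhammer_Suc poly_of_nat)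

lemma eventually_affine_notin_Ints:
  fixes c u z :: complex
  assumes "c \<noteq> 0"
  shows "eventually (\<lambda>w. c * w + u \<notin> \<int>) (at z)"
proof -
  let ?g = "\<lambda>w. c * w + u"
  have g: "(?g \<longlongrightarrow> ?g z) (at z)" by (intro tendsto_intros)
  show ?thesis
  proof (cases "?g z \<in> \<int>")
    case False
    have "eventually (\<lambda>v. ?g v \<in> - \<int>) (at z)"
      using False by (intro topological_tendstoD[OF g]) (auto simp: open_Compl)
    thus ?thesis by simp
  next
    case True
    have "eventually (\<lambda>v. dist (?g v) (?g z) < 1) (at z)"
      by (intro tendstoD[OF g]) simp
    moreover have "eventually (\<lambda>v. v \<noteq> z) (at z)"
      by (simp add: eventually_at_filter)
    ultimately show ?thesis
    proof eventually_elim
      case (elim v)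
      show ?case
      proof
        assume "?g v \<in> \<int>"
        hence "?g v - ?g z \<in> \<int>" using True by (rule Ints_diff)
        then obtain n where n: "?g v - ?g z = of_int n" by (auto elim: Ints_cases)
        hence "\<bar>real_of_int n\<bar> < 1" using elim(1) unfolding dist_norm n by simp
        hence "n = 0" by linarith
        thus False using n elim(2) assms by simp
      qed
    qed
  qed
qed

section \<open>Continuity and poles of f\<close>

context gauss_family
begin

lemma hgf_eq_f: "hgf (real p) 0 (real r) a (1/2) x = f"
  by (rule ext) (simp add: hgf_def f_def al_def ga_def)

lemma ga_nonpos_plus_1: "ga w \<notin> \<int>\<^sub>\<le>\<^sub>0 \<Longrightarrow> ga (w + 1) \<notin> \<int>\<^sub>\<le>\<^sub>0"
proof (erule contrapos_nn)
  assume "ga (w + 1) \<in> \<int>\<^sub>\<le>\<^sub>0"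
  then obtain n where "ga w + of_nat r = - of_nat n"
    unfolding ga_plus_1 by (elim nonpos_Ints_cases')
  hence "ga w = - of_nat (n + r)" by (simp add: algebra_simps eq_neg_iff_add_eq_0)
  thus "ga w \<in> \<int>\<^sub>\<le>\<^sub>0" by (simp only: minus_of_nat_in_nonpos_Ints)
qed

lemma ga_Ints_plus_1: "ga (w + 1) \<in> \<int> \<longleftrightarrow> ga w \<in> \<int>"
  unfolding ga_plus_1 using Ints_add[of "ga w" "of_nat r"] Ints_diff[of "ga w + of_nat r" "of_nat r"] by auto

lemma continuous_ga: "isCont ga w"
  unfolding ga_def by (intro continuous_intros)

lemma eventually_ga_nonint: "eventually (\<lambda>v. ga v \<notin> \<int>) (at w)"
  using eventually_affine_notin_Ints[of "of_nat r" 0 w] r_pos by (simp add: ga_def)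

lemma f_holomorphic: "f holomorphic_on {w. ga w \<notin> \<int>\<^sub>\<le>\<^sub>0}"
proof -
  have "(\<lambda>w. Gamma (ga w) * freg w) holomorphic_on {w. ga w \<notin> \<int>\<^sub>\<le>\<^sub>0}"
    unfolding ga_def by (intro holomorphic_intros holomorphic_on_subset[OF freg_holomorphic]) auto
  thus ?thesis by (rule holomorphic_transform) (simp add: f_eq_freg)
qed

lemma open_ga: "open {w. ga w \<notin> \<int>\<^sub>\<le>\<^sub>0}"
proof -
  have "open (ga -` (- \<int>\<^sub>\<le>\<^sub>0))"
    by (intro open_vimage continuous_at_imp_continuous_on ballI continuous_ga) (simp add: open_Compl)
  thus ?thesis by (simp add: vimage_def)
qed

lemma isCont_f: "ga w \<notin> \<int>\<^sub>\<le>\<^sub>0 \<Longrightarrow> isCont f w"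
  using holomorphic_on_imp_continuous_on[OF f_holomorphic] open_ga by (simp add: continuous_on_eq_continuous_at)

lemma isCont_f_shift: "ga w \<notin> \<int>\<^sub>\<le>\<^sub>0 \<Longrightarrow> isCont (\<lambda>v. f (v + 1)) w"
  using isCont_o2[where g = f and f = "\<lambda>v. v + 1" and a = w] isCont_f[OF ga_nonpos_plus_1] by simp

lemma isCont_fd: "2 - ga w \<notin> \<int>\<^sub>\<le>\<^sub>0 \<Longrightarrow> isCont fd w"
proof -
  assume w: "2 - ga w \<notin> \<int>\<^sub>\<le>\<^sub>0"
  interpret D: gauss_family p r dual_a x by (rule gauss_family_axioms)
  have "D.ga (2 / of_nat r - w) = 2 - ga w"
    using r_pos by (simp add: D.ga_def ga_def right_diff_distrib)
  hence "isCont D.f (2 / of_nat r - w)" using w by (intro D.isCont_f) simp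
  hence "isCont (\<lambda>w. D.f (2 / of_nat r - w)) w"
    by (intro isCont_o2[where g = D.f and f = "\<lambda>w. 2 / of_nat r - w"] continuous_intros) auto
  thus ?thesis by (simp add: fd_eq[abs_def])
qed

lemma pole_imp_ga:
  assumes "is_pole f w"
  shows "ga w \<in> \<int>\<^sub>\<le>\<^sub>0"
proof (rule ccontr)
  assume "ga w \<notin> \<int>\<^sub>\<le>\<^sub>0"
  hence "(f \<longlongrightarrow> f w) (at w)" using isCont_f by (simp add: isCont_def)
  thus False using assms not_tendsto_and_filterlim_at_infinity[of "at w" f] unfolding is_pole_def by auto
qed

lemma is_pole_f:
  assumes "ga w = - of_nat n" "freg w \<noteq> 0"
  shows "is_pole f w"
proof -
  have "filterlim ga (at (- of_nat n)) (at w)"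
  proof (rule filterlim_atI)
    show "(ga \<longlongrightarrow> - of_nat n) (at w)" using continuous_ga[of w] assms(1) by (simp add: isCont_def)
    have "eventually (\<lambda>v. v \<noteq> w) (at w)" by (simp add: eventually_at_filter)
    thus "eventually (\<lambda>v. ga v \<noteq> - of_nat n) (at w)"
      unfolding assms(1)[symmetric] by (rule eventually_mono) (use r_pos in \<open>simp add: ga_def\<close>)
  qed
  from filterlim_compose[OF Gamma_poles this] have G: "filterlim (\<lambda>v. Gamma (ga v)) at_infinity (at w)" .
  have "isCont freg w"
    using holomorphic_on_imp_continuous_on[OF freg_holomorphic] by (simp add: continuous_on_eq_continuous_at)
  hence "filterlim (\<lambda>v. freg v * Gamma (ga v)) at_infinity (at w)"
    using assms(2) by (intro tendsto_mult_filterlim_at_infinity[OF _ _ G, where c = "freg w"]) (auto simp: isCont_def)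
  moreover have ev: "eventually (\<lambda>v. freg v * Gamma (ga v) = f v) (at w)"
    using eventually_ga_nonint[of w]
    by eventually_elim (subst f_eq_freg, use nonpos_Ints_Int in auto)
  ultimately show ?thesis unfolding is_pole_def filterlim_cong[OF refl refl ev] by simp
qed

text \<open>At ga w = -n the terms of index up to n vanish because \<open>rGamma\<close> does. All
  later ones share the factor (alpha)_(n+1), and their cofactors are positive.\<close>

lemma freg_nonzero:
  assumes w: "ga w = - of_nat n" "al w = of_real \<alpha>"
    and \<alpha>: "pochhammer \<alpha> (n + 1) \<noteq> 0" "0 < \<alpha> + real n + 1"
  shows "freg w \<noteq> 0"
proof -
  let ?t = "\<lambda>k. of_real (half_coeff x k) * (pochhammer (al w) k * rGamma (ga w + of_nat k))"
  define B where "B = (\<lambda>m. half_coeff x (m + (n + 1)) * pochhammer (\<alpha> + real n + 1) m / fact m)"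
  have B: "0 < B m" for m
    unfolding B_def using half_coeff_bounds[OF x_pos] \<alpha>(2) by (intro divide_pos_pos mult_pos_pos pochhammer_pos) auto
  have "?t k = 0" if "k < n + 1" for k
  proof -
    have "ga w + of_nat k = - of_nat (n - k)" using that by (simp add: w of_nat_diff)
    hence "rGamma (ga w + of_nat k) = 0" by (simp add: rGamma_eq_zero_iff)
    thus ?thesis by simp
  qed
  hence "(\<Sum>k<n + 1. ?t k) = 0" by (intro sum.neutral) auto
  hence "(\<lambda>m. ?t (m + (n + 1))) sums freg w"
    using sums_iff_shift[of ?t "n + 1" "freg w"] freg_sums[of w] by simp
  also have "(\<lambda>m. ?t (m + (n + 1))) = (\<lambda>m. of_real (pochhammer \<alpha> (n + 1) * B m))"
  proof
    fix m
    have "pochhammer \<alpha> (m + (n + 1)) = pochhammer \<alpha> (n + 1) * pochhammer (\<alpha> + real n + 1) m"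
      using pochhammer_product'[of \<alpha> "n + 1" m] by (simp add: add_ac)
    moreover have "ga w + of_nat (m + (n + 1)) = of_nat m + 1" by (simp add: w)
    hence "rGamma (ga w + of_nat (m + (n + 1))) = of_real (1 / fact m)"
      by (simp only: add.commute[of _ 1]) (simp add: rGamma_inverse_Gamma Gamma_fact field_simps)
    ultimately show "?t (m + (n + 1)) = of_real (pochhammer \<alpha> (n + 1) * B m)"
      unfolding w(2) pochhammer_of_real B_def by simp
  qed
  finally have s: "(\<lambda>m. complex_of_real (pochhammer \<alpha> (n + 1) * B m)) sums freg w" .
  hence "summable (\<lambda>m. pochhammer \<alpha> (n + 1) * B m)"
    by (simp only: sums_iff summable_complex_of_real)
  hence "summable B" using \<alpha>(1) by (simp add: summable_cmult_iff)
  hence "suminf B > 0" using B by (intro suminf_pos)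
  moreover have "(\<lambda>m. complex_of_real (pochhammer \<alpha> (n + 1) * B m)) sums of_real (pochhammer \<alpha> (n + 1) * suminf B)"
    using \<open>summable B\<close> by (intro sums_of_real sums_mult summable_sums)
  hence "freg w = of_real (pochhammer \<alpha> (n + 1) * suminf B)"
    by (rule sums_unique2[OF s])
  ultimately show ?thesis using \<alpha>(1) by auto
qed

text \<open>The functional equation of Gamma makes g(w + 1) / g(w) a quotient of products of linear
  factors times the constant exp L. As f agrees with g only off a discrete set, the recurrence is
  extended to the remaining points by continuity.\<close>

lemma gamma_product_recurrence:
  assumes "solves_problem_I (real p) 0 (real r) a (1/2) x"
  obtains A B where "A \<noteq> 0" "B \<noteq> 0" "\<And>w. ga w \<notin> \<int>\<^sub>\<le>\<^sub>0 \<Longrightarrow> poly A w * f (w + 1) = poly B w * f w"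
proof -
  obtain C L us vs where C: "C \<noteq> 0" and ev: "\<forall>\<^sub>F w in cosparse UNIV.
       f w = C * exp (w * L) * (\<Prod>u\<leftarrow>us. Gamma (w + u)) / (\<Prod>v\<leftarrow>vs. Gamma (w + v))"
    using assms unfolding solves_problem_I_def hgf_eq_f by blast
  define g where "g = (\<lambda>w. C * exp (w * L) * (\<Prod>u\<leftarrow>us. Gamma (w + u)) / (\<Prod>v\<leftarrow>vs. Gamma (w + v)))"
  define lin where "lin = (\<lambda>us. (\<Prod>u\<leftarrow>us. [:u, 1:]) :: complex poly)"
  have lin0: "lin us \<noteq> 0" for us by (auto simp: lin_def prod_list_zero_iff)
  have lin: "(\<Prod>u\<leftarrow>us. Gamma (w + 1 + u)) = poly (lin us) w * (\<Prod>u\<leftarrow>us. Gamma (w + u))" if "\<forall>u\<in>set us. w + u \<noteq> 0" for us w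
    using that
  proof (induction us)
    case (Cons u us)
    have "Gamma (w + 1 + u) = (u + w) * Gamma (w + u)"
      using Gamma_plus1_nonzero[of "w + u"] Cons.prems by (simp add: add_ac)
    thus ?case using Cons by (simp add: lin_def algebra_simps)
  qed (simp add: lin_def)
  define A B where "A = lin vs" and "B = smult (exp L) (lin us)"
  have gs: "poly A w * g (w + 1) = poly B w * g w" if w: "\<forall>u\<in>set us \<union> set vs. w + u \<noteq> 0" for w
  proof -
    have "poly (lin vs) w \<noteq> 0"
    proof -
      have "poly (lin us) w = (\<Prod>u\<leftarrow>us. w + u)" for us
        by (induction us) (auto simp: lin_def algebra_simps)
      thus ?thesis using w by (auto simp: prod_list_zero_iff)
    qed
    moreover have "exp ((w + 1) * L) = exp L * exp (w * L)"
      by (simp add: distrib_right exp_add)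
    ultimately show ?thesis unfolding g_def A_def B_def using w
      by (simp add: lin)
  qed
  have "poly A w * f (w + 1) = poly B w * f w" if w: "ga w \<notin> \<int>\<^sub>\<le>\<^sub>0" for w
  proof -
    have e: "eventually (\<lambda>v. f v = g v) (at z)" for z
      using ev unfolding g_def by (simp add: eventually_cosparse_open_eq)
    have "eventually (\<lambda>v. f (v + 1) = g (v + 1)) (at w)"
      using e[of "w - (- 1)"] unfolding filtermap_at_shift[symmetric] eventually_filtermap by simp
    moreover have "eventually (\<lambda>v. v \<notin> uminus ` (set us \<union> set vs)) (at w)"
      using islimpt_finite[of "uminus ` (set us \<union> set vs)" w] by (simp add: islimpt_iff_eventually)
    ultimately have "eventually (\<lambda>v. poly A v * f (v + 1) = poly B v * f v) (at w)"
      using e[of w]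
    proof eventually_elim
      case (elim v)
      have "\<forall>u\<in>set us \<union> set vs. v + u \<noteq> 0"
        using elim(2) by (auto simp: add_eq_0_iff2 image_iff)
      from gs[OF this] elim show ?case by simp
    qed
    moreover have "((\<lambda>v. poly A v * f (v + 1)) \<longlongrightarrow> poly A w * f (w + 1)) (at w)"
      "((\<lambda>v. poly B v * f v) \<longlongrightarrow> poly B w * f w) (at w)"
      using isCont_f_shift[OF w] isCont_f[OF w] by (auto intro!: tendsto_intros simp: isCont_def)
    ultimately show ?thesis
      using tendsto_cong[of "\<lambda>v. poly A v * f (v + 1)" "\<lambda>v. poly B v * f v" "at w"]
        tendsto_unique[OF at_neq_bot] by blast
  qed
  moreover have "A \<noteq> 0" "B \<noteq> 0" using lin0 by (auto simp: A_def B_def)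
  ultimately show ?thesis using that by blast
qed

section \<open>Recurrences of f and fd as polynomial identities\<close>

text \<open>The map w -> 2/r - (w + 1). It takes the pair (w, w + 1) to the pair in reverse order
  for the dual, so a forward recurrence of the dual becomes a backward one of fd.\<close>

definition reflection :: "complex poly" where
  "reflection = [:2 / of_nat r - 1, -1:]"

lemma poly_reflection: "poly reflection w = 2 / of_nat r - 1 - w"
  by (simp add: reflection_def)

lemma dual_recurrence:
  assumes AB: "\<And>w. ga w \<notin> \<int>\<^sub>\<le>\<^sub>0 \<Longrightarrow> poly A w * dual_f (w + 1) = poly B w * dual_f w"
    and w: "2 - ga (w + 1) \<notin> \<int>\<^sub>\<le>\<^sub>0"
  shows "poly (A \<circ>\<^sub>p reflection) w * fd w = poly (B \<circ>\<^sub>p reflection) w * fd (w + 1)"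
proof -
  have "ga (poly reflection w) = 2 - ga (w + 1)"
    using r_pos by (simp add: poly_reflection ga_def algebra_simps)
  with AB[of "poly reflection w"] w
  have "poly A (poly reflection w) * dual_f (poly reflection w + 1) = poly B (poly reflection w) * dual_f (poly reflection w)"
    by simp
  moreover have e: "poly reflection w + 1 = 2 / of_nat r - w" "2 / of_nat r - (w + 1) = poly reflection w"
    by (simp_all add: poly_reflection)
  ultimately show ?thesis unfolding poly_pcompose fd_eq e by simp
qed

definition rel_poly :: "complex poly" where
  "rel_poly = smult cross_factor (pochhammer [:-1, of_nat r:] r * pochhammer [:0, of_nat r:] r)"

definition shift_poly :: "complex poly" where
  "shift_poly = pochhammer [:-1/2, of_nat r:] r * pochhammer [:of_real a, of_nat p:] p
     * pochhammer [:- of_real a, of_nat (r - p):] (r - p)"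

lemma poly_rel_poly: "poly rel_poly w = cross_factor * pochhammer (ga w - 1) r * pochhammer (ga w) r"
  by (simp add: rel_poly_def poly_pochhammer ga_def mult_ac)

lemma poly_shift_poly: "poly shift_poly w = shift_factor w"
proof -
  have e: "(of_nat (r - p) :: complex) = of_nat r - of_nat p" using p_less_r by (simp add: of_nat_diff)
  have "poly [:-1/2, of_nat r:] w = ga w - 1/2" "poly [:of_real a, of_nat p:] w = al w"
    "poly [:- of_real a, of_nat (r - p):] w = ga w - al w"
    by (simp_all add: ga_def al_def e right_diff_distrib mult.commute)
  thus ?thesis by (simp only: shift_poly_def poly_mult poly_pochhammer shift_factor_def)
qed

lemma rel_poly_nonzero_at: "ga w \<notin> \<int> \<Longrightarrow> poly rel_poly w \<noteq> 0"
  using notin_Ints_shift(8)[of "ga w"] notin_Ints_shift(8)[of "ga w - 1"] notin_Ints_shift(2)[of "ga w" 1]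
    cross_factor_nonzero by (auto simp: poly_rel_poly)

lemma cross_relation_alt:
  "cross_relation \<longleftrightarrow> (\<forall>w. ga w \<notin> \<int> \<longrightarrow> poly rel_poly w * f w * fd (w + 1) = poly shift_poly w * f (w + 1) * fd w)"
  by (simp add: cross_relation_def poly_rel_poly poly_shift_poly)

lemma infinite_nonint: "infinite {w. ga w \<notin> \<int>}"
proof -
  have "range node \<subseteq> {w. ga w \<notin> \<int>}" using ga_node by auto
  moreover have "inj node" using r_pos by (auto simp: inj_def node_def)
  hence "infinite (range node)" by (simp add: finite_image_iff)
  ultimately show ?thesis using infinite_super by blast
qed

text \<open>Here 2 - ga w = n + 2 > 1/2, so \<open>hyp2F1_half_nonzero\<close> applies whatever the
  sign of the first parameter is.\<close>

lemma fd_nonzero_at_pole: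
  assumes "ga w = - of_nat n"
  shows "fd w \<noteq> 0" "isCont fd w"
proof -
  have w: "w = of_real (- real n / real r)"
    using assms r_pos by (simp add: ga_def field_simps)
  have "1 - al w = of_real (1 - (real p * (- real n / real r) + a))" unfolding al_def w by simp
  moreover have 2: "2 - ga w = of_real (real n + 2)" using assms by simp
  ultimately show "fd w \<noteq> 0" unfolding fd_def
    using hyp2F1_half_nonzero[of x "real n + 2"] x_pos x_less_1 by (simp only: less_imp_le) simp
  have "2 - ga w \<notin> \<int>\<^sub>\<le>\<^sub>0"
  proof
    assume "2 - ga w \<in> \<int>\<^sub>\<le>\<^sub>0"
    then obtain m :: nat where m: "2 - ga w = - of_nat m" by (elim nonpos_Ints_cases')
    hence "real n + 2 = - real m" unfolding 2 by (metis of_real_eq_iff of_real_minus of_real_of_nat_eq)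
    thus False by linarith
  qed
  thus "isCont fd w" by (rule isCont_fd)
qed

(* The recurrences turn the Casoratian identity into M * (f * fd) = N with polynomials M and N; as
   fd is finite and nonzero at the poles of f, M vanishes at all of them. *)
lemma rational_ratios_imp_cross_relation:
  assumes AB: "A \<noteq> 0" "B \<noteq> 0" "\<And>w. ga w \<notin> \<int>\<^sub>\<le>\<^sub>0 \<Longrightarrow> poly A w * f (w + 1) = poly B w * f w"
    and AB': "A' \<noteq> 0" "B' \<noteq> 0" "\<And>w. 2 - ga (w + 1) \<notin> \<int>\<^sub>\<le>\<^sub>0 \<Longrightarrow> poly A' w * fd w = poly B' w * fd (w + 1)"
    and inf: "infinite {w. is_pole f w}"
  shows "cross_relation" "rel_poly * A * A' = shift_poly * B * B'"
proof -
  obtain P where P: "low_degree r P" "\<And>w. ga w \<notin> \<int> \<Longrightarrow>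
     cross_factor * pochhammer (ga w - 1) r * pochhammer (ga w) r * f w * fd (w + 1)
       - shift_factor w * f (w + 1) * fd w = pochhammer (ga w) r * (ga w - 1) * poly P w"
    using cross_difference_poly by blast
  define M where "M = rel_poly * A * A' - shift_poly * B * B'"
  define N where "N = pochhammer [:0, of_nat r:] r * [:-1, of_nat r:] * P * A * B'"
  have gaps: "poly [:-1, of_nat r:] w = ga w - 1" "poly [:0, of_nat r:] w = ga w" for w
    by (simp_all add: ga_def)
  have MN: "poly M w * (f w * fd w) = poly N w" if w: "ga w \<notin> \<int>" for w
  proof -
    have n1: "ga w \<notin> \<int>\<^sub>\<le>\<^sub>0" using w nonpos_Ints_Int by blast
    have "2 - ga (w + 1) \<notin> \<int>"
      using w ga_Ints_plus_1[of w] notin_Ints_shift(3)[of "ga (w+1)" 2] by simp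
    hence n2: "2 - ga (w + 1) \<notin> \<int>\<^sub>\<le>\<^sub>0" using nonpos_Ints_Int by blast
    \<comment> \<open>The Casoratian identity is multiplied by A B'; then A f(w + 1) = B f(w) and B'
      fd(w + 1) = A' fd(w) express everything at the single point w.\<close>
    have "poly M w * (f w * fd w) = poly rel_poly w * (poly A w * f w) * (poly A' w * fd w)
        - shift_factor w * (poly B w * f w) * (poly B' w * fd w)"
      by (simp add: M_def poly_shift_poly algebra_simps)
    also have "\<dots> = (poly rel_poly w * f w * fd (w + 1) - shift_factor w * f (w + 1) * fd w) * (poly A w * poly B' w)"
      unfolding AB(3)[OF n1, symmetric] AB'(3)[OF n2] by (simp add: algebra_simps)
    also have "\<dots> = pochhammer (ga w) r * (ga w - 1) * poly P w * (poly A w * poly B' w)"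
      using P(2)[OF w] by (simp add: poly_rel_poly)
    also have "\<dots> = poly N w"
      unfolding N_def poly_mult poly_pochhammer gaps by (simp add: mult_ac)
    finally show ?thesis .
  qed
  have zero: "poly M w = 0" if w: "is_pole f w" for w
  proof -
    obtain n where n: "ga w = - of_nat n" using pole_imp_ga[OF w] by (elim nonpos_Ints_cases')
    have fd: "(fd \<longlongrightarrow> fd w) (at w)" "fd w \<noteq> 0"
      using fd_nonzero_at_pole[OF n] by (auto simp: isCont_def)
    have inf: "filterlim (\<lambda>v. fd v * f v) at_infinity (at w)"
      using w unfolding is_pole_def by (intro tendsto_mult_filterlim_at_infinity[OF fd(1) fd(2)])
    have polyN: "(poly N \<longlongrightarrow> poly N w) (at w)" for N :: "complex poly"
      by (rule tendsto_poly) (rule tendsto_ident_at)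
    \<comment> \<open>M equals N / (f fd) near the pole; the numerator stays bounded while the
      denominator tends to infinity.\<close>
    have 1: "((\<lambda>v. poly N v / (fd v * f v)) \<longlongrightarrow> 0) (at w)"
      by (rule tendsto_divide_0[OF polyN inf])
    have "eventually (\<lambda>v. fd v * f v \<noteq> 0) (at w)"
      by (rule filterlim_at_infinity_imp_eventually_ne[OF inf])
    hence 2: "eventually (\<lambda>v. poly N v / (fd v * f v) = poly M v) (at w)"
      using eventually_ga_nonint[of w]
    proof eventually_elim
      case (elim v)
      show ?case using MN[OF elim(2)] elim(1) by (simp add: field_simps)
    qed
    have "(poly M \<longlongrightarrow> 0) (at w)"
      by (rule Lim_transform_eventually[OF 1 2])
    thus ?thesis by (rule tendsto_unique[OF at_neq_bot polyN])
  qed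
  have "M = 0"
  proof (rule ccontr)
    assume "M \<noteq> 0"
    hence "finite {w. poly M w = 0}" by (rule poly_roots_finite)
    moreover have "{w. is_pole f w} \<subseteq> {w. poly M w = 0}" using zero by auto
    ultimately show False using inf finite_subset by blast
  qed
  thus "rel_poly * A * A' = shift_poly * B * B'" by (simp add: M_def)
  have "N = 0"
  proof (rule ccontr)
    assume "N \<noteq> 0"
    hence "finite {w. poly N w = 0}" by (rule poly_roots_finite)
    moreover have "{w. ga w \<notin> \<int>} \<subseteq> {w. poly N w = 0}" using MN \<open>M = 0\<close> by auto
    ultimately show False using infinite_nonint finite_subset by blast
  qed
  hence "poly P w = 0 \<or> poly (A * B') w = 0" if "ga w \<notin> \<int>" for w
  proof -
    have "pochhammer (ga w) r \<noteq> 0" "ga w - 1 \<noteq> 0" using notin_Ints_shift(8)[OF that] that by auto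
    moreover have "poly N w = pochhammer (ga w) r * (ga w - 1) * poly P w * poly (A * B') w"
      unfolding N_def poly_mult poly_pochhammer gaps by (simp add: mult_ac)
    ultimately show ?thesis using \<open>N = 0\<close> by auto
  qed
  hence "{w. ga w \<notin> \<int>} \<subseteq> {w. poly (P * (A * B')) w = 0}" by auto
  hence "infinite {w. poly (P * (A * B')) w = 0}" using infinite_nonint finite_subset by blast
  hence "P * (A * B') = 0" using poly_roots_finite by blast
  hence "P = 0" using AB(1) AB'(2) by simp
  thus "cross_relation" using P(2) by (simp add: cross_relation_def)
qed

(* Suppose ga w is not an integer.  In the chain w + n, f is nonzero far to the left, and the cross
   relation propagates this to the right.  As al w is an integer, shift_factor vanishes somewhere
   on the chain, and from there on so does fd; but fd is nonzero far to the right. *)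
lemma cross_relation_integrality:
  assumes rel: "cross_relation" and al: "al w \<in> \<int>"
  shows "ga w \<in> \<int>"
proof (rule ccontr)
  assume nonint: "ga w \<notin> \<int>"
  obtain m where m: "al w = of_int m" using al by (auto elim: Ints_cases)
  define y where "y = (real_of_int m - a) / real p"
  have w: "w = of_real y"
    using m p_pos by (simp add: y_def al_def field_simps)
  have ga_shift: "ga (w + of_int k) \<notin> \<int>" for k
  proof
    assume "ga (w + of_int k) \<in> \<int>"
    moreover have "ga w = ga (w + of_int k) - of_nat r * of_int k" by (simp add: ga_def algebra_simps)
    ultimately have "ga w \<in> \<int>" by auto
    thus False using nonint by simp
  qed
  \<comment> \<open>Far to the left al is a nonpositive integer -M, so the series terminates, and r
    > p drives ga + M below 1. The mirror image of this argument serves fd in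
    \<open>right\<close>.\<close>
  have left: "f (w + of_int k) \<noteq> 0" if k: "k \<le> 0" "int p * k + m \<le> 0" "real r * y - m + k < 1" for k
  proof -
    define M where "M = nat (- (int p * k + m))"
    have M: "int M = - (int p * k + m)" using k by (simp add: M_def)
    have "al (w + of_int k) = of_int (int p * k + m)" using m by (simp add: al_def algebra_simps)
    also have "\<dots> = - of_nat M" using M by (metis minus_minus of_int_minus of_int_of_nat_eq)
    finally have a: "al (w + of_int k) = - of_nat M" .
    have g: "ga (w + of_int k) = of_real (real r * (y + k))" by (simp add: ga_def w)
    have "real M = - (real p * k + m)" using M by (metis of_int_minus of_int_add of_int_mult of_int_of_nat_eq)
    hence "real r * (y + k) + real M = (real r * y - m) + (real r - real p) * k" by (simp add: algebra_simps)
    also have "(real r - real p) * k \<le> 1 * real_of_int k"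
      using p_less_r k by (intro mult_right_mono_neg) auto
    finally have "real r * (y + k) + real M < 1" using k by simp
    thus ?thesis unfolding f_def a g using x_pos x_less_1 by (intro hyp2F1_terminating_nonzero) auto
  qed
  have right: "fd (w + of_int k) \<noteq> 0" if k: "k \<ge> 0" "int p * k + m \<ge> 1" "m - real r * y < k" for k
  proof -
    define M where "M = nat (int p * k + m - 1)"
    have M: "int M = int p * k + m - 1" using k by (simp add: M_def)
    have "1 - al (w + of_int k) = of_int (1 - (int p * k + m))" using m by (simp add: al_def algebra_simps)
    also have "\<dots> = of_int (- int M)" using M by simp
    also have "\<dots> = - of_nat M" by simp
    finally have a: "1 - al (w + of_int k) = - of_nat M" .
    have g: "2 - ga (w + of_int k) = of_real (2 - real r * (y + k))" by (simp add: ga_def w)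
    have "real M = real p * k + m - 1" using M by (metis of_int_1 of_int_diff of_int_add of_int_mult of_int_of_nat_eq)
    hence "2 - real r * (y + k) + real M = 1 + (m - real r * y) - (real r - real p) * k" by (simp add: algebra_simps)
    moreover have "1 * real_of_int k \<le> (real r - real p) * k"
      using p_less_r k by (intro mult_right_mono) auto
    ultimately have "2 - real r * (y + k) + real M < 1" using k by simp
    thus ?thesis unfolding fd_def a g using x_pos x_less_1 by (intro hyp2F1_terminating_nonzero) auto
  qed
  obtain N1 :: nat where N1: "\<bar>m\<bar> + \<bar>real r * y - m\<bar> < N1" using reals_Archimedean2 by blast
  have N1': "\<bar>m\<bar> \<le> int N1" using N1 by linarith
  have pN: "int N \<le> int p * int N" for N using p_pos by (simp add: mult_le_cancel_right1)
  define s where "s = w + of_int (- int N1)"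
  have rel': "poly rel_poly (s + of_nat n) * f (s + of_nat n) * fd (s + of_nat (Suc n)) =
      shift_factor (s + of_nat n) * f (s + of_nat (Suc n)) * fd (s + of_nat n)"
    and nz: "poly rel_poly (s + of_nat n) \<noteq> 0" "f (s + of_nat n) \<noteq> 0 \<or> fd (s + of_nat n) \<noteq> 0" for n
  proof -
    have "s + of_nat n = w + of_int (int n - int N1)" by (simp add: s_def)
    hence gs: "ga (s + of_nat n) \<notin> \<int>" using ga_shift by metis
    show "poly rel_poly (s + of_nat n) * f (s + of_nat n) * fd (s + of_nat (Suc n)) =
      shift_factor (s + of_nat n) * f (s + of_nat (Suc n)) * fd (s + of_nat n)"
    proof -
      have e: "s + of_nat (Suc n) = (s + of_nat n) + 1" by simp
      show ?thesis
        using rel[unfolded cross_relation_alt, rule_format, OF gs] unfolding e poly_shift_poly .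
    qed
    show "poly rel_poly (s + of_nat n) \<noteq> 0" "f (s + of_nat n) \<noteq> 0 \<or> fd (s + of_nat n) \<noteq> 0"
      using rel_poly_nonzero_at[OF gs] not_both_zero[OF gs] by auto
  qed
  have f_nz: "f (s + of_nat n) \<noteq> 0" for n
  proof (induction n)
    case 0
    show ?case unfolding s_def using N1 N1' pN[of N1] by (simp only: of_nat_0 add_0_right, intro left) auto
  next
    case (Suc n)
    \<comment> \<open>A zero of f at the new point would force fd to vanish there as well, by the
      cross relation at the old point.\<close>
    show ?case
      using rel'[of n] nz(1)[of n] nz(2)[of "Suc n"] Suc by auto
  qed
  define M where "M = nat (int p * int N1 - m)"
  \<comment> \<open>Division with remainder finds the chain point with al = -(M mod p). As M mod p <
    p, the product (al)_p contains the factor 0 there.\<close>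
  define n where "n = M div p"
  have M: "int M = int p * int N1 - m" using N1' pN[of N1] by (simp add: M_def)
  have "int p * int n - int p * int N1 + m = - int (M mod p)"
  proof -
    have "p * n + M mod p = M" by (simp add: n_def)
    hence "int p * int n + int (M mod p) = int M" by (metis of_nat_add of_nat_mult)
    thus ?thesis using M by simp
  qed
  hence "of_int (int p * int n - int p * int N1 + m) = (of_int (- int (M mod p)) :: complex)" by simp
  moreover have "al (s + of_nat n) = of_int (int p * int n - int p * int N1 + m)"
    using m by (simp add: s_def al_def algebra_simps)
  ultimately have "al (s + of_nat n) = - of_nat (M mod p)" by simp
  hence "pochhammer (al (s + of_nat n)) p = 0"
    using p_pos by (simp only: pochhammer_of_nat_eq_0_iff) simp
  hence "shift_factor (s + of_nat n) = 0" by (simp add: shift_factor_def)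
  hence fd0: "fd (s + of_nat (Suc n)) = 0"
    using rel'[of n] nz(1)[of n] f_nz[of n] by auto
  have fd_z: "fd (s + of_nat (Suc n + k)) = 0" for k
  proof (induction k)
    case (Suc k)
    thus ?case using rel'[of "Suc n + k"] nz(1)[of "Suc n + k"] f_nz[of "Suc n + k"] by auto
  qed (use fd0 in simp)
  define N2 where "N2 = N1 + n + 2"
  have "fd (w + of_int (int N2)) \<noteq> 0"
  proof (rule right)
    have N2: "int N2 = int N1 + int n + 2" by (simp add: N2_def)
    thus "0 \<le> int N2" "1 \<le> int p * int N2 + m" using N1' pN[of N2] by linarith+
    show "m - real r * y < real_of_int (int N2)" using N1 by (simp add: N2_def)
  qed
  moreover have "w + of_int (int N2) = s + of_nat (Suc n + (2 * N1 + 1))"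
    by (simp add: s_def N2_def)
  ultimately show False using fd_z by metis
qed

end

section \<open>Second-order asymptotics\<close>

lemma summable_square_power:
  fixes x :: real
  assumes "0 < x" "x < 1"
  shows "summable (\<lambda>k. real k ^ 2 * x ^ k)"
proof -
  obtain \<rho> where \<rho>: "x < \<rho>" "\<rho> < 1" using assms dense by blast
  have "((\<lambda>k. (real k + 1) ^ 2 / real k ^ 2) \<longlongrightarrow> 1) sequentially" by real_asymp
  hence "((\<lambda>k. (real k + 1) ^ 2 / real k ^ 2 * x) \<longlongrightarrow> 1 * x) sequentially"
    by (intro tendsto_mult tendsto_const)
  hence "eventually (\<lambda>k. (real k + 1) ^ 2 / real k ^ 2 * x < \<rho>) sequentially"
    using \<rho> by (intro order_tendstoD) auto
  then obtain N where N: "\<And>k. k \<ge> N \<Longrightarrow> (real k + 1) ^ 2 / real k ^ 2 * x < \<rho>"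
    by (auto simp: eventually_sequentially)
  have "norm (real (Suc k) ^ 2 * x ^ Suc k) \<le> \<rho> * norm (real k ^ 2 * x ^ k)" if "k \<ge> max N 1" for k
  proof -
    have "(real k + 1) ^ 2 * x \<le> \<rho> * real k ^ 2"
      using N[of k] that by (simp add: field_simps)
    hence "(real k + 1) ^ 2 * x * x ^ k \<le> \<rho> * real k ^ 2 * x ^ k"
      using assms by (intro mult_right_mono) auto
    thus ?thesis using assms by (simp add: abs_mult add_ac mult_ac)
  qed
  thus ?thesis by (intro summable_ratio_test[where c = \<rho> and N = "max N 1"]) (use \<rho> in auto)
qed

lemma eventually_poly_nonzero_at_infinity:
  fixes Q :: "complex poly"
  assumes "Q \<noteq> 0"
  shows "eventually (\<lambda>w. poly Q w \<noteq> 0) at_infinity"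
proof -
  have "finite {w. poly Q w = 0}" using assms by (rule poly_roots_finite)
  then obtain b where "\<And>w. poly Q w = 0 \<Longrightarrow> norm w \<le> b"
    using finite_imp_bounded[of "{w. poly Q w = 0}"] by (auto simp: bounded_iff)
  thus ?thesis unfolding eventually_at_infinity by (intro exI[of _ "b + 1"]) force
qed

text \<open>A rational function is determined at infinity by degrees: if the numerator of P/Q - e
  had degree at least that of Q, the values at the integers could not tend to 0. This transfers
  limits obtained from the series at integers to all directions.\<close>

lemma poly_quotient_limit_from_sequence:
  fixes P Q :: "complex poly"
  assumes Q: "Q \<noteq> 0" and lim: "(\<lambda>n. poly P (of_nat n) / poly Q (of_nat n)) \<longlonglongrightarrow> e"
  shows "((\<lambda>w. poly P w / poly Q w) \<longlongrightarrow> e) at_infinity"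
proof -
  define R where "R = P - smult e Q"
  have Qev: "eventually (\<lambda>w. poly Q w \<noteq> 0) at_infinity"
    by (rule eventually_poly_nonzero_at_infinity[OF Q])
  have nat: "filterlim (of_nat :: nat \<Rightarrow> complex) at_infinity sequentially" by (rule tendsto_of_nat)
  have Qn: "eventually (\<lambda>n. poly Q (of_nat n) \<noteq> 0) sequentially"
    by (rule eventually_compose_filterlim[OF Qev nat])
  have "((\<lambda>w. poly R w / poly Q w) \<longlongrightarrow> 0) at_infinity"
  proof (cases "R = 0 \<or> degree R < degree Q")
    case True
    thus ?thesis by (auto intro: poly_divide_tendsto_0_at_infinity)
  next
    case False
    hence R: "R \<noteq> 0" "degree Q \<le> degree R" by auto
    have "(\<lambda>n. poly P (of_nat n) / poly Q (of_nat n) - e) \<longlonglongrightarrow> e - e"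
      by (intro tendsto_diff lim tendsto_const)
    moreover have "eventually (\<lambda>n. poly P (of_nat n) / poly Q (of_nat n) - e = poly R (of_nat n) / poly Q (of_nat n)) sequentially"
      using Qn by eventually_elim (simp add: R_def diff_divide_distrib)
    ultimately have "(\<lambda>n. poly R (of_nat n) / poly Q (of_nat n)) \<longlonglongrightarrow> e - e"
      by (rule Lim_transform_eventually)
    hence "(\<lambda>n. poly R (of_nat n) / poly Q (of_nat n)) \<longlonglongrightarrow> 0" by simp
    moreover have "(\<lambda>n. poly Q (of_nat n) / of_nat n ^ degree Q) \<longlonglongrightarrow> lead_coeff Q"
      by (rule filterlim_compose[OF poly_divide_tendsto_aux nat])
    ultimately have "(\<lambda>n. norm (poly R (of_nat n) / poly Q (of_nat n) * (poly Q (of_nat n) / of_nat n ^ degree Q))) \<longlonglongrightarrow> norm (0 * lead_coeff Q)"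
      by (intro tendsto_norm tendsto_mult)
    hence "(\<lambda>n. norm (poly R (of_nat n) / poly Q (of_nat n) * (poly Q (of_nat n) / of_nat n ^ degree Q))) \<longlonglongrightarrow> 0"
      by simp
    hence "(\<lambda>n. poly R (of_nat n) / of_nat n ^ degree R) \<longlonglongrightarrow> 0"
    proof (rule Lim_null_comparison[rotated])
      show "eventually (\<lambda>n. norm (poly R (of_nat n) / of_nat n ^ degree R) \<le>
          norm (poly R (of_nat n) / poly Q (of_nat n) * (poly Q (of_nat n) / of_nat n ^ degree Q))) sequentially"
        using Qn eventually_gt_at_top[of 0]
      proof eventually_elim
        case (elim n)
        have "real n ^ degree Q \<le> real n ^ degree R" using elim R by (intro power_increasing) auto
        thus ?case using elim by (simp add: norm_divide norm_mult norm_power frac_le)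
      qed
    qed
    moreover have "(\<lambda>n. poly R (of_nat n) / of_nat n ^ degree R) \<longlonglongrightarrow> lead_coeff R"
      by (rule filterlim_compose[OF poly_divide_tendsto_aux nat])
    ultimately have "lead_coeff R = 0" using LIMSEQ_unique by blast
    thus ?thesis using R by simp
  qed
  hence "((\<lambda>w. e + poly R w / poly Q w) \<longlongrightarrow> e + 0) at_infinity"
    by (intro tendsto_add tendsto_const)
  moreover have "eventually (\<lambda>w. e + poly R w / poly Q w = poly P w / poly Q w) at_infinity"
    using Qev by eventually_elim (simp add: R_def diff_divide_distrib)
  ultimately show ?thesis
    using Lim_transform_eventually by fastforce
qed

(* The recursion is the product rule for the limits of n^2 * (q(n+1) - q(n)), where q is the k-th
   quotient pochhammer (al n) k / pochhammer (ga n) k. *)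
primrec quot_slope :: "real \<Rightarrow> real \<Rightarrow> real \<Rightarrow> nat \<Rightarrow> real" where
  "quot_slope t b c 0 = 0"
| "quot_slope t b c (Suc k) = quot_slope t b c k * t - t ^ k * (b + c * real k)"

text \<open>Only the sum of the two slopes has a definite sign: each step multiplies by t >= 0 and
  subtracts t^k ((b + b') + 2 c k) >= 0. It is applied to a family and its dual.\<close>

lemma quot_slope_sum_nonpos:
  assumes "0 \<le> t" "0 \<le> c" "0 \<le> b + b'"
  shows "quot_slope t b c k + quot_slope t b' c k \<le> 0"
proof (induction k)
  case (Suc k)
  have "(quot_slope t b c k + quot_slope t b' c k) * t \<le> 0"
    using Suc assms by (intro mult_nonpos_nonneg)
  moreover have "0 \<le> t ^ k * ((b + b') + 2 * c * real k)"
    using assms by (intro mult_nonneg_nonneg add_nonneg_nonneg[of "b + b'"]) auto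
  ultimately show ?case by (simp add: algebra_simps)
qed auto

section \<open>The limit of n^2 (f(n + 1) - f(n))\<close>

context gauss_family
begin

text \<open>The increment of (p n + a + k) / (r n + k), multiplied by n^2, tends to
  -(\<open>slope_a\<close> + \<open>slope_c\<close> k).\<close>

definition slope_a :: real where "slope_a = a / real r"
definition slope_c :: real where "slope_c = (real r - real p) / real r ^ 2"
definition second_limit :: real where
  "second_limit = (\<Sum>k. half_coeff x k * quot_slope (real p / real r) slope_a slope_c k)"

definition quot :: "nat \<Rightarrow> complex \<Rightarrow> complex" where
  "quot k w = pochhammer (al w) k / pochhammer (ga w) k"

definition step_quot :: "nat \<Rightarrow> complex \<Rightarrow> complex" where
  "step_quot k w = (al w + of_nat k) / (ga w + of_nat k)"

abbreviation slope :: "nat \<Rightarrow> real" where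
  "slope \<equiv> quot_slope (real p / real r) slope_a slope_c"

abbreviation quot_diff :: "nat \<Rightarrow> nat \<Rightarrow> complex" where
  "quot_diff k n \<equiv> of_nat n ^ 2 * (quot k (of_nat n + 1) - quot k (of_nat n))"

abbreviation step_diff :: "nat \<Rightarrow> nat \<Rightarrow> complex" where
  "step_diff k n \<equiv> of_nat n ^ 2 * (step_quot k (of_nat n + 1) - step_quot k (of_nat n))"

abbreviation f_diff :: "nat \<Rightarrow> complex" where
  "f_diff n \<equiv> of_nat n ^ 2 * (f (of_nat n + 1) - f (of_nat n))"

lemma quot_Suc: "quot (Suc k) w = quot k w * step_quot k w"
  by (simp add: quot_def step_quot_def pochhammer_Suc)

lemma step_quot_diff:
  assumes "n > 0"
  shows "step_quot k (of_nat n + 1) - step_quot k (of_nat n) =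
     - of_real ((real r * a + (real r - real p) * real k) / ((real r * real n + real k) * (real r * real n + real r + real k)))"
proof -
  have "real r * real n + real k > 0" "real r * real n + real r + real k > 0"
    using assms r_pos by (auto intro!: add_pos_nonneg)
  hence nz: "complex_of_real (real r * real n + real k) \<noteq> 0" "complex_of_real (real r * real n + real r + real k) \<noteq> 0"
    by (simp_all only: of_real_eq_0_iff)
  define P R N K A where "P = (of_nat p :: complex)" and "R = (of_nat r :: complex)" and "N = (of_nat n :: complex)"
    and "K = (of_nat k :: complex)" and "A = complex_of_real a"
  have 1: "step_quot k (of_nat n + 1) = (P * N + P + A + K) / (R * N + R + K)"
    "step_quot k (of_nat n) = (P * N + A + K) / (R * N + K)"
    unfolding step_quot_def al_def ga_def P_def R_def N_def K_def A_def by (simp_all add: algebra_simps)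
  have nz': "R * N + K \<noteq> 0" "R * N + R + K \<noteq> 0"
    using nz by (simp_all add: R_def N_def K_def)
  have "step_quot k (of_nat n + 1) - step_quot k (of_nat n) = - ((R * A + (R - P) * K) / ((R * N + K) * (R * N + R + K)))"
    unfolding 1 using nz' by (simp add: divide_simps) (simp add: algebra_simps)
  thus ?thesis by (simp add: P_def R_def N_def K_def A_def)
qed

lemma step_quot_le_1:
  assumes "\<bar>a\<bar> \<le> real n" "n > 0"
  shows "norm (step_quot k (of_nat n)) \<le> 1"
proof -
  have "step_quot k (of_nat n) = of_real ((real p * real n + a + real k) / (real r * real n + real k))"
    by (simp add: step_quot_def al_def ga_def)
  moreover have "\<bar>real p * real n + a + real k\<bar> \<le> real r * real n + real k"
  proof -
    have "real p + 1 \<le> real r" using p_less_r by linarith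
    hence "(real p + 1) * real n \<le> real r * real n" by (intro mult_right_mono) auto
    hence "real p * real n + real n \<le> real r * real n" by (simp add: distrib_right)
    moreover have "0 \<le> real p * real n" "0 \<le> real k" by auto
    ultimately show ?thesis using assms(1) unfolding abs_le_iff by linarith
  qed
  moreover have "real r * real n + real k > 0" using assms r_pos by (intro add_pos_nonneg) auto
  ultimately show ?thesis by (simp only: norm_of_real abs_divide) (simp add: divide_le_eq)
qed

lemma quot_le_1:
  assumes "\<bar>a\<bar> \<le> real n" "n > 0"
  shows "norm (quot k (of_nat n)) \<le> 1"
proof (induction k)
  case (Suc k)
  thus ?case unfolding quot_Suc norm_mult using step_quot_le_1[OF assms, of k]
    by (intro mult_le_one) auto
qed (simp add: quot_def)

lemma tendsto_of_nat_infinity: "filterlim (of_nat :: nat \<Rightarrow> complex) at_infinity sequentially"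
  by (rule tendsto_of_nat)

lemma tendsto_Suc_infinity: "filterlim (\<lambda>n. of_nat n + 1 :: complex) at_infinity sequentially"
  using filterlim_compose[OF tendsto_of_nat_infinity filterlim_Suc] by (simp add: add.commute)

lemma tendsto_quot: "(quot k \<longlongrightarrow> of_real ((real p / real r) ^ k)) at_infinity"
  using tendsto_pochhammer_quotient[of k] by (simp add: quot_def[abs_def])

lemma quot_diff_limit:
  "(\<lambda>n. quot_diff k n) \<longlonglongrightarrow>
     of_real (slope k)"
proof (induction k)
  case 0
  show ?case by (simp add: quot_def)
next
  case (Suc k)
  have s: "(\<lambda>n. step_quot k (of_nat n + 1)) \<longlonglongrightarrow> of_real (real p / real r)"
  proof -
    have "((\<lambda>w. quot (Suc k) w / quot k w) \<longlongrightarrow> of_real ((real p / real r) ^ Suc k) / of_real ((real p / real r) ^ k)) at_infinity"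
      using p_pos r_pos by (intro tendsto_divide tendsto_quot) auto
    hence 1: "((\<lambda>w. quot (Suc k) w / quot k w) \<longlongrightarrow> of_real (real p / real r)) at_infinity"
      using p_pos r_pos by simp
    have "eventually (\<lambda>w. quot k w \<noteq> 0) at_infinity"
      using tendsto_imp_eventually_ne[OF tendsto_quot[of k], of 0] p_pos r_pos by simp
    hence 2: "eventually (\<lambda>w. quot (Suc k) w / quot k w = step_quot k w) at_infinity"
      by eventually_elim (simp add: quot_Suc)
    show ?thesis
      by (rule filterlim_compose[OF Lim_transform_eventually[OF 1 2] tendsto_Suc_infinity])
  qed
  have q: "(\<lambda>n. quot k (of_nat n)) \<longlonglongrightarrow> of_real ((real p / real r) ^ k)"
    by (rule filterlim_compose[OF tendsto_quot tendsto_of_nat_infinity])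
  have d: "(\<lambda>n. step_diff k n) \<longlonglongrightarrow> - of_real (slope_a + slope_c * real k)"
  proof -
    define R K C where "R = real r" and "K = real k" and "C = real r * a + (real r - real p) * real k"
    have R: "R > 0" using r_pos by (simp add: R_def)
    have "(\<lambda>n. real n ^ 2 * (C / ((R * real n + K) * (R * real n + R + K)))) \<longlonglongrightarrow> C * (inverse R * inverse R)"
      using R by (real_asymp simp: power2_eq_square)
    also have "C * (inverse R * inverse R) = slope_a + slope_c * real k"
      using R by (simp add: C_def R_def slope_a_def slope_c_def power2_eq_square field_simps)
    finally have "(\<lambda>n. - complex_of_real (real n ^ 2 * (C / ((R * real n + K) * (R * real n + R + K))))) \<longlonglongrightarrow> - of_real (slope_a + slope_c * real k)"
      by (intro tendsto_minus tendsto_of_real)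
    moreover have "eventually (\<lambda>n. - complex_of_real (real n ^ 2 * (C / ((R * real n + K) * (R * real n + R + K)))) =
        step_diff k n) sequentially"
      using eventually_gt_at_top[of 0]
      by eventually_elim (subst step_quot_diff, simp_all add: R_def K_def C_def)
    ultimately show ?thesis by (rule Lim_transform_eventually)
  qed
  have "(\<lambda>n. quot_diff k n * step_quot k (of_nat n + 1)
      + quot k (of_nat n) * (step_diff k n)) \<longlonglongrightarrow>
      of_real (slope k) * of_real (real p / real r)
      + of_real ((real p / real r) ^ k) * (- of_real (slope_a + slope_c * real k))"
    by (intro tendsto_add tendsto_mult Suc s q d)
  also have "(\<lambda>n. quot_diff k n * step_quot k (of_nat n + 1)
      + quot k (of_nat n) * (step_diff k n)) =
      (\<lambda>n. quot_diff (Suc k) n)"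
    by (simp add: quot_Suc algebra_simps)
  also have "of_real (slope k) * of_real (real p / real r)
      + of_real ((real p / real r) ^ k) * (- of_real (slope_a + slope_c * real k)) =
      (of_real (slope (Suc k)) :: complex)"
    by (simp only: quot_slope.simps of_real_diff of_real_mult mult_minus_right add_uminus_conv_diff)
  finally show ?case .
qed

text \<open>Once n >= |a|, all quotients have norm at most 1, so the product rule contributes one
  bounded increment for each factor. The resulting quadratic growth in k is harmless against
  x^k.\<close>

lemma quot_diff_bound:
  assumes n: "\<bar>a\<bar> \<le> real n" "n > 0"
  shows "norm (quot_diff k n) \<le> real k * (real r * \<bar>a\<bar> + real r * real k)"
proof (induction k)
  case 0
  show ?case by (simp add: quot_def)
next
  case (Suc k)
  have n1: "\<bar>a\<bar> \<le> real (Suc n)" "Suc n > 0" using n by auto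
  have s: "norm (step_quot k (of_nat n + 1)) \<le> 1"
    using step_quot_le_1[OF n1, of k] by (simp add: add.commute)
  have d: "norm (step_diff k n) \<le> real r * \<bar>a\<bar> + real r * real k"
  proof -
    define C where "C = real r * a + (real r - real p) * real k"
    define E where "E = (real r * real n + real k) * (real r * real n + real r + real k)"
    have "real n * 1 \<le> real n * real r" using r_pos by (intro mult_left_mono) auto
    hence "real n * real n \<le> E" unfolding E_def by (intro mult_mono) (auto simp: mult.commute intro: add_increasing2)
    moreover have "0 < real n * real n" using n by simp
    ultimately have E: "real n ^ 2 / E \<le> 1" "0 \<le> real n ^ 2 / E" by (auto simp: power2_eq_square divide_le_eq)
    have "norm (step_diff k n) = norm (of_real (real n ^ 2 / E * C) :: complex)"
      unfolding step_quot_diff[OF n(2)] E_def C_def by (simp add: norm_mult norm_divide)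
    also have "\<dots> = (real n ^ 2 / E) * \<bar>C\<bar>"
      unfolding norm_of_real abs_mult using E by (simp only: abs_of_nonneg)
    also have "\<dots> \<le> 1 * \<bar>C\<bar>" using E by (intro mult_right_mono) auto
    also have "\<bar>C\<bar> \<le> real r * \<bar>a\<bar> + (real r - real p) * real k"
      unfolding C_def using p_less_r by (intro order.trans[OF abs_triangle_ineq]) (simp add: abs_mult)
    also have "(real r - real p) * real k \<le> real r * real k" by (intro mult_right_mono) auto
    finally show ?thesis by simp
  qed
  have "norm (quot_diff (Suc k) n) =
     norm (quot_diff k n * step_quot k (of_nat n + 1)
      + quot k (of_nat n) * (step_diff k n))"
    by (simp add: quot_Suc algebra_simps)
  also have "\<dots> \<le> norm (quot_diff k n) * norm (step_quot k (of_nat n + 1))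
      + norm (quot k (of_nat n)) * norm (step_diff k n)"
    unfolding norm_mult[symmetric] by (rule norm_triangle_ineq)
  also have "\<dots> \<le> (real k * (real r * \<bar>a\<bar> + real r * real k)) * 1 + 1 * (real r * \<bar>a\<bar> + real r * real k)"
    by (intro add_mono mult_mono Suc s d quot_le_1 n) auto
  also have "\<dots> \<le> real (Suc k) * (real r * \<bar>a\<bar> + real r * real (Suc k))"
    by (simp add: algebra_simps)
  finally show ?case .
qed

lemma second_difference_limit:
  "summable (\<lambda>k. half_coeff x k * slope k)"
  "(\<lambda>n. f_diff n) \<longlonglongrightarrow> of_real second_limit"
proof -
  let ?t = "\<lambda>k n. of_real (half_coeff x k) * (quot_diff k n)"
  define M where "M = (\<lambda>k. (real r * \<bar>a\<bar> + real r) * (real k ^ 2 * x ^ k))"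
  have bound: "norm (?t k n) \<le> M k" if n: "\<bar>a\<bar> \<le> real n" "n > 0" for k n
  proof -
    have "norm (?t k n) \<le> x ^ k * (real k * (real r * \<bar>a\<bar> + real r * real k))"
      unfolding norm_mult[of "of_real _"] using half_coeff_bounds[OF x_pos, of k] quot_diff_bound[OF n, of k] x_pos
      by (intro mult_mono) auto
    also have "real k * (real r * \<bar>a\<bar> + real r * real k) \<le> (real r * \<bar>a\<bar> + real r) * real k ^ 2"
    proof -
      have "real k \<le> real k ^ 2" by (cases k) (auto simp: power2_eq_square)
      hence "real r * \<bar>a\<bar> * real k \<le> real r * \<bar>a\<bar> * real k ^ 2" by (intro mult_left_mono) auto
      thus ?thesis by (simp add: algebra_simps power2_eq_square)
    qed
    finally show ?thesis using x_pos by (simp add: M_def mult_ac)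
  qed
  obtain N :: nat where N: "\<bar>a\<bar> < real N" using reals_Archimedean2 by blast
  have "eventually (\<lambda>(k, n). norm (?t k n) \<le> M k) (at_top \<times>\<^sub>F sequentially)"
    unfolding eventually_prod_filter prod.case
  proof (intro exI conjI allI impI)
    show "eventually (\<lambda>k::nat. True) at_top" by simp
    show "eventually (\<lambda>n. n \<ge> N + 1) sequentially" by (rule eventually_ge_at_top)
    show "norm (?t k n) \<le> M k" if "n \<ge> N + 1" for k n
      using N that by (intro bound) auto
  qed
  moreover have "summable M"
    unfolding M_def using x_pos x_less_1 by (intro summable_mult summable_square_power)
  moreover have "(\<lambda>n. ?t k n) \<longlonglongrightarrow> of_real (half_coeff x k) * of_real (slope k)" for k
    by (intro tendsto_mult tendsto_const quot_diff_limit)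
  ultimately have T: "summable (\<lambda>k. norm (of_real (half_coeff x k) * of_real (slope k) :: complex))"
    "(\<lambda>n. \<Sum>k. ?t k n) \<longlonglongrightarrow> (\<Sum>k. of_real (half_coeff x k) * of_real (slope k))"
    using tannerys_theorem[of ?t "\<lambda>k. of_real (half_coeff x k) * of_real (slope k)" sequentially M] by auto
  have "summable (\<lambda>k. norm (half_coeff x k * slope k))"
    using T(1) unfolding of_real_mult[symmetric] norm_of_real by simp
  thus s: "summable (\<lambda>k. half_coeff x k * slope k)" by (rule summable_norm_cancel)
  have "(\<Sum>k. ?t k n) = f_diff n" for n
  proof -
    have "(\<lambda>k. of_nat n ^ 2 * (of_real (half_coeff x k) * quot k (of_nat n + 1) - of_real (half_coeff x k) * quot k (of_nat n)))
       sums (f_diff n)"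
      unfolding quot_def by (intro sums_mult sums_diff f_sums)
    thus ?thesis by (simp add: sums_iff algebra_simps)
  qed
  thus "(\<lambda>n. f_diff n) \<longlonglongrightarrow> of_real second_limit"
    using T(2) unfolding second_limit_def suminf_of_real[OF s] by simp
qed

lemma f_nat_limit: "(\<lambda>n. f (of_nat n)) \<longlonglongrightarrow> of_real limit_f"
proof -
  have "filterlim (of_nat :: nat \<Rightarrow> complex) (right_infinity 0) sequentially"
    using tendsto_of_nat_infinity by (simp add: filterlim_inf filterlim_principal)
  from filterlim_compose[OF f_tendsto this] show ?thesis by simp
qed

text \<open>At large integers both limits come from the series; as B/A is rational, they persist at
  infinity in every direction. In particular f(w + 1) / f(w) has no term of order 1/w.\<close>

lemma recurrence_asymptotics:
  assumes A: "A \<noteq> 0" and AB: "\<And>w. ga w \<notin> \<int>\<^sub>\<le>\<^sub>0 \<Longrightarrow> poly A w * f (w + 1) = poly B w * f w"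
  shows "((\<lambda>w. poly B w / poly A w) \<longlongrightarrow> 1) at_infinity"
    "((\<lambda>w. w ^ 2 * (poly B w / poly A w - 1)) \<longlongrightarrow> of_real (second_limit / limit_f)) at_infinity"
proof -
  have nz: "eventually (\<lambda>n. f (of_nat n) \<noteq> 0) sequentially"
    using tendsto_imp_eventually_ne[OF f_nat_limit, of 0] limit_f_pos by simp
  have Anz: "eventually (\<lambda>n. poly A (of_nat n) \<noteq> 0) sequentially"
    by (rule eventually_compose_filterlim[OF eventually_poly_nonzero_at_infinity[OF A] tendsto_of_nat_infinity])
  have ratio: "eventually (\<lambda>n. f (of_nat n + 1) / f (of_nat n) = poly B (of_nat n) / poly A (of_nat n)) sequentially"
    using nz Anz eventually_gt_at_top[of 0]
  proof eventually_elim
    case (elim n)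
    have "ga (of_nat n) \<notin> \<int>\<^sub>\<le>\<^sub>0"
    proof
      assume "ga (of_nat n) \<in> \<int>\<^sub>\<le>\<^sub>0"
      then obtain m where "of_nat (r * n) = - (of_nat m :: complex)" unfolding ga_def by (auto elim!: nonpos_Ints_cases')
      hence "of_nat (r * n + m) = (0 :: complex)" by (simp add: add_eq_0_iff2)
      thus False using elim(3) r_pos by (simp only: of_nat_eq_0_iff) simp
    qed
    from AB[OF this] show ?case using elim by (simp add: field_simps)
  qed
  have "(\<lambda>n. f (of_nat (Suc n)) / f (of_nat n)) \<longlonglongrightarrow> of_real limit_f / of_real limit_f"
    using limit_f_pos by (intro tendsto_divide f_nat_limit LIMSEQ_Suc[OF f_nat_limit]) auto
  hence "(\<lambda>n. f (of_nat n + 1) / f (of_nat n)) \<longlonglongrightarrow> 1"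
    using limit_f_pos by (simp add: add.commute)
  hence "(\<lambda>n. poly B (of_nat n) / poly A (of_nat n)) \<longlonglongrightarrow> 1"
    by (rule Lim_transform_eventually[OF _ ratio])
  thus "((\<lambda>w. poly B w / poly A w) \<longlongrightarrow> 1) at_infinity"
    by (rule poly_quotient_limit_from_sequence[OF A])
  have "(\<lambda>n. (f_diff n) / f (of_nat n)) \<longlonglongrightarrow> of_real second_limit / of_real limit_f"
    using limit_f_pos by (intro tendsto_divide f_nat_limit second_difference_limit) auto
  moreover have "eventually (\<lambda>n. (f_diff n) / f (of_nat n) =
      poly (monom 1 2 * (B - A)) (of_nat n) / poly A (of_nat n)) sequentially"
    using ratio nz Anz
  proof eventually_elim
    case (elim n)
    have "(f_diff n) / f (of_nat n) = of_nat n ^ 2 * (f (of_nat n + 1) / f (of_nat n) - 1)"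
      using elim(2) by (simp add: field_simps)
    also have "\<dots> = poly (monom 1 2 * (B - A)) (of_nat n) / poly A (of_nat n)"
      unfolding elim(1) using elim(3) by (simp add: poly_monom field_simps)
    finally show ?case .
  qed
  ultimately have "(\<lambda>n. poly (monom 1 2 * (B - A)) (of_nat n) / poly A (of_nat n)) \<longlonglongrightarrow> of_real second_limit / of_real limit_f"
    by (rule Lim_transform_eventually)
  hence "((\<lambda>w. poly (monom 1 2 * (B - A)) w / poly A w) \<longlongrightarrow> of_real second_limit / of_real limit_f) at_infinity"
    by (rule poly_quotient_limit_from_sequence[OF A])
  moreover have "eventually (\<lambda>w. poly (monom 1 2 * (B - A)) w / poly A w = w ^ 2 * (poly B w / poly A w - 1)) at_infinity"
    using eventually_poly_nonzero_at_infinity[OF A] by eventually_elim (simp add: poly_monom field_simps)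
  ultimately show "((\<lambda>w. w ^ 2 * (poly B w / poly A w - 1)) \<longlongrightarrow> of_real (second_limit / limit_f)) at_infinity"
    unfolding of_real_divide by (rule Lim_transform_eventually)
qed

end

section \<open>Products of linear factors to second order\<close>

abbreviation sum_squares :: "'a::field list \<Rightarrow> 'a" where
  "sum_squares zs \<equiv> \<Sum>z\<leftarrow>zs. z ^ 2"

text \<open>The limit is the second elementary symmetric polynomial, written through power sums so
  that it can be compared after equal sums cancel.\<close>

lemma prod_list_expansion:
  fixes zs :: "complex list"
  defines "P \<equiv> \<lambda>w. \<Prod>z\<leftarrow>zs. 1 + z / w"
  shows "((\<lambda>w. w ^ 2 * (P w - 1 - sum_list zs / w)) \<longlongrightarrow> (sum_list zs ^ 2 - (sum_squares zs)) / 2) at_infinity"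
    and "(P \<longlongrightarrow> 1) at_infinity"
  unfolding P_def
proof (induction zs)
  case (Cons z zs)
  let ?P = "\<lambda>w. \<Prod>z\<leftarrow>zs. 1 + z / w"
  let ?s = "sum_list zs"
  have inv: "((\<lambda>w. c / w) \<longlongrightarrow> 0) at_infinity" for c :: complex
    by (rule tendsto_divide_0[OF tendsto_const filterlim_ident])
  have nz: "eventually (\<lambda>w. w \<noteq> (0::complex)) at_infinity"
    by (rule filterlim_at_infinity_imp_eventually_ne[OF filterlim_ident])
  have "((\<lambda>w. 1 / w * (w ^ 2 * (?P w - 1 - ?s / w)) + ?s) \<longlongrightarrow> 0 * ((?s ^ 2 - (sum_squares zs)) / 2) + ?s) at_infinity"
    by (intro tendsto_add tendsto_mult inv Cons tendsto_const)
  moreover have "eventually (\<lambda>w. 1 / w * (w ^ 2 * (?P w - 1 - ?s / w)) + ?s = w * (?P w - 1)) at_infinity"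
    using nz by eventually_elim (simp add: power2_eq_square field_simps)
  ultimately have 1: "((\<lambda>w. w * (?P w - 1)) \<longlongrightarrow> ?s) at_infinity"
    using Lim_transform_eventually by fastforce
  have "((\<lambda>w. w ^ 2 * (?P w - 1 - ?s / w) + z * (w * (?P w - 1))) \<longlongrightarrow> (?s ^ 2 - (sum_squares zs)) / 2 + z * ?s) at_infinity"
    by (intro tendsto_add tendsto_mult 1 Cons tendsto_const)
  moreover have "eventually (\<lambda>w. w ^ 2 * (?P w - 1 - ?s / w) + z * (w * (?P w - 1)) =
      w ^ 2 * ((1 + z / w) * ?P w - 1 - (z + ?s) / w)) at_infinity"
    using nz by eventually_elim (simp add: power2_eq_square field_simps)
  ultimately have "((\<lambda>w. w ^ 2 * ((1 + z / w) * ?P w - 1 - (z + ?s) / w)) \<longlongrightarrow> (?s ^ 2 - (sum_squares zs)) / 2 + z * ?s) at_infinity"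
    by (rule Lim_transform_eventually)
  also have "(?s ^ 2 - (sum_squares zs)) / 2 + z * ?s = ((z + ?s) ^ 2 - (z ^ 2 + (sum_squares zs))) / 2"
    by (simp add: power2_eq_square field_simps)
  finally show "((\<lambda>w. w ^ 2 * ((\<Prod>z\<leftarrow>z # zs. 1 + z / w) - 1 - sum_list (z # zs) / w)) \<longlongrightarrow>
      (sum_list (z # zs) ^ 2 - (sum_squares (z # zs))) / 2) at_infinity" by simp
  have "((\<lambda>w. (1 + z / w) * ?P w) \<longlongrightarrow> (1 + 0) * 1) at_infinity"
    by (intro tendsto_add tendsto_mult inv Cons tendsto_const)
  thus "((\<lambda>w. \<Prod>z\<leftarrow>z # zs. 1 + z / w) \<longlongrightarrow> 1) at_infinity" by simp
qed auto

lemma prod_list_quotient_expansion: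
  fixes zs ys :: "complex list"
  assumes "sum_list zs = sum_list ys"
  shows "((\<lambda>w. w ^ 2 * ((\<Prod>z\<leftarrow>zs. 1 + z / w) / (\<Prod>z\<leftarrow>ys. 1 + z / w) - 1)) \<longlongrightarrow>
     ((sum_squares ys) - (sum_squares zs)) / 2) at_infinity"
proof -
  let ?P = "\<lambda>zs w. \<Prod>z\<leftarrow>zs. 1 + z / (w :: complex)"
  let ?E = "\<lambda>zs. (sum_list zs ^ 2 - (sum_squares zs)) / 2"
  have "((\<lambda>w. (w ^ 2 * (?P zs w - 1 - sum_list zs / w) - w ^ 2 * (?P ys w - 1 - sum_list ys / w)) / ?P ys w)
      \<longlongrightarrow> (?E zs - ?E ys) / 1) at_infinity"
    by (intro tendsto_divide tendsto_diff prod_list_expansion) auto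
  moreover have "eventually (\<lambda>w. ?P ys w \<noteq> 0) at_infinity"
    using tendsto_imp_eventually_ne[OF prod_list_expansion(2)[of ys], of 0] by simp
  hence "eventually (\<lambda>w. (w ^ 2 * (?P zs w - 1 - sum_list zs / w) - w ^ 2 * (?P ys w - 1 - sum_list ys / w)) / ?P ys w
      = w ^ 2 * (?P zs w / ?P ys w - 1)) at_infinity"
    unfolding assms by eventually_elim (simp add: right_diff_distrib diff_divide_distrib)
  ultimately have "((\<lambda>w. w ^ 2 * (?P zs w / ?P ys w - 1)) \<longlongrightarrow> (?E zs - ?E ys) / 1) at_infinity"
    by (rule Lim_transform_eventually)
  also have "(?E zs - ?E ys) / 1 = ((sum_squares ys) - (sum_squares zs)) / 2"
    unfolding assms by (simp add: diff_divide_distrib)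
  finally show ?thesis .
qed

lemma pochhammer_as_prod_list:
  fixes m w b :: complex
  assumes "m \<noteq> 0" "w \<noteq> 0"
  shows "pochhammer (m * w + b) n = (m * w) ^ n * (\<Prod>z\<leftarrow>map (\<lambda>i. (b + of_nat i) / m) [0..<n]. 1 + z / w)"
proof (induction n)
  case (Suc n)
  have "m * w + b + of_nat n = (m * w) * (1 + (b + of_nat n) / m / w)"
    using assms by (simp add: field_simps)
  thus ?case unfolding pochhammer_Suc Suc by simp
qed auto

text \<open>S/G is the reciprocal of (B/A)(B'/A'). As both ratios are 1 up to order w^(-2), their
  second-order coefficients add, and inversion changes the sign.\<close>

lemma reciprocal_ratio_limits:
  fixes G S A B A' B' :: "complex poly"
  assumes eq: "G * A * A' = S * B * B'"
    and nz: "G \<noteq> 0" "A \<noteq> 0" "B \<noteq> 0" "A' \<noteq> 0" "B' \<noteq> 0"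
    and R: "((\<lambda>w. poly B w / poly A w) \<longlongrightarrow> 1) at_infinity" "((\<lambda>w. poly B' w / poly A' w) \<longlongrightarrow> 1) at_infinity"
    and e: "((\<lambda>w. w ^ 2 * (poly B w / poly A w - 1)) \<longlongrightarrow> e) at_infinity"
      "((\<lambda>w. w ^ 2 * (poly B' w / poly A' w - 1)) \<longlongrightarrow> e') at_infinity"
  shows "((\<lambda>w. poly S w / poly G w) \<longlongrightarrow> 1) at_infinity"
    "((\<lambda>w. w ^ 2 * (poly S w / poly G w - 1)) \<longlongrightarrow> - (e + e')) at_infinity"
proof -
  define X Y where "X = (\<lambda>w. poly B w / poly A w)" and "Y = (\<lambda>w. poly B' w / poly A' w)"
  have ev: "eventually (\<lambda>w. 1 / (X w * Y w) = poly S w / poly G w \<and> X w * Y w \<noteq> 0) at_infinity"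
    using nz[THEN eventually_poly_nonzero_at_infinity]
  proof eventually_elim
    case (elim w)
    have "poly G w * poly A w * poly A' w = poly S w * poly B w * poly B' w"
      using arg_cong[OF eq, of "\<lambda>p. poly p w"] by simp
    thus ?case using elim by (simp add: X_def Y_def divide_simps mult_ac)
  qed
  have "((\<lambda>w. 1 / (X w * Y w)) \<longlongrightarrow> 1 / (1 * 1)) at_infinity"
    unfolding X_def Y_def by (intro tendsto_divide tendsto_mult R tendsto_const) auto
  thus "((\<lambda>w. poly S w / poly G w) \<longlongrightarrow> 1) at_infinity"
    using Lim_transform_eventually[OF _ eventually_mono[OF ev]] by fastforce
  have "((\<lambda>w. - (w ^ 2 * (X w - 1) + X w * (w ^ 2 * (Y w - 1))) / (X w * Y w)) \<longlongrightarrow> - (e + 1 * e') / (1 * 1)) at_infinity"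
    unfolding X_def Y_def by (intro tendsto_divide tendsto_minus tendsto_add tendsto_mult R e) auto
  moreover have "eventually (\<lambda>w. - (w ^ 2 * (X w - 1) + X w * (w ^ 2 * (Y w - 1))) / (X w * Y w) =
     w ^ 2 * (poly S w / poly G w - 1)) at_infinity"
    using ev
  proof eventually_elim
    case (elim w)
    have e1: "poly S w / poly G w = 1 / (X w * Y w)" using elim by simp
    show ?case unfolding e1 using conjunct2[OF elim] by (simp add: field_simps)
  qed
  ultimately show "((\<lambda>w. w ^ 2 * (poly S w / poly G w - 1)) \<longlongrightarrow> - (e + e')) at_infinity"
    using Lim_transform_eventually by fastforce
qed

lemma sum_list_map_upt: "sum_list (map g [0..<n]) = (\<Sum>i<n. g i)"
  by (simp add: interv_sum_list_conv_sum_set_nat atLeast0LessThan)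

lemma sum_nat_real: "(\<Sum>i<n. real i) = real n * (real n - 1) / 2"
  by (induction n) (auto simp: field_simps)

context gauss_family
begin

text \<open>The negatives of the zeros of \<open>shift_poly\<close>, with multiplicity;
  \<open>den_shifts\<close> plays the same role for \<open>rel_poly\<close>. Both polynomials have
  degree 2r, so their quotient is a constant times a quotient of products of factors 1 +
  z/w.\<close>

definition num_shifts :: "real list" where
  "num_shifts = map (\<lambda>i. (- 1/2 + real i) / real r) [0..<r] @ map (\<lambda>i. (a + real i) / real p) [0..<p]
     @ map (\<lambda>i. (- a + real i) / real (r - p)) [0..<r - p]"

definition den_shifts :: "real list" where
  "den_shifts = map (\<lambda>i. (- 1 + real i) / real r) [0..<r] @ map (\<lambda>i. real i / real r) [0..<r]"

text \<open>A progression (b + i)/n with n terms sums to b + (n - 1)/2; the contributions of a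
  cancel and both totals are r - 2. Hence the quotient has no term of order 1/w.\<close>

lemma sum_shifts_eq: "sum_list num_shifts = sum_list den_shifts"
proof -
  have lin: "(\<Sum>i<n. (b + real i) / real n) = b + (real n - 1) / 2" if "n > 0" for n b
  proof -
    have "(\<Sum>i<n. (b + real i) / real n) = (real n * b + real n * (real n - 1) / 2) / real n"
      by (simp add: sum.distrib sum_nat_real flip: sum_divide_distrib)
    also have "\<dots> = b + (real n - 1) / 2" using that by (simp add: field_simps)
    finally show ?thesis .
  qed
  have "r - p > 0" "r > 0" using p_less_r by auto
  thus ?thesis
    using lin[of r "-1/2"] lin[of p a] lin[of "r - p" "-a"] lin[of r "-1"] lin[of r 0] p_pos p_less_r
    unfolding num_shifts_def den_shifts_def sum_list_append sum_list_map_upt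
    by (simp add: of_nat_diff field_simps)
qed

text \<open>The quotient of the leading coefficients of \<open>shift_poly\<close> and
  \<open>rel_poly\<close>.\<close>

definition shift_limit :: complex where
  "shift_limit = of_real (real p ^ p * real (r - p) ^ (r - p) / real r ^ r) / cross_factor"

lemma shift_rel_quotient:
  "eventually (\<lambda>w. poly shift_poly w / poly rel_poly w =
     shift_limit *
     ((\<Prod>z\<leftarrow>map of_real num_shifts. 1 + z / w) / (\<Prod>z\<leftarrow>map of_real den_shifts. 1 + z / w))) at_infinity"
proof -
  have nz: "eventually (\<lambda>w. w \<noteq> (0::complex)) at_infinity"
    by (rule filterlim_at_infinity_imp_eventually_ne[OF filterlim_ident])
  thus ?thesis
  proof eventually_elim
    case (elim w)
    let ?Q = "\<lambda>zs. \<Prod>z\<leftarrow>zs. 1 + z / w"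
    define L where "L = (\<lambda>m b n. map (\<lambda>i. (b + of_nat i) / m) [0..<n] :: complex list)"
    have pr: "of_nat (r - p) \<noteq> (0::complex)" "of_nat r \<noteq> (0::complex)" "of_nat p \<noteq> (0::complex)"
      using p_less_r p_pos r_pos by simp_all
    have ys: "map complex_of_real den_shifts = L (of_nat r) (-1) r @ L (of_nat r) 0 r"
      by (simp add: den_shifts_def L_def)
    have zs: "map complex_of_real num_shifts = L (of_nat r) (-1/2) r @ L (of_nat p) (of_real a) p @ L (of_nat (r - p)) (- of_real a) (r - p)"
      by (simp add: num_shifts_def L_def)
    have poch: "pochhammer (poly [:b, of_nat m:] w) n = (of_nat m * w) ^ n * ?Q (L (of_nat m) b n)" if "of_nat m \<noteq> (0::complex)" for m b n
      using pochhammer_as_prod_list[OF that elim, of b n] by (simp add: L_def mult.commute add.commute)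
    have S: "poly shift_poly w = (of_nat r * w) ^ r * (of_nat p * w) ^ p * (of_nat (r - p) * w) ^ (r - p) * ?Q (map of_real num_shifts)"
      unfolding shift_poly_def poly_mult poly_pochhammer poch[OF pr(1)] poch[OF pr(2)] poch[OF pr(3)] zs
      by (simp add: mult_ac)
    have G: "poly rel_poly w = cross_factor * (of_nat r * w) ^ r * (of_nat r * w) ^ r * ?Q (map of_real den_shifts)"
      unfolding rel_poly_def poly_smult poly_mult poly_pochhammer poch[OF pr(2)] ys
      by (simp add: mult_ac)
    have "w ^ r = w ^ p * w ^ (r - p)" using p_less_r by (simp flip: power_add)
    hence "(of_nat p * w) ^ p * (of_nat (r - p) * w) ^ (r - p) = of_nat p ^ p * of_nat (r - p) ^ (r - p) * w ^ r"
      by (simp add: power_mult_distrib)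
    hence "poly shift_poly w = (of_nat r * w) ^ r * (of_nat p ^ p * of_nat (r - p) ^ (r - p) * w ^ r) * ?Q (map of_real num_shifts)"
      unfolding S by (simp add: mult.assoc)
    thus ?case unfolding G shift_limit_def using elim pr cross_factor_nonzero
      by (simp add: power_mult_distrib mult_ac)
  qed
qed

lemma tendsto_shift_limit: "((\<lambda>w. poly shift_poly w / poly rel_poly w) \<longlongrightarrow> shift_limit) at_infinity"
proof -
  have "((\<lambda>w. shift_limit * ((\<Prod>z\<leftarrow>map of_real num_shifts. 1 + z / w) / (\<Prod>z\<leftarrow>map of_real den_shifts. 1 + z / w)))
      \<longlongrightarrow> shift_limit * (1 / 1)) at_infinity"
    by (rule tendsto_mult[OF tendsto_const tendsto_divide[OF prod_list_expansion(2) prod_list_expansion(2)]]) simp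
  thus ?thesis using tendsto_cong[OF shift_rel_quotient] by simp
qed

lemma necessary_asymptotics:
  assumes nz: "A \<noteq> 0" "B \<noteq> 0" "A' \<noteq> 0" "B' \<noteq> 0"
    and AB: "\<And>w. ga w \<notin> \<int>\<^sub>\<le>\<^sub>0 \<Longrightarrow> poly A w * f (w + 1) = poly B w * f w"
    and AB': "\<And>w. ga w \<notin> \<int>\<^sub>\<le>\<^sub>0 \<Longrightarrow> poly A' w * dual_f (w + 1) = poly B' w * dual_f w"
    and eq: "rel_poly * A * (A' \<circ>\<^sub>p reflection) = shift_poly * B * (B' \<circ>\<^sub>p reflection)"
  shows "(-1) ^ (r - p) * (1 - x) ^ (r - p) / x ^ r = real p ^ p * real (r - p) ^ (r - p) / real r ^ r"
    and "2 * p \<le> r \<Longrightarrow> (sum_squares num_shifts) \<le> (sum_squares den_shifts)"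
proof -
  interpret D: gauss_family p r dual_a x by (rule gauss_family_axioms)
  define q where "q = reflection"
  have q: "poly q w = 2 / of_nat r - 1 - w" for w by (simp add: q_def poly_reflection)
  note D1 = D.recurrence_asymptotics(1)[OF nz(3) AB'] and D2 = D.recurrence_asymptotics(2)[OF nz(3) AB']
  have qinf: "filterlim (poly q) at_infinity at_infinity"
    by (rule filterlim_poly_at_infinity) (simp add: q_def reflection_def)
  have R': "((\<lambda>w. poly (B' \<circ>\<^sub>p q) w / poly (A' \<circ>\<^sub>p q) w) \<longlongrightarrow> 1) at_infinity"
    using filterlim_compose[OF D1 qinf] by (simp add: poly_pcompose)
  \<comment> \<open>To leading order the reflection is w -> -w. The second-order coefficient sees
    only its square, so fd contributes the constant of the dual family unchanged.\<close>
  have "((\<lambda>w. (w / poly q w) ^ 2 * (poly q w ^ 2 * (poly (B' \<circ>\<^sub>p q) w / poly (A' \<circ>\<^sub>p q) w - 1))) \<longlongrightarrow> (- 1) ^ 2 * of_real (D.second_limit / D.limit_f)) at_infinity"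
  proof (intro tendsto_mult tendsto_power)
    show "((\<lambda>w. poly q w ^ 2 * (poly (B' \<circ>\<^sub>p q) w / poly (A' \<circ>\<^sub>p q) w - 1)) \<longlongrightarrow> of_real (D.second_limit / D.limit_f)) at_infinity"
      using filterlim_compose[OF D2 qinf] by (simp add: poly_pcompose)
    have "((\<lambda>w. 1 / (- 1 + (2 / of_nat r - 1) / w)) \<longlongrightarrow> 1 / (- 1 + (0 :: complex))) at_infinity"
      by (intro tendsto_divide tendsto_add tendsto_const tendsto_divide_0[OF tendsto_const filterlim_ident]) auto
    moreover have "eventually (\<lambda>w. 1 / (- 1 + (2 / of_nat r - 1) / w) = w / poly q w) at_infinity"
      using filterlim_at_infinity_imp_eventually_ne[OF filterlim_ident, of 0]
    proof eventually_elim
      case (elim w)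
      have "- 1 + (2 / of_nat r - 1) / w = poly q w / w" using elim by (simp add: q field_simps)
      thus ?case by simp
    qed
    ultimately show "((\<lambda>w. w / poly q w) \<longlongrightarrow> - 1) at_infinity"
      using Lim_transform_eventually by fastforce
  qed
  moreover have "eventually (\<lambda>w. (w / poly q w) ^ 2 * (poly q w ^ 2 * (poly (B' \<circ>\<^sub>p q) w / poly (A' \<circ>\<^sub>p q) w - 1)) = w ^ 2 * (poly (B' \<circ>\<^sub>p q) w / poly (A' \<circ>\<^sub>p q) w - 1)) at_infinity"
    using filterlim_at_infinity_imp_eventually_ne[OF qinf, of 0] by eventually_elim (simp add: power_divide)
  ultimately have e': "((\<lambda>w. w ^ 2 * (poly (B' \<circ>\<^sub>p q) w / poly (A' \<circ>\<^sub>p q) w - 1)) \<longlongrightarrow> of_real (D.second_limit / D.limit_f)) at_infinity"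
    using Lim_transform_eventually by fastforce
  have "rel_poly \<noteq> 0"
    using rel_poly_nonzero_at[OF ga_node(2)[of 0]] by auto
  have nzq: "A' \<circ>\<^sub>p q \<noteq> 0" "B' \<circ>\<^sub>p q \<noteq> 0"
    using nz(3,4) by (simp_all add: pcompose_eq_0_iff q_def reflection_def)
  from reciprocal_ratio_limits[OF eq[folded q_def] \<open>rel_poly \<noteq> 0\<close> nz(1,2) nzq recurrence_asymptotics(1)[OF nz(1) AB] R' recurrence_asymptotics(2)[OF nz(1) AB] e']
  have lim1: "((\<lambda>w. poly shift_poly w / poly rel_poly w) \<longlongrightarrow> 1) at_infinity"
    and lim2: "((\<lambda>w. w ^ 2 * (poly shift_poly w / poly rel_poly w - 1)) \<longlongrightarrow>
       - (of_real (second_limit / limit_f) + of_real (D.second_limit / D.limit_f))) at_infinity" by auto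
  have K: "shift_limit = 1"
    by (rule tendsto_unique[OF trivial_limit_at_infinity tendsto_shift_limit lim1])
  hence "cross_factor = of_real (real p ^ p * real (r - p) ^ (r - p) / real r ^ r)"
    using cross_factor_nonzero by (simp add: shift_limit_def)
  thus "(-1) ^ (r - p) * (1 - x) ^ (r - p) / x ^ r = real p ^ p * real (r - p) ^ (r - p) / real r ^ r"
    unfolding cross_factor_def of_real_eq_iff .
  let ?q = "\<lambda>w. (\<Prod>z\<leftarrow>map of_real num_shifts. 1 + z / w) / (\<Prod>z\<leftarrow>map of_real den_shifts. 1 + z / (w :: complex))"
  assume "2 * p \<le> r"
  hence pr: "2 * real p \<le> real r" by linarith
  have so: "sum_list (map complex_of_real zs) = of_real (sum_list zs)" for zs by (induction zs) auto
  have so2: "(sum_squares (map complex_of_real zs)) = of_real (sum_squares zs)" for zs by (induction zs) auto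
  have "((\<lambda>w. w ^ 2 * (?q w - 1)) \<longlongrightarrow> (of_real (sum_squares den_shifts) - of_real (sum_squares num_shifts)) / 2) at_infinity"
    using prod_list_quotient_expansion[of "map complex_of_real num_shifts" "map complex_of_real den_shifts"]
    unfolding so so2 sum_shifts_eq by simp
  moreover have "eventually (\<lambda>w. w ^ 2 * (?q w - 1) = w ^ 2 * (poly shift_poly w / poly rel_poly w - 1)) at_infinity"
    using shift_rel_quotient unfolding K by eventually_elim simp
  ultimately have "((\<lambda>w. w ^ 2 * (poly shift_poly w / poly rel_poly w - 1)) \<longlongrightarrow> (of_real (sum_squares den_shifts) - of_real (sum_squares num_shifts)) / 2) at_infinity"
    by (rule Lim_transform_eventually)
  from tendsto_unique[OF trivial_limit_at_infinity this lim2]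
  have "complex_of_real (((sum_squares den_shifts) - (sum_squares num_shifts)) / 2) =
      of_real (- (second_limit / limit_f + D.second_limit / D.limit_f))" by simp
  hence main: "((sum_squares den_shifts) - (sum_squares num_shifts)) / 2 = - ((second_limit + D.second_limit) / limit_f)"
    unfolding of_real_eq_iff by (simp add: add_divide_distrib)
  have "second_limit + D.second_limit \<le> 0"
  proof -
    have s: "(\<lambda>k. half_coeff x k * slope k + half_coeff x k * D.slope k)
       sums (second_limit + D.second_limit)"
      using summable_sums[OF second_difference_limit(1)] summable_sums[OF D.second_difference_limit(1)]
      unfolding second_limit_def D.second_limit_def
      by (intro sums_add) auto
    show ?thesis
    proof (rule sums_le[OF _ s sums_zero])
      fix k
      \<comment> \<open>Here a cancels against the a of the dual; what is left is nonnegative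
        exactly because 2 p <= r.\<close>
      have "slope_a + D.slope_a = (1 - 2 * real p / real r) / real r"
        by (simp add: slope_a_def D.slope_a_def add_divide_distrib[symmetric])
      also have "\<dots> \<ge> 0" using pr r_pos by (intro divide_nonneg_nonneg) (auto simp: field_simps)
      finally have "slope k + D.slope k \<le> 0"
        using p_less_r by (intro quot_slope_sum_nonpos) (auto simp: slope_c_def)
      hence "half_coeff x k * (slope k + D.slope k) \<le> 0"
        using half_coeff_bounds[OF x_pos, of k] by (intro mult_nonneg_nonpos) auto
      thus "half_coeff x k * slope k + half_coeff x k * D.slope k \<le> 0"
        by (simp add: distrib_left)
    qed
  qed
  hence "(second_limit + D.second_limit) / limit_f \<le> 0"
    using limit_f_pos by (intro divide_nonpos_pos)
  hence "0 \<le> ((sum_squares den_shifts) - (sum_squares num_shifts)) / 2"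
    unfolding main by (simp only: neg_0_le_iff_le)
  thus "(sum_squares num_shifts) \<le> (sum_squares den_shifts)"
    by simp
qed

end

section \<open>From the cross relation to gamma products\<close>

lemma eventually_nonzero_entire:
  assumes v: "v holomorphic_on UNIV" and nz: "v \<beta> \<noteq> 0"
  shows "eventually (\<lambda>w. v w \<noteq> 0) (at z)"
proof (cases "v z = 0")
  case True
  obtain e where "0 < e" "\<And>w. w \<in> ball z e - {z} \<Longrightarrow> v w \<noteq> 0"
    using isolated_zeros[OF v open_UNIV connected_UNIV UNIV_I True UNIV_I nz] by metis
  thus ?thesis unfolding eventually_at by (intro exI[of _ e]) (auto simp: dist_commute)
next
  case False
  have "isCont v z"
    using holomorphic_on_imp_continuous_on[OF v] by (simp add: continuous_on_eq_continuous_at)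
  thus ?thesis using False by (intro tendsto_imp_eventually_ne[of v "v z"]) (auto simp: isCont_def)
qed

text \<open>Riemann's theorem: the zeros of v are isolated and the bound makes the singularity of
  u/v removable.\<close>

lemma bounded_quotient_limit:
  assumes u: "u holomorphic_on UNIV" and v: "v holomorphic_on UNIV" "v \<beta> \<noteq> 0"
    and bnd: "eventually (\<lambda>w. norm (u w) \<le> C * norm (v w)) (at z)"
  shows "\<exists>l. ((\<lambda>w. u w / v w) \<longlongrightarrow> l) (at z)"
proof -
  have ev: "eventually (\<lambda>w. v w \<noteq> 0) (at z)" by (rule eventually_nonzero_entire[OF v])
  then obtain e where e: "0 < e" "\<And>w. w \<noteq> z \<Longrightarrow> dist w z < e \<Longrightarrow> v w \<noteq> 0"
    unfolding eventually_at by auto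
  have hol: "(\<lambda>w. u w / v w) holomorphic_on (ball z e - {z})"
    using e by (intro holomorphic_intros holomorphic_on_subset[OF u] holomorphic_on_subset[OF v(1)]) (auto simp: dist_commute)
  have "eventually (\<lambda>w. norm (u w / v w) \<le> C) (at z)"
    using ev bnd by eventually_elim (simp add: norm_divide divide_le_eq)
  hence "\<exists>g. g holomorphic_on ball z e \<and> (\<forall>w \<in> ball z e - {z}. g w = u w / v w)"
    using holomorphic_on_extend_bounded[OF hol] e(1) by auto
  then obtain g where g: "g holomorphic_on ball z e" "\<And>w. w \<in> ball z e - {z} \<Longrightarrow> g w = u w / v w" by auto
  have "isCont g z"
    using holomorphic_on_imp_continuous_on[OF g(1)] e(1) by (simp add: continuous_on_eq_continuous_at)
  hence 1: "(g \<longlongrightarrow> g z) (at z)" by (simp add: isCont_def)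
  have 2: "eventually (\<lambda>w. g w = u w / v w) (at z)"
    unfolding eventually_at using e(1) g(2) by (intro exI[of _ e]) (auto simp: dist_commute)
  show ?thesis by (rule exI, rule Lim_transform_eventually[OF 1 2])
qed

(* A collects the finitely many zeros of v in the disc; A u / v extends to an entire function of
   polynomial growth. *)
lemma bounded_entire_quotient_rational:
  assumes u: "u holomorphic_on UNIV" and v: "v holomorphic_on UNIV" "v \<beta> \<noteq> 0"
    and bnd: "\<And>w. W < norm w \<Longrightarrow> norm (u w) \<le> C * norm (v w)"
  obtains A B :: "complex poly" where "A \<noteq> 0" "\<And>w. poly A w * u w = poly B w * v w"
proof -
  define Z where "Z = {z \<in> cball 0 W. v z = 0}"
  have "finite Z"
  proof (rule ccontr)
    assume "infinite Z"
    moreover have "Z \<subseteq> cball 0 W" by (auto simp: Z_def)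
    ultimately obtain z where "z islimpt Z"
      using compact_cball[of "0 :: complex" W] unfolding compact_eq_Bolzano_Weierstrass by blast
    hence "\<not> eventually (\<lambda>w. w \<notin> Z) (at z)" by (simp add: islimpt_iff_eventually)
    moreover have "eventually (\<lambda>w. w \<notin> Z) (at z)"
      using eventually_nonzero_entire[OF v(1,2), of z] by eventually_elim (auto simp: Z_def)
    ultimately show False by simp
  qed
  have "\<forall>z\<in>Z. \<exists>n g e. 0 < e \<and> g holomorphic_on ball z e \<and> (\<forall>w\<in>ball z e. v w = (w - z) ^ n * g w \<and> g w \<noteq> 0)"
  proof
    fix z assume "z \<in> Z"
    hence "v z = 0" by (simp add: Z_def)
    hence nc: "\<not> v constant_on UNIV" using v(2) unfolding constant_on_def by (metis UNIV_I)
    obtain g e n where "0 < (n::nat)" "0 < e" "ball z e \<subseteq> UNIV" "g holomorphic_on ball z e"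
       "\<And>w. w \<in> ball z e \<Longrightarrow> v w = (w - z) ^ n * g w" "\<And>w. w \<in> ball z e \<Longrightarrow> g w \<noteq> 0"
      using holomorphic_factor_zero_nonconstant[OF v(1) open_UNIV connected_UNIV UNIV_I \<open>v z = 0\<close> nc] by metis
    thus "\<exists>n g e. 0 < e \<and> g holomorphic_on ball z e \<and> (\<forall>w\<in>ball z e. v w = (w - z) ^ n * g w \<and> g w \<noteq> 0)" by blast
  qed
  then obtain N where N: "\<And>z. z \<in> Z \<Longrightarrow> \<exists>g e. 0 < e \<and> g holomorphic_on ball z e \<and> (\<forall>w\<in>ball z e. v w = (w - z) ^ N z * g w \<and> g w \<noteq> 0)"
    by metis
  define A :: "complex poly" where "A = (\<Prod>z\<in>Z. [:-z, 1:] ^ N z)"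
  have A0: "A \<noteq> 0" using \<open>finite Z\<close> by (simp add: A_def)
  have contP: "isCont (poly P) z" for P :: "complex poly" and z by (rule poly_isCont)
  have cu: "isCont u z" and cv: "isCont v z" for z
    using holomorphic_on_imp_continuous_on[OF u] holomorphic_on_imp_continuous_on[OF v(1)]
    by (simp_all add: continuous_on_eq_continuous_at)
  define q where "q = (\<lambda>w. poly A w * u w / v w)"
  have Au: "(\<lambda>w. poly A w * u w) holomorphic_on UNIV" by (intro holomorphic_intros u)
  \<comment> \<open>Zeros of v in the disc are cancelled by A, zeros outside are removable by the
    assumed bound, and elsewhere the quotient is continuous.\<close>
  have lim: "\<exists>l. (q \<longlongrightarrow> l) (at z)" for z
  proof (cases "v z = 0 \<and> norm z \<le> W")
    case True
    hence zZ: "z \<in> Z" by (simp add: Z_def)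
    obtain g e where ge: "0 < e" "g holomorphic_on ball z e" "\<And>w. w \<in> ball z e \<Longrightarrow> v w = (w - z) ^ N z * g w" "\<And>w. w \<in> ball z e \<Longrightarrow> g w \<noteq> 0"
      using N[OF zZ] by blast
    define R where "R = (\<Prod>z\<in>Z - {z}. [:-z, 1:] ^ N z)"
    have AR: "A = [:-z, 1:] ^ N z * R" unfolding A_def R_def using \<open>finite Z\<close> zZ by (rule prod.remove)
    have "isCont g z"
      using holomorphic_on_imp_continuous_on[OF ge(2)] ge(1) by (simp add: continuous_on_eq_continuous_at)
    hence 1: "((\<lambda>w. poly R w * u w / g w) \<longlongrightarrow> poly R z * u z / g z) (at z)"
      using contP cu[of z] ge(1) ge(4)[of z] by (intro tendsto_intros) (auto simp: isCont_def)
    have 2: "eventually (\<lambda>w. poly R w * u w / g w = q w) (at z)"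
      unfolding eventually_at
    proof (intro exI[of _ e] conjI ballI impI ge(1))
      fix w assume w: "w \<noteq> z \<and> dist w z < e"
      hence "w \<in> ball z e" by (simp add: dist_commute)
      thus "poly R w * u w / g w = q w"
        using w ge(3)[of w] ge(4)[of w] by (simp add: q_def AR)
    qed
    show ?thesis by (rule exI, rule Lim_transform_eventually[OF 1 2])
  next
    case False
    show ?thesis
    proof (cases "v z = 0")
      case True
      with False have "W < norm z" by simp
      have 1: "eventually (\<lambda>w. W < norm w) (at z)"
        using \<open>W < norm z\<close> by (intro order_tendstoD(1)[of norm "norm z"] tendsto_norm tendsto_ident_at)
      have "eventually (\<lambda>w. norm (poly A w) < norm (poly A z) + 1) (at z)"
        using contP by (intro order_tendstoD(2)[of _ "norm (poly A z)"] tendsto_norm) (auto simp: isCont_def)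
      with 1 have "eventually (\<lambda>w. norm (poly A w * u w) \<le> (norm (poly A z) + 1) * C * norm (v w)) (at z)"
      proof eventually_elim
        case (elim w)
        have "norm (poly A w * u w) \<le> (norm (poly A z) + 1) * (C * norm (v w))"
          unfolding norm_mult using elim bnd[of w] by (intro mult_mono) auto
        thus ?case by (simp add: mult_ac)
      qed
      from bounded_quotient_limit[OF Au v(1,2) this] show ?thesis unfolding q_def .
    next
      case False
      hence "(q \<longlongrightarrow> q z) (at z)"
        unfolding q_def using contP cu[of z] cv[of z] by (intro tendsto_intros) (auto simp: isCont_def)
      thus ?thesis by blast
    qed
  qed
  define Q where "Q = remove_sings q"
  have q_an: "q analytic_on {w}" if "v w \<noteq> 0" for w
    unfolding q_def using that Au v(1)
    by (intro analytic_on_divide holomorphic_on_imp_analytic_at[OF _ open_UNIV]) auto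
  have iso: "isolated_singularity_at q z" for z
  proof -
    obtain e where e: "0 < e" "\<And>w. w \<noteq> z \<Longrightarrow> dist w z < e \<Longrightarrow> v w \<noteq> 0"
      using eventually_nonzero_entire[OF v(1,2), of z] unfolding eventually_at by auto
    have "q analytic_on ball z e - {z}"
      using q_an e by (subst analytic_on_analytic_at) (auto simp: dist_commute)
    thus ?thesis unfolding isolated_singularity_at_def using e(1) by blast
  qed
  have Q_an: "Q analytic_on {z}" for z
  proof -
    obtain l where "(q \<longlongrightarrow> l) (at z)" using lim by blast
    thus ?thesis unfolding Q_def by (rule remove_sings_analytic_at[OF iso])
  qed
  hence Q_hol: "Q holomorphic_on UNIV"
    by (intro analytic_imp_holomorphic) (simp add: analytic_on_analytic_at[of Q UNIV])
  have Q_eq: "Q w * v w = poly A w * u w" for w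
  proof -
    have cQ: "isCont Q w" using Q_an by (rule analytic_at_imp_isCont)
    have "((\<lambda>w. Q w * v w) \<longlongrightarrow> Q w * v w) (at w)"
      using cQ cv[of w] by (intro tendsto_intros) (auto simp: isCont_def)
    moreover have "((\<lambda>w. poly A w * u w) \<longlongrightarrow> poly A w * u w) (at w)"
      using contP cu[of w] by (intro tendsto_intros) (auto simp: isCont_def)
    moreover have "eventually (\<lambda>w. Q w * v w = poly A w * u w) (at w)"
      using eventually_nonzero_entire[OF v(1,2), of w]
    proof eventually_elim
      case (elim w)
      have "Q w = q w" unfolding Q_def using q_an[OF elim] by (rule remove_sings_at_analytic)
      thus ?case using elim by (simp add: q_def)
    qed
    ultimately show ?thesis
      using tendsto_cong[of "\<lambda>w. Q w * v w" "\<lambda>w. poly A w * u w" "at w"] tendsto_unique[OF at_neq_bot] by blast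
  qed
  have Q_bd: "norm (Q w) \<le> C * norm (poly A w)" if w: "W < norm w" for w
  proof -
    have "((\<lambda>w. norm (Q w)) \<longlongrightarrow> norm (Q w)) (at w)"
      using analytic_at_imp_isCont[OF Q_an[of w]] by (intro tendsto_norm) (simp add: isCont_def)
    moreover have "((\<lambda>w. C * norm (poly A w)) \<longlongrightarrow> C * norm (poly A w)) (at w)"
      using contP by (intro tendsto_mult tendsto_const tendsto_norm) (simp add: isCont_def)
    moreover have "eventually (\<lambda>w. W < norm w) (at w)"
      using w by (intro order_tendstoD(1)[of norm "norm w"] tendsto_norm tendsto_ident_at)
    with eventually_nonzero_entire[OF v(1,2), of w] have "eventually (\<lambda>w. norm (Q w) \<le> C * norm (poly A w)) (at w)"
    proof eventually_elim
      case (elim w)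
      have "norm (Q w) * norm (v w) = norm (poly A w) * norm (u w)"
        using Q_eq[of w] by (metis norm_mult)
      also have "\<dots> \<le> norm (poly A w) * (C * norm (v w))"
        using bnd[OF elim(2)] by (intro mult_left_mono) auto
      finally have "norm (Q w) * norm (v w) \<le> (C * norm (poly A w)) * norm (v w)" by (simp add: mult_ac)
      thus ?case using elim(1) by (simp only: mult_le_cancel_right) auto
    qed
    ultimately show ?thesis
      using tendsto_le[OF at_neq_bot] by blast
  qed
  obtain B0 where B0: "\<And>w. B0 \<le> norm w \<Longrightarrow> norm (poly A w) \<le> (norm (lead_coeff A) + 1) * norm w ^ degree A"
  proof -
    have "eventually (\<lambda>w. norm (poly A w / w ^ degree A) < norm (lead_coeff A) + 1) at_infinity"
      by (intro order_tendstoD(2)[OF tendsto_norm[OF poly_divide_tendsto_aux]]) simp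
    moreover have "eventually (\<lambda>w::complex. w \<noteq> 0) at_infinity"
      by (rule filterlim_at_infinity_imp_eventually_ne[OF filterlim_ident])
    ultimately have "eventually (\<lambda>w. norm (poly A w) \<le> (norm (lead_coeff A) + 1) * norm w ^ degree A) at_infinity"
      by eventually_elim (simp add: norm_divide norm_power field_simps)
    thus ?thesis using that by (auto simp: eventually_at_infinity)
  qed
  have "norm (Q w) \<le> (\<bar>C\<bar> * (norm (lead_coeff A) + 1)) * norm w ^ degree A" if "max B0 (W + 1) \<le> norm w" for w
  proof -
    have "norm (Q w) \<le> \<bar>C\<bar> * norm (poly A w)"
      using that by (intro order.trans[OF Q_bd] mult_right_mono) auto
    also have "\<dots> \<le> \<bar>C\<bar> * ((norm (lead_coeff A) + 1) * norm w ^ degree A)"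
      using that by (intro mult_left_mono B0) auto
    finally show ?thesis by (simp add: mult_ac)
  qed
  hence Qp: "Q w = (\<Sum>k\<le>degree A. (deriv ^^ k) Q 0 / fact k * w ^ k)" for w
    by (rule Liouville_polynomial[OF Q_hol])
  define B where "B = (\<Sum>k\<le>degree A. monom ((deriv ^^ k) Q 0 / fact k) k)"
  have "poly B w = Q w" for w
    unfolding B_def Qp[of w] by (simp add: poly_sum poly_monom)
  hence "poly A w * u w = poly B w * v w" for w using Q_eq[of w] by simp
  with A0 show ?thesis using that by blast
qed

section \<open>Gamma products far to the right\<close>

text \<open>This is Gamma(z + n) ~ (n - 1)! n^z, a rewriting of the limit formula behind
  \<open>Gamma_series'\<close>.\<close>

lemma Gamma_shift_asymptotics:
  fixes z :: complex
  assumes "z \<notin> \<int>\<^sub>\<le>\<^sub>0"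
  shows "(\<lambda>n. Gamma (z + of_nat n) / (fact (n - 1) * exp (z * of_real (ln (of_nat n))))) \<longlonglongrightarrow> 1"
proof -
  have nz: "Gamma z \<noteq> 0" using assms by (simp add: Gamma_eq_zero_iff)
  have "(\<lambda>n. Gamma z / Gamma_series' z n) \<longlonglongrightarrow> Gamma z / Gamma z"
    using nz by (intro tendsto_divide tendsto_const Gamma_series'_LIMSEQ)
  moreover have "Gamma z / Gamma_series' z n = Gamma (z + of_nat n) / (fact (n - 1) * exp (z * of_real (ln (of_nat n))))" for n
    using nz assms by (simp add: Gamma_series'_def pochhammer_Gamma)
  ultimately show ?thesis using nz by simp
qed

text \<open>The exponent depends on w only through the number of factors, so in a quotient of two
  products of equal length the growth rate is the same for every w.\<close>

lemma Gamma_product_shift_asymptotics: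
  fixes us :: "complex list"
  assumes "\<And>u. u \<in> set us \<Longrightarrow> w + u \<notin> \<int>\<^sub>\<le>\<^sub>0"
  shows "(\<lambda>n. (\<Prod>u\<leftarrow>us. Gamma (w + of_nat n + u)) /
     (fact (n - 1) ^ length us * exp ((of_nat (length us) * w + sum_list us) * of_real (ln (of_nat n))))) \<longlonglongrightarrow> 1"
  using assms
proof (induction us)
  case (Cons u us)
  have "w + u \<notin> \<int>\<^sub>\<le>\<^sub>0" using Cons.prems by simp
  from tendsto_mult[OF Gamma_shift_asymptotics[OF this] Cons.IH] Cons.prems
  have lim: "(\<lambda>n. Gamma (w + u + of_nat n) / (fact (n - 1) * exp ((w + u) * of_real (ln (of_nat n)))) *
     ((\<Prod>u\<leftarrow>us. Gamma (w + of_nat n + u)) /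
     (fact (n - 1) ^ length us * exp ((of_nat (length us) * w + sum_list us) * of_real (ln (of_nat n)))))) \<longlonglongrightarrow> 1 * 1" by auto
  have E: "exp ((w + u) * L) * exp ((of_nat (length us) * w + sum_list us) * L) =
      exp ((of_nat (length (u # us)) * w + sum_list (u # us)) * L)" for L :: complex
    unfolding exp_add[symmetric] by (simp add: algebra_simps)
  show ?case unfolding E[symmetric] using lim by (simp add: add_ac mult_ac)
qed auto

lemma poly_ratio_limit_1:
  fixes A B :: "complex poly"
  assumes A: "A \<noteq> 0" and lim: "((\<lambda>w. poly B w / poly A w) \<longlongrightarrow> 1) at_infinity"
  shows "degree B = degree A" "lead_coeff B = lead_coeff A"
proof -
  have nle: False if deg: "degree P < degree Q" and l: "((\<lambda>w. poly P w / poly Q w) \<longlongrightarrow> 1) at_infinity" for P Q :: "complex poly"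
    using tendsto_unique[OF trivial_limit_at_infinity l poly_divide_tendsto_0_at_infinity[OF deg]] by simp
  have "((\<lambda>w. 1 / (poly B w / poly A w)) \<longlongrightarrow> 1 / 1) at_infinity"
    by (intro tendsto_divide tendsto_const lim) simp
  hence lim': "((\<lambda>w. poly A w / poly B w) \<longlongrightarrow> 1) at_infinity" by simp
  show deg: "degree B = degree A"
    using nle[OF _ lim] nle[OF _ lim'] by (meson linorder_neqE_nat)
  have l: "((\<lambda>w. (poly B w / w ^ degree B) / (poly A w / w ^ degree A)) \<longlongrightarrow> lead_coeff B / lead_coeff A) at_infinity"
    using A by (intro tendsto_divide poly_divide_tendsto_aux) auto
  have "eventually (\<lambda>w::complex. w \<noteq> 0) at_infinity"
    by (rule filterlim_at_infinity_imp_eventually_ne[OF filterlim_ident])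
  hence e: "eventually (\<lambda>w. (poly B w / w ^ degree B) / (poly A w / w ^ degree A) = poly B w / poly A w) at_infinity"
    by eventually_elim (simp add: deg)
  have "lead_coeff B / lead_coeff A = 1"
    by (rule tendsto_unique[OF trivial_limit_at_infinity Lim_transform_eventually[OF l e] lim])
  thus "lead_coeff B = lead_coeff A" using A by simp
qed

lemma complex_poly_split_exists:
  fixes A :: "complex poly"
  assumes "A \<noteq> 0"
  shows "\<exists>us. length us = degree A \<and> (\<forall>w. poly A w = lead_coeff A * (\<Prod>u\<leftarrow>us. w + u))"
proof -
  obtain M where M: "size M = degree A" "A = smult (lead_coeff A) (\<Prod>x\<in>#M. [:-x, 1:])"
    using alg_closed_imp_factorization[OF assms] by blast
  obtain xs where xs: "M = mset xs" by (metis ex_mset)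
  have "poly (\<Prod>x\<in>#mset xs. [:-x, 1:]) w = (\<Prod>u\<leftarrow>map uminus xs. w + u)" for w :: complex
    by (induction xs) (auto simp: left_diff_distrib)
  moreover have "poly A w = lead_coeff A * poly (\<Prod>x\<in>#M. [:-x, 1:]) w" for w
    by (subst M(2)) simp
  ultimately show ?thesis using M(1) by (intro exI[of _ "map uminus xs"]) (simp add: xs)
qed

context gauss_family
begin

(* To the right f is close to its limit; to the left the cross relation replaces f by fd. *)
lemma shift_bound:
  assumes rel: "cross_relation"
  obtains W C where "\<And>w. W < norm w \<Longrightarrow> ga w \<notin> \<int> \<Longrightarrow> norm (f (w + 1)) \<le> C * norm (f w)"
proof -
  define c where "c = limit_f"
  have c: "c > 0" using limit_f_pos by (simp add: c_def)
  have near: "c / 2 < norm y \<and> norm y < 2 * c" if "dist y (of_real c) < c / 2" for y :: complex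
  proof -
    have "\<bar>norm y - c\<bar> < c / 2"
      using that norm_triangle_ineq3[of y "of_real c"] c by (simp add: dist_norm)
    thus ?thesis using c by (auto simp: abs_if split: if_splits)
  qed
  have "eventually (\<lambda>w. dist (f w) (of_real c) < c / 2) (right_infinity 0)"
    using c unfolding c_def by (intro tendstoD[OF f_tendsto]) auto
  then obtain b1 where b1: "\<And>w. b1 \<le> norm w \<Longrightarrow> 0 \<le> Re w \<Longrightarrow> c / 2 < norm (f w) \<and> norm (f w) < 2 * c"
    using near by (auto simp: eventually_inf_principal eventually_at_infinity)
  have "eventually (\<lambda>w. dist (fd w) (of_real c) < c / 2) (inf at_infinity (principal {w. Re w \<le> 1}))"
    using c unfolding c_def by (intro tendstoD[OF fd_tendsto]) auto
  then obtain b2 where b2: "\<And>w. b2 \<le> norm w \<Longrightarrow> Re w \<le> 1 \<Longrightarrow> c / 2 < norm (fd w) \<and> norm (fd w) < 2 * c"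
    using near by (auto simp: eventually_inf_principal eventually_at_infinity)
  define K where "K = shift_limit"
  have K: "norm K > 0" using p_pos r_pos p_less_r cross_factor_nonzero by (simp add: K_def shift_limit_def)
  have "eventually (\<lambda>w. norm K / 2 < norm (poly shift_poly w / poly rel_poly w)) at_infinity"
    using K unfolding K_def by (intro order_tendstoD(1)[OF tendsto_norm[OF tendsto_shift_limit]]) auto
  then obtain b3 where b3: "\<And>w. b3 \<le> norm w \<Longrightarrow> norm K / 2 < norm (poly shift_poly w / poly rel_poly w)"
    by (auto simp: eventually_at_infinity)
  \<comment> \<open>The margin 1 makes the estimates valid at w + 1 too. In C, 4 is the ratio of the
    bounds 2c and c/2, and 8 / |K| is this ratio times 2 / |K| from the lower bound on
    \<open>shift_poly\<close> / \<open>rel_poly\<close>.\<close>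
  define W where "W = max (b1 + 1) (max (b2 + 1) b3)"
  define C where "C = max 4 (8 / norm K)"
  have "norm (f (w + 1)) \<le> C * norm (f w)" if w: "W < norm w" "ga w \<notin> \<int>" for w
  proof -
    have n1: "norm w - 1 \<le> norm (w + 1)" using norm_triangle_ineq4[of "w + 1" 1] by simp
    show ?thesis
    proof (cases "0 \<le> Re w")
      case True
      have "norm (f (w + 1)) \<le> 2 * c" using b1[of "w + 1"] w n1 True by (simp add: W_def)
      also have "\<dots> = 4 * (c / 2)" by simp
      also have "\<dots> \<le> C * norm (f w)"
        using b1[of w] w True c by (intro mult_mono) (auto simp: W_def C_def)
      finally show ?thesis .
    next
      case False
      have fd: "c / 2 < norm (fd w)" "norm (fd (w + 1)) < 2 * c"
        using b2[of w] b2[of "w + 1"] w n1 False by (auto simp: W_def)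
      have G: "norm (poly rel_poly w) > 0" using rel_poly_nonzero_at[OF w(2)] by simp
      have "norm K / 2 < norm (poly shift_poly w / poly rel_poly w)"
        using w by (intro b3) (simp add: W_def)
      hence S: "norm K / 2 * norm (poly rel_poly w) \<le> norm (poly shift_poly w)"
        using G by (simp add: norm_divide pos_less_divide_eq)
      have "(norm K / 2 * norm (poly rel_poly w)) * norm (f (w + 1)) * (c / 2) \<le>
          norm (poly shift_poly w) * norm (f (w + 1)) * norm (fd w)"
        using S fd c by (intro mult_mono) auto
      also have "\<dots> = norm (poly rel_poly w) * norm (f w) * norm (fd (w + 1))"
        using rel w(2) unfolding cross_relation_alt norm_mult[symmetric] by metis
      also have "\<dots> \<le> norm (poly rel_poly w) * norm (f w) * (2 * c)"
        using fd by (intro mult_left_mono) auto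
      finally have "(norm (poly rel_poly w) * c) * (norm K / 4 * norm (f (w + 1))) \<le> (norm (poly rel_poly w) * c) * (2 * norm (f w))"
        by (simp add: mult_ac)
      hence "norm K / 4 * norm (f (w + 1)) \<le> 2 * norm (f w)"
        using G c by (simp add: mult_le_cancel_left_pos)
      hence "norm (f (w + 1)) \<le> 8 / norm K * norm (f w)"
        using K by (simp add: field_simps)
      also have "\<dots> \<le> C * norm (f w)" by (intro mult_right_mono) (auto simp: C_def)
      finally show ?thesis .
    qed
  qed
  thus ?thesis using that by blast
qed

lemma cross_relation_imp_recurrence:
  assumes rel: "cross_relation"
  obtains A B where "A \<noteq> 0" "\<And>w. ga w \<notin> \<int>\<^sub>\<le>\<^sub>0 \<Longrightarrow> poly A w * f (w + 1) = poly B w * f w"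
proof -
  obtain W C where WC: "\<And>w. W < norm w \<Longrightarrow> ga w \<notin> \<int> \<Longrightarrow> norm (f (w + 1)) \<le> C * norm (f w)"
    using shift_bound[OF rel] by blast
  \<comment> \<open>Chosen so that f(w + 1) and f(w) carry the same factor Gamma(ga w), with entire
    cofactors u and \<open>freg\<close>. The bound on f then becomes one on entire
    functions.\<close>
  define u where "u = (\<lambda>w. pochhammer (ga w) r * freg (w + 1))"
  have f1: "f (w + 1) = Gamma (ga w) * u w" if w: "ga w \<notin> \<int>\<^sub>\<le>\<^sub>0" for w
  proof -
    have "Gamma (ga (w + 1)) = pochhammer (ga w) r * Gamma (ga w)"
      using pochhammer_Gamma[OF w, of r] w by (simp add: ga_plus_1 Gamma_eq_zero_iff)
    thus ?thesis using f_eq_freg[OF ga_nonpos_plus_1[OF w]] by (simp add: u_def)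
  qed
  have "(\<lambda>w. w + 1 :: complex) holomorphic_on UNIV" by (intro holomorphic_intros)
  hence "(\<lambda>w. freg (w + 1)) holomorphic_on UNIV"
    using holomorphic_on_compose_gen[OF _ freg_holomorphic, of "\<lambda>w. w + 1" UNIV] by (auto simp: o_def)
  hence u: "u holomorphic_on UNIV"
    unfolding u_def ga_def pochhammer_prod by (intro holomorphic_intros)
  have cont: "isCont u w" "isCont freg w" for w
    using holomorphic_on_imp_continuous_on[OF u] holomorphic_on_imp_continuous_on[OF freg_holomorphic]
    by (simp_all add: continuous_on_eq_continuous_at)
  have bnd: "norm (u w) \<le> C * norm (freg w)" if w: "W < norm w" for w
  proof -
    have "((\<lambda>w. norm (u w)) \<longlongrightarrow> norm (u w)) (at w)"
      using cont(1)[of w] by (intro tendsto_norm) (simp add: isCont_def)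
    moreover have "((\<lambda>w. C * norm (freg w)) \<longlongrightarrow> C * norm (freg w)) (at w)"
      using cont(2)[of w] by (intro tendsto_mult tendsto_const tendsto_norm) (simp add: isCont_def)
    moreover have "eventually (\<lambda>w. W < norm w) (at w)"
      using w by (intro order_tendstoD(1)[of norm "norm w"] tendsto_norm tendsto_ident_at)
    with eventually_ga_nonint[of w] have "eventually (\<lambda>w. norm (u w) \<le> C * norm (freg w)) (at w)"
    proof eventually_elim
      case (elim v)
      have n: "ga v \<notin> \<int>\<^sub>\<le>\<^sub>0" using elim(1) nonpos_Ints_Int by blast
      hence "norm (Gamma (ga v)) * norm (u v) \<le> norm (Gamma (ga v)) * (C * norm (freg v))"
        using WC[OF elim(2,1)] unfolding f1[OF n] f_eq_freg[OF n] by (simp add: norm_mult mult_ac)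
      thus ?case using n by (simp add: Gamma_eq_zero_iff)
    qed
    ultimately show ?thesis using tendsto_le[OF at_neq_bot] by blast
  qed
  have "\<exists>\<beta>. freg \<beta> \<noteq> 0"
  proof (rule ccontr)
    assume "\<nexists>\<beta>. freg \<beta> \<noteq> 0"
    hence "f w = 0" if "ga w \<notin> \<int>\<^sub>\<le>\<^sub>0" for w using f_eq_freg[OF that] by simp
    moreover have "ga (of_nat (Suc n)) \<notin> \<int>\<^sub>\<le>\<^sub>0" for n
      unfolding ga_def using r_pos by (metis mult_is_0 nat.distinct(1) not_gr_zero of_nat_in_nonpos_Ints_iff of_nat_mult)
    ultimately have "(\<lambda>n. f (of_nat (Suc n))) = (\<lambda>n. 0)" by blast
    thus False using LIMSEQ_Suc[OF f_nat_limit] limit_f_pos by (simp add: LIMSEQ_const_iff)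
  qed
  then obtain \<beta> where "freg \<beta> \<noteq> 0" ..
  from bounded_entire_quotient_rational[OF u freg_holomorphic this bnd]
  obtain A B where AB: "A \<noteq> 0" "\<And>w. poly A w * u w = poly B w * freg w" by blast
  have "poly A w * f (w + 1) = poly B w * f w" if "ga w \<notin> \<int>\<^sub>\<le>\<^sub>0" for w
    using AB(2)[of w] unfolding f1[OF that] f_eq_freg[OF that] by (simp add: mult.left_commute)
  thus ?thesis using AB(1) that by blast
qed

lemma cross_relation_imp_gamma_product:
  assumes rel: "cross_relation"
  shows "solves_problem_I (real p) 0 (real r) a (1/2) x"
proof -
  obtain A B where AB: "A \<noteq> 0" "\<And>w. ga w \<notin> \<int>\<^sub>\<le>\<^sub>0 \<Longrightarrow> poly A w * f (w + 1) = poly B w * f w"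
    using cross_relation_imp_recurrence[OF rel] by blast
  have lim: "((\<lambda>w. poly B w / poly A w) \<longlongrightarrow> 1) at_infinity"
    by (rule recurrence_asymptotics(1)[OF AB])
  have deg: "degree B = degree A" "lead_coeff B = lead_coeff A"
    using poly_ratio_limit_1[OF AB(1) lim] by auto
  have lc: "lead_coeff A \<noteq> 0" using AB(1) by simp
  have "B \<noteq> 0"
  proof
    assume "B = 0"
    hence "lead_coeff B = 0" by simp
    thus False using lc deg(2) by simp
  qed
  obtain vs where vs: "length vs = degree A" "\<And>w. poly A w = lead_coeff A * (\<Prod>u\<leftarrow>vs. w + u)"
    using complex_poly_split_exists[OF AB(1)] by blast
  obtain us where us: "length us = degree A" "\<And>w. poly B w = lead_coeff A * (\<Prod>u\<leftarrow>us. w + u)"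
    using complex_poly_split_exists[OF \<open>B \<noteq> 0\<close>] unfolding deg(2) unfolding deg(1) by blast
  \<comment> \<open>Excluding all integers, not only the poles, keeps the set stable under w -> w +
    n.\<close>
  define good where "good = (\<lambda>w. ga w \<notin> \<int> \<and> (\<forall>u\<in>set us \<union> set vs. w + u \<notin> \<int>))"
  have good_ev: "eventually good (at z)" for z
  proof -
    have "eventually (\<lambda>w. \<forall>u\<in>set us \<union> set vs. 1 * w + u \<notin> \<int>) (at z)"
      by (intro eventually_ball_finite ballI eventually_affine_notin_Ints) auto
    with eventually_ga_nonint[of z] show ?thesis
      unfolding good_def by eventually_elim simp
  qed
  have good_shift: "good (w + of_nat n)" if "good w" for w n
  proof -
    have 1: "ga (w + of_nat n) = ga w + of_nat (r * n)" by (simp add: ga_def algebra_simps)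
    have 2: "w + of_nat n + u = (w + u) + of_nat n" for u by simp
    show ?thesis using that unfolding good_def 1 2 by (simp add: notin_Ints_shift(1) del: of_nat_mult)
  qed
  define GP where "GP = (\<lambda>zs w. \<Prod>u\<leftarrow>zs. Gamma (w + u :: complex))"
  have GP_nz: "GP zs w \<noteq> 0" if "\<forall>u\<in>set zs. w + u \<notin> \<int>" for zs w
  proof
    assume "GP zs w = 0"
    then obtain u where u: "u \<in> set zs" "Gamma (w + u) = 0" by (auto simp: GP_def prod_list_zero_iff)
    hence "w + u \<in> \<int>" by (simp only: Gamma_eq_zero_iff nonpos_Ints_Int)
    thus False using that u(1) by blast
  qed
  have GP_1: "GP zs (w + 1) = (\<Prod>u\<leftarrow>zs. w + u) * GP zs w" if "\<forall>u\<in>set zs. w + u \<notin> \<int>" for zs w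
    using that
  proof (induction zs)
    case (Cons u zs)
    have "w + u \<noteq> 0" using Cons.prems by (metis Ints_0 list.set_intros(1))
    hence "Gamma (w + 1 + u) = (w + u) * Gamma (w + u)"
      using Gamma_plus1_nonzero[of "w + u"] by (simp add: add_ac)
    thus ?case using Cons by (simp add: GP_def mult_ac)
  qed (simp add: GP_def)
  \<comment> \<open>The quotient of f by the expected gamma product; by the recurrence it has period
    1, and it remains to see that it is constant.\<close>
  define h where "h = (\<lambda>w. f w * GP vs w / GP us w)"
  have h_1: "h (w + 1) = h w" if w: "good w" for w
  proof -
    have wn: "ga w \<notin> \<int>\<^sub>\<le>\<^sub>0" using w nonpos_Ints_Int unfolding good_def by blast
    have pu: "(\<Prod>u\<leftarrow>us. w + u) \<noteq> 0"
    proof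
      assume "(\<Prod>u\<leftarrow>us. w + u) = 0"
      then obtain u where "u \<in> set us" "w + u = 0" by (auto simp: prod_list_zero_iff)
      thus False using w Ints_0 unfolding good_def by (metis UnI1)
    qed
    have e: "(\<Prod>u\<leftarrow>vs. w + u) * f (w + 1) = (\<Prod>u\<leftarrow>us. w + u) * f w"
      using AB(2)[OF wn] lc unfolding vs(2) us(2) by (simp add: mult.assoc)
    have "h (w + 1) = ((\<Prod>u\<leftarrow>vs. w + u) * f (w + 1)) * GP vs w / ((\<Prod>u\<leftarrow>us. w + u) * GP us w)"
      using w unfolding h_def good_def by (simp add: GP_1 mult_ac)
    also have "\<dots> = h w" unfolding e h_def using pu by simp
    finally show ?thesis .
  qed
  have h_n: "h (w + of_nat n) = h w" if "good w" for w n
  proof (induction n)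
    case (Suc n)
    have "h (w + of_nat (Suc n)) = h (w + of_nat n + 1)" by (simp add: add_ac)
    thus ?case using h_1[OF good_shift[OF that]] Suc by simp
  qed auto
  \<comment> \<open>The power of n left over between the two gamma products. It is free of w, so it
    drops out when w is compared with w0, whether or not the two sums agree.\<close>
  define X where "X = (\<lambda>n::nat. exp ((sum_list us - sum_list vs) * of_real (ln (of_nat n))) :: complex)"
  have h_lim: "(\<lambda>n. h w * X n) \<longlonglongrightarrow> of_real limit_f" if w: "good w" for w
  proof -
    let ?E = "\<lambda>zs n. fact (n - 1) ^ length zs * exp ((of_nat (length zs) * w + sum_list zs) * of_real (ln (of_nat n))) :: complex"
    have G: "(\<lambda>n. GP zs (w + of_nat n) / ?E zs n) \<longlonglongrightarrow> 1" if "set zs \<subseteq> set us \<union> set vs" for zs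
      unfolding GP_def using w that nonpos_Ints_Int
      by (intro Gamma_product_shift_asymptotics) (auto simp: good_def)
    have fl: "filterlim (\<lambda>n. w + of_nat n) (right_infinity \<bar>Re w\<bar>) sequentially"
      using tendsto_add_filterlim_at_infinity[OF tendsto_const tendsto_of_nat_infinity, of w]
      by (auto simp: filterlim_inf filterlim_principal intro!: always_eventually)
    have "(\<lambda>n. f (w + of_nat n)) \<longlonglongrightarrow> of_real limit_f"
      by (rule filterlim_compose[OF f_tendsto fl]) simp
    hence "(\<lambda>n. f (w + of_nat n) * (GP vs (w + of_nat n) / ?E vs n) / (GP us (w + of_nat n) / ?E us n)) \<longlonglongrightarrow> of_real limit_f * 1 / 1"
      by (intro tendsto_divide tendsto_mult G) auto
    moreover have "f (w + of_nat n) * (GP vs (w + of_nat n) / ?E vs n) / (GP us (w + of_nat n) / ?E us n) = h w * X n" for n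
    proof -
      have "?E us n / ?E vs n = X n"
        unfolding X_def us(1) vs(1) by (simp add: exp_diff[symmetric] algebra_simps)
      moreover have "f (w + of_nat n) * (GP vs (w + of_nat n) / ?E vs n) / (GP us (w + of_nat n) / ?E us n) =
          h (w + of_nat n) * (?E us n / ?E vs n)"
        unfolding h_def by simp
      ultimately show ?thesis using h_n[OF w] by simp
    qed
    ultimately show ?thesis by simp
  qed
  obtain w0 where w0: "good w0"
    using eventually_happens[OF good_ev[of 0]] by auto
  have h_const: "h w = h w0" if w: "good w" for w
  proof -
    have "(\<lambda>n. h w * (h w0 * X n)) \<longlonglongrightarrow> h w * of_real limit_f"
      by (intro tendsto_mult tendsto_const h_lim w0)
    moreover have "(\<lambda>n. h w0 * (h w * X n)) \<longlonglongrightarrow> h w0 * of_real limit_f"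
      by (intro tendsto_mult tendsto_const h_lim w)
    hence "(\<lambda>n. h w * (h w0 * X n)) \<longlonglongrightarrow> h w0 * of_real limit_f" by (simp add: mult.left_commute)
    ultimately have "h w * of_real limit_f = h w0 * of_real limit_f" by (rule LIMSEQ_unique)
    thus ?thesis using limit_f_pos by simp
  qed
  have h0: "h w0 \<noteq> 0"
  proof
    assume "h w0 = 0"
    thus False using h_lim[OF w0] limit_f_pos by (simp add: LIMSEQ_const_iff)
  qed
  \<comment> \<open>A and B have equal leading coefficients, so the exponential base is d = 1 with
    logarithm L = 0.\<close>
  have "f w = h w0 * exp (w * 0) * (\<Prod>u\<leftarrow>us. Gamma (w + u)) / (\<Prod>v\<leftarrow>vs. Gamma (w + v))" if w: "good w" for w
  proof -
    have "GP us w \<noteq> 0" "GP vs w \<noteq> 0" using GP_nz w by (auto simp: good_def)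
    hence "f w = h w * GP us w / GP vs w" by (simp add: h_def)
    thus ?thesis unfolding h_const[OF w] GP_def by simp
  qed
  hence "eventually (\<lambda>w. f w = h w0 * exp (w * 0) * (\<Prod>u\<leftarrow>us. Gamma (w + u)) / (\<Prod>v\<leftarrow>vs. Gamma (w + v))) (cosparse UNIV)"
    unfolding eventually_cosparse_open_eq[OF open_UNIV] by (intro ballI eventually_mono[OF good_ev])
  hence "h w0 \<noteq> 0 \<and> (1::complex) \<noteq> 0 \<and> exp (0::complex) = 1 \<and>
     eventually (\<lambda>w. f w = h w0 * exp (w * 0) * (\<Prod>u\<leftarrow>us. Gamma (w + u)) / (\<Prod>v\<leftarrow>vs. Gamma (w + v))) (cosparse UNIV)"
    using h0 by simp
  thus ?thesis
    unfolding solves_problem_I_def hgf_eq_f by (intro exI)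
qed

end

section \<open>The parameters\<close>

lemma sum_nat_square_real: "(\<Sum>i<n. real i ^ 2) = real n * (real n - 1) * (2 * real n - 1) / 6"
  by (induction n) (auto simp: field_simps power2_eq_square)

lemma sum_shifted_squares:
  assumes "n > 0"
  shows "(\<Sum>i<n. ((b + real i) / real n) ^ 2) = (b ^ 2 + b * (real n - 1) + (real n - 1) * (2 * real n - 1) / 6) / real n"
proof -
  have "(\<Sum>i<n. ((b + real i) / real n) ^ 2) = (\<Sum>i<n. (b ^ 2 + 2 * b * real i + real i ^ 2) / real n ^ 2)"
    by (intro sum.cong refl) (simp add: power_divide power2_sum)
  also have "\<dots> = (\<Sum>i<n. b ^ 2 + 2 * b * real i + real i ^ 2) / real n ^ 2"
    by (rule sum_divide_distrib[symmetric])
  also have "(\<Sum>i<n. b ^ 2 + 2 * b * real i + real i ^ 2) = real n * b ^ 2 + 2 * b * (\<Sum>i<n. real i) + (\<Sum>i<n. real i ^ 2)"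
    by (simp add: sum.distrib sum_distrib_left)
  also have "\<dots> = real n * (b ^ 2 + b * (real n - 1) + (real n - 1) * (2 * real n - 1) / 6)"
    unfolding sum_nat_real sum_nat_square_real by (simp add: field_simps)
  finally show ?thesis using assms by (simp add: power2_eq_square)
qed

lemma of_real_in_Ints:
  assumes "complex_of_real y \<in> \<int>"
  obtains m where "y = real_of_int m"
  using assms by (metis Ints_cases of_real_eq_iff of_real_of_int_eq)

context gauss_family
begin

text \<open>For r = s p and a = J/s, the difference of the two sums of squares is the expression
  shown divided by s p (s - 1): p enters only through a positive factor.\<close>

lemma shift_inequality:
  fixes s :: nat and J :: real
  assumes s: "r = s * p" "2 \<le> s" and a: "a = J / real s"
    and le: "(sum_squares num_shifts) \<le> (sum_squares den_shifts)"
  shows "0 \<le> 17 * (real s - 1) / 12 - real s ^ 2 / 6 + J * (real s - 2 - J)"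
proof -
  define P S where "P = real p" and "S = real s"
  have PS: "P > 0" "S > 1" using p_pos s by (auto simp: P_def S_def)
  have r: "real r = S * P" by (simp add: s P_def S_def)
  have q: "real (r - p) = (S - 1) * P" using p_less_r by (simp add: of_nat_diff r P_def algebra_simps)
  have pos: "r > 0" "p > 0" "r - p > 0" using p_less_r p_pos by auto
  define g where "g = (\<lambda>b n :: real. (b ^ 2 + b * (n - 1) + (n - 1) * (2 * n - 1) / 6) / n)"
  have g: "(\<Sum>i<n. ((b + real i) / real n) ^ 2) = g b (real n)" if "n > 0" for n b
    unfolding g_def by (rule sum_shifted_squares[OF that])
  have g0: "(\<Sum>i<r. (real i / real r) ^ 2) = g 0 (real r)" using g[OF pos(1), of 0] by simp
  have den: "(sum_squares den_shifts) = g (-1) (real r) + g 0 (real r)"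
    unfolding den_shifts_def map_append map_map o_def sum_list_append sum_list_map_upt g[OF pos(1)] g0 ..
  have num: "(sum_squares num_shifts) = g (-1/2) (real r) + (g a (real p) + g (-a) (real (r - p)))"
    unfolding num_shifts_def map_append map_map o_def sum_list_append sum_list_map_upt
      g[OF pos(1)] g[OF pos(2)] g[OF pos(3)] ..
  have "0 \<le> (sum_squares den_shifts) - (sum_squares num_shifts)" using le by simp
  also have "\<dots> = g (-1) (S * P) + g 0 (S * P) - (g (-1/2) (S * P) + (g (J / S) P + g (- (J / S)) ((S - 1) * P)))"
    unfolding den num q r unfolding a S_def P_def ..
  also have "\<dots> = (17 * (S - 1) / 12 - S ^ 2 / 6 + J * (S - 2 - J)) / (S * P * (S - 1))"
    using PS unfolding g_def
    by (simp add: divide_simps) (simp add: algebra_simps power2_eq_square)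
  finally have "0 \<le> (17 * (S - 1) / 12 - S ^ 2 / 6 + J * (S - 2 - J)) / (S * P * (S - 1))" .
  moreover have "S * P * (S - 1) > 0" using PS by simp
  ultimately show ?thesis unfolding S_def[symmetric] by (simp add: zero_le_divide_iff)
qed

text \<open>Integrality is used at the points where al is 0 and 1. There ga equals -r a / p and r (1
  - a) / p; the difference is r/p, and the first value is -s a.\<close>

lemma cross_relation_parameters:
  assumes rel: "cross_relation"
  obtains s :: nat and m :: int where "r = s * p" "2 \<le> s" "a = real_of_int m / real s"
proof -
  have "al (of_real (- a / real p)) = 0" "al (of_real ((1 - a) / real p)) = 1"
    using p_pos by (simp_all add: al_def)
  hence "ga (of_real (- a / real p)) \<in> \<int>" "ga (of_real ((1 - a) / real p)) \<in> \<int>"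
    by (intro cross_relation_integrality[OF rel]; simp)+
  hence "complex_of_real (real r * (- a / real p)) \<in> \<int>" "complex_of_real (real r * ((1 - a) / real p)) \<in> \<int>"
    by (simp_all only: ga_def of_real_mult of_real_of_nat_eq)
  then obtain m1 m2 where m: "real r * (- a / real p) = real_of_int m1" "real r * ((1 - a) / real p) = real_of_int m2"
    using of_real_in_Ints by metis
  have "real r / real p = real_of_int (m2 - m1)"
    unfolding of_int_diff m[symmetric] by (simp add: diff_divide_distrib right_diff_distrib)
  hence rp: "real r = real_of_int (m2 - m1) * real p" using p_pos by (simp add: field_simps)
  have "m2 - m1 > 0"
  proof (rule ccontr)
    assume "\<not> m2 - m1 > 0"
    hence "real_of_int (m2 - m1) \<le> 0" by linarith
    hence "real r \<le> 0" unfolding rp by (intro mult_nonpos_nonneg) auto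
    thus False using r_pos by simp
  qed
  define s where "s = nat (m2 - m1)"
  have s: "real s = real_of_int (m2 - m1)" using \<open>m2 - m1 > 0\<close> by (simp add: s_def)
  have "real r = real (s * p)" using rp s by simp
  hence r: "r = s * p" by (simp only: of_nat_eq_iff)
  have "s \<noteq> 0" "s \<noteq> 1" using p_less_r r by (auto intro: Nat.gr0I)
  hence s2: "2 \<le> s" by simp
  have "a = real_of_int (- m1) / real s"
    using m(1) p_pos s2 by (simp add: r field_simps)
  thus ?thesis using r s2 that by blast
qed

text \<open>Positivity of the right-hand side forces the sign (-1)^(r-p) to be 1. Then both sides
  are p-th powers of positive numbers, and taking the root removes p.\<close>

lemma balance_condition:
  fixes s :: nat
  assumes s: "r = s * p" "2 \<le> s"
    and eq: "(-1) ^ (r - p) * (1 - x) ^ (r - p) / x ^ r = real p ^ p * real (r - p) ^ (r - p) / real r ^ r"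
  shows "even (p * (s - 1))" "(real s - 1) ^ (s - 1) * x ^ s - real s ^ s * (1 - x) ^ (s - 1) = 0"
proof -
  have q: "r - p = (s - 1) * p" using s by (simp add: diff_mult_distrib)
  have "0 < real p ^ p * real (r - p) ^ (r - p) / real r ^ r"
    using p_pos p_less_r by (intro divide_pos_pos mult_pos_pos zero_less_power) auto
  hence pos: "0 < (-1) ^ (r - p) * ((1 - x) ^ (r - p) / x ^ r)" unfolding eq[symmetric] by simp
  have ev: "even (r - p)"
  proof (rule ccontr)
    assume "odd (r - p)"
    hence "(-1) ^ (r - p) * ((1 - x) ^ (r - p) / x ^ r) = - ((1 - x) ^ (r - p) / x ^ r)" by simp
    also have "\<dots> \<le> 0" using x_pos x_less_1 by simp
    finally show False using pos by simp
  qed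
  thus "even (p * (s - 1))" unfolding q by (simp only: mult.commute)
  have S: "real s - 1 = real (s - 1)" using s by (simp add: of_nat_diff)
  have "((1 - x) ^ (s - 1) / x ^ s) ^ p = (1 - x) ^ (r - p) / x ^ r"
    unfolding power_divide power_mult[symmetric] q unfolding s(1) ..
  also have "\<dots> = real p ^ p * real (r - p) ^ (r - p) / real r ^ r"
    unfolding eq[symmetric] using ev by simp
  also have "\<dots> = (real (s - 1) ^ (s - 1) / real s ^ s) ^ p"
  proof -
    have e: "p + (s - 1) * p = s * p" using s(2) by (cases s) auto
    have "real p ^ p * real (r - p) ^ (r - p) = (real p ^ p * real p ^ ((s - 1) * p)) * real (s - 1) ^ ((s - 1) * p)"
      unfolding q by (simp add: power_mult_distrib)
    also have "real p ^ p * real p ^ ((s - 1) * p) = real p ^ (s * p)"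
      unfolding power_add[symmetric] e ..
    finally have "real p ^ p * real (r - p) ^ (r - p) / real r ^ r =
        real p ^ (s * p) * real (s - 1) ^ ((s - 1) * p) / (real s ^ (s * p) * real p ^ (s * p))"
      unfolding s(1) by (simp add: power_mult_distrib)
    also have "\<dots> = real (s - 1) ^ ((s - 1) * p) / real s ^ (s * p)"
      using p_pos by simp
    finally show ?thesis unfolding power_divide power_mult[symmetric] .
  qed
  finally have "(1 - x) ^ (s - 1) / x ^ s = real (s - 1) ^ (s - 1) / real s ^ s"
    using x_pos x_less_1 p_pos by (rule_tac power_eq_imp_eq_base) auto
  thus "(real s - 1) ^ (s - 1) * x ^ s - real s ^ s * (1 - x) ^ (s - 1) = 0"
    using x_pos s unfolding S by (simp add: field_simps)
qed

lemma infinite_poles: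
  fixes s j :: nat
  assumes s: "r = s * p" "2 \<le> s" and a: "a = real j / real s"
  shows "infinite {w. is_pole f w}"
proof -
  \<comment> \<open>At these poles of Gamma (ga w), al w is congruent to -1/s modulo 1, so no factor of the numerators vanishes.\<close>
  define n where "n = (\<lambda>m::nat. j + 1 + s * m)"
  define w where "w = (\<lambda>m. complex_of_real (- real (n m) / real r))"
  have "is_pole f (w m)" for m
  proof (rule is_pole_f)
    define \<alpha> where "\<alpha> = (real j - real (n m)) / real s"
    show g: "ga (w m) = - of_nat (n m)" using r_pos by (simp add: ga_def w_def)
    have rs: "real r = real s * real p" by (simp add: s)
    have "real p * (- real (n m) / real r) + a = \<alpha>"
      unfolding rs a \<alpha>_def using p_pos s by (simp add: field_simps)
    hence al: "al (w m) = of_real \<alpha>" unfolding al_def w_def by (metis of_real_add of_real_mult of_real_of_nat_eq)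
    have "pochhammer \<alpha> (n m + 1) \<noteq> 0"
    proof
      assume "pochhammer \<alpha> (n m + 1) = 0"
      then obtain k where "\<alpha> = - real k" by (auto simp: pochhammer_eq_0_iff)
      hence "real (n m) = real j + real k * real s"
        unfolding \<alpha>_def using s by (simp add: field_simps)
      hence "n m = j + k * s" by (metis of_nat_add of_nat_eq_iff of_nat_mult)
      hence "1 + s * m = s * k" by (simp add: n_def mult.commute)
      hence "s dvd 1" by (metis dvd_add_left_iff dvd_triv_left)
      thus False using s by simp
    qed
    moreover have "0 < \<alpha> + real (n m) + 1"
    proof -
      have "- real (n m) \<le> real j - real (n m)" by simp
      also have "\<dots> = \<alpha> * real s" using s by (simp add: \<alpha>_def)
      finally have 1: "- real (n m) \<le> \<alpha> * real s" .
      have "- real (n m) \<le> \<alpha>"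
      proof (cases "\<alpha> \<ge> 0")
        case False
        hence "real s * \<alpha> \<le> 1 * \<alpha>" using s by (intro mult_right_mono_neg) auto
        thus ?thesis using 1 by (simp add: mult.commute)
      qed (use of_nat_0_le_iff[of "n m"] in linarith)
      thus ?thesis by simp
    qed
    ultimately show "freg (w m) \<noteq> 0" by (intro freg_nonzero[OF g al])
  qed
  hence "range w \<subseteq> {w. is_pole f w}" by auto
  moreover have "inj w"
    using r_pos s by (auto simp: inj_def w_def n_def)
  hence "infinite (range w)" by (simp add: finite_image_iff)
  ultimately show ?thesis using infinite_super by blast
qed

lemma fd_node:
  assumes "k + k' = r - 1"
  shows "fd (node k + 1) = dual_f (node k')"
  unfolding fd_eq node_dual[OF assms] ..

end

text \<open>The left-hand side is gamma - alpha at the node with index k, the parameter that Euler's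
  transformation puts into the terminating series; this is the origin of \<open>chi\<close>.\<close>

lemma chi_eq:
  assumes "r = s * p" "0 < p" "2 \<le> s"
  shows "(1/2 - real k) * (1 - real p / real r) - real j / real s = chi j k s"
proof -
  have "real p / real r = 1 / real s" using assms by simp
  thus ?thesis using assms by (simp add: chi_def field_simps)
qed

theorem mainTheorem5:
  fixes p r :: nat and a x :: real
  assumes "0 < p" and "p < r" and "0 < x" and "x < 1"
  defines "a' \<equiv> 1 - 2 * real p / real r - a"
  shows "(solves_problem_I (real p) 0 (real r) a (1/2) x \<and> \<not> elementary (real p) 0 (real r) a (1/2) x \<and>
          solves_problem_I (real p) 0 (real r) a' (1/2) x \<and> \<not> elementary (real p) 0 (real r) a' (1/2) x)
     \<longleftrightarrow>
         (\<exists>s::nat. r = s * p \<and> s \<ge> 2 \<and> even (p * (s - 1)) \<and>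
            (real s - 1) ^ (s - 1) * x ^ s - real s ^ s * (1 - x) ^ (s - 1) = 0 \<and>
            (\<exists>j j' :: nat. j + j' = s - 2 \<and> a = real j / real s \<and> a' = real j' / real s \<and>
               (\<forall>k k' :: nat. k + k' = r - 1 \<longrightarrow>
                  Fk k (chi j k s) (1/2 - real k) x * Fk k' (chi j' k' s) (1/2 - real k') x = 0)))"
    (is "?lhs \<longleftrightarrow> ?rhs")
proof -
  interpret G: gauss_family p r a x using assms by unfold_locales
  interpret D: gauss_family p r a' x by (rule G.gauss_family_axioms)
  have dd: "1 - 2 * real p / real r - a' = a" by (simp add: a'_def)
  have Gf: "G.f (G.node k) = 0 \<longleftrightarrow> Fk k (chi j k s) (1/2 - real k) x = 0"
    if "r = s * p" "2 \<le> s" "a = real j / real s" for s j k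
    using G.f_node_eq_0_iff[of k] chi_eq[OF that(1) assms(1) that(2), of k j] that(3) by simp
  have Df: "D.f (D.node k) = 0 \<longleftrightarrow> Fk k (chi j k s) (1/2 - real k) x = 0"
    if "r = s * p" "2 \<le> s" "a' = real j / real s" for s j k
    using D.f_node_eq_0_iff[of k] chi_eq[OF that(1) assms(1) that(2), of k j] that(3) by simp
  have Gfd: "G.fd (G.node k + 1) = D.f (D.node k')" if "k + k' = r - 1" for k k'
    using G.fd_node[OF that] by (simp add: a'_def)
  have Dfd: "D.fd (D.node k + 1) = G.f (G.node k')" if "k + k' = r - 1" for k k'
    using D.fd_node[OF that] unfolding dd .
  show ?thesis
  proof
    assume lhs: ?lhs
    obtain A B where AB: "A \<noteq> 0" "B \<noteq> 0" "\<And>w. G.ga w \<notin> \<int>\<^sub>\<le>\<^sub>0 \<Longrightarrow> poly A w * G.f (w + 1) = poly B w * G.f w"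
      using G.gamma_product_recurrence lhs by blast
    obtain A' B' where AB': "A' \<noteq> 0" "B' \<noteq> 0" "\<And>w. G.ga w \<notin> \<int>\<^sub>\<le>\<^sub>0 \<Longrightarrow> poly A' w * G.dual_f (w + 1) = poly B' w * G.dual_f w"
      using D.gamma_product_recurrence lhs unfolding a'_def by blast
    let ?A' = "A' \<circ>\<^sub>p G.reflection" and ?B' = "B' \<circ>\<^sub>p G.reflection"
    have nz: "?A' \<noteq> 0" "?B' \<noteq> 0"
      using AB'(1,2) by (simp_all add: pcompose_eq_0_iff G.reflection_def)
    have inf: "infinite {w. is_pole G.f w}"
      using lhs by (simp add: elementary_def G.hgf_eq_f)
    have rel: "G.cross_relation" "G.rel_poly * A * ?A' = G.shift_poly * B * ?B'"
      using G.rational_ratios_imp_cross_relation[OF AB nz G.dual_recurrence[OF AB'(3)] inf] by blast+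
    have asym: "(-1) ^ (r - p) * (1 - x) ^ (r - p) / x ^ r = real p ^ p * real (r - p) ^ (r - p) / real r ^ r"
      "2 * p \<le> r \<Longrightarrow> (\<Sum>z\<leftarrow>G.num_shifts. z ^ 2) \<le> (\<Sum>z\<leftarrow>G.den_shifts. z ^ 2)"
      using G.necessary_asymptotics[of A B A' B'] AB AB' rel(2) by blast+
    obtain s m where s: "r = s * p" "2 \<le> s" "a = real_of_int m / real s"
      using G.cross_relation_parameters[OF rel(1)] by blast
    have "2 * p \<le> r" using s by simp
    from G.shift_inequality[OF s asym(2)[OF this]]
    have ineq: "0 \<le> 17 * (real s - 1) / 12 - real s ^ 2 / 6 + real_of_int m * (real s - 2 - real_of_int m)" .
    \<comment> \<open>The square gives 2 s^2 >= 5 s - 25/8 > 5 s - 5.\<close>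
    have quad: "5 * (real s - 1) / 12 < real s ^ 2 / 6"
    proof -
      have "0 \<le> (real s - 5/4) ^ 2" by simp
      thus ?thesis by (simp add: power2_eq_square field_simps)
    qed
    \<comment> \<open>Symmetric in the two numerators of a and a', which sum to s - 2: if one is at
      most -1, the other is at least s - 1 and the product is at most -(s - 1). It serves once for
      each of them.\<close>
    have no_neg: False if "u \<le> -1" "u + v = real s - 2" "0 \<le> 17 * (real s - 1) / 12 - real s ^ 2 / 6 + u * v" for u v :: real
    proof -
      have v: "real s - 1 \<le> v" using that by linarith
      have "u * v \<le> (-1) * v" using that(1) v s(2) by (intro mult_right_mono) auto
      hence "u * v \<le> - (real s - 1)" using v by simp
      moreover have "5 * real s - 5 < 2 * real s ^ 2" using quad by (simp add: field_simps)
      moreover have "0 \<le> 17 * real s - 17 - 2 * real s ^ 2 + 12 * (u * v)" using that(3) by (simp add: field_simps)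
      ultimately show False by linarith
    qed
    have "m \<ge> 0"
    proof (rule ccontr)
      assume "\<not> m \<ge> 0"
      hence "real_of_int m \<le> -1" by linarith
      from no_neg[OF this _ ineq] show False by simp
    qed
    have "m \<le> int s - 2"
    proof (rule ccontr)
      assume "\<not> m \<le> int s - 2"
      hence "real s - 2 - real_of_int m \<le> -1" by linarith
      from no_neg[OF this, of "real_of_int m"] ineq show False by (simp add: mult.commute)
    qed
    define j j' where "j = nat m" and "j' = nat (int s - 2 - m)"
    have jj: "j + j' = s - 2" using \<open>m \<ge> 0\<close> \<open>m \<le> int s - 2\<close> by (simp add: j_def j'_def)
    have aj: "a = real j / real s" using s(3) \<open>m \<ge> 0\<close> by (simp add: j_def)
    have "real p / real r = 1 / real s" using s assms(1) by simp
    moreover have "real j' = real s - 2 - real j"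
      using jj s(2) by (metis add_diff_cancel_left' of_nat_add of_nat_diff of_nat_numeral)
    ultimately have aj': "a' = real j' / real s"
      using s(2) aj assms(1) by (simp add: a'_def field_simps)
    have "Fk k (chi j k s) (1/2 - real k) x * Fk k' (chi j' k' s) (1/2 - real k') x = 0" if k: "k + k' = r - 1" for k k'
    proof -
      have "k < r" using k G.r_pos by linarith
      from G.nodes_if_cross_relation[OF rel(1) this] Gfd[OF k] Gf[OF s(1,2) aj, of k] Df[OF s(1,2) aj', of k']
      show ?thesis by auto
    qed
    thus ?rhs using s(1,2) G.balance_condition[OF s(1,2) asym(1)] jj aj aj' by blast
  next
    assume ?rhs
    then obtain s j j' where s: "r = s * p" "2 \<le> s" and j: "a = real j / real s" "a' = real j' / real s"
      and F: "\<And>k k'. k + k' = r - 1 \<Longrightarrow> Fk k (chi j k s) (1/2 - real k) x * Fk k' (chi j' k' s) (1/2 - real k') x = 0"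
      by blast
    have "G.cross_relation"
    proof (rule G.cross_relation_if_nodes)
      fix k assume "k < r"
      hence k: "k + (r - 1 - k) = r - 1" by simp
      show "G.f (G.node k) * G.fd (G.node k + 1) = 0"
        using F[OF k] Gf[OF s j(1), of k] Df[OF s j(2), of "r - 1 - k"] Gfd[OF k] by auto
    qed
    \<comment> \<open>For the dual the roles of k and k' are interchanged, so the same products
      vanish.\<close>
    moreover have "D.cross_relation"
    proof (rule D.cross_relation_if_nodes)
      fix k assume "k < r"
      hence k: "k + (r - 1 - k) = r - 1" "(r - 1 - k) + k = r - 1" by simp_all
      show "D.f (D.node k) * D.fd (D.node k + 1) = 0"
        using F[OF k(2)] Df[OF s j(2), of k] Gf[OF s j(1), of "r - 1 - k"] Dfd[OF k(1)] by auto
    qed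
    moreover have "infinite {w. is_pole G.f w}" "infinite {w. is_pole D.f w}"
      using G.infinite_poles[OF s j(1)] D.infinite_poles[OF s j(2)] by auto
    ultimately show ?lhs
      using G.cross_relation_imp_gamma_product D.cross_relation_imp_gamma_product
      by (simp add: elementary_def G.hgf_eq_f D.hgf_eq_f)
  qed
qed

end
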